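(* Let $(X,T,\mu)$ be a measure-preserving system as in the context that satisfies the Multiple Decorrelation condition. Let $(r_n)_{n\ge 1}$ be a sequence of positive real numbers, and define $$\sigma_n^2=\operatorname{Var}\Bigl(x\mapsto\sum_{k=1}^n \mathbf 1_{B(x,r_k)}(T^kx)-\mu(B(x,r_k))\Bigr),\qquad s_n^2(y)=\operatorname{Var}\Bigl(x\mapsto\sum_{k=1}^n \mathbf 1_{B(y,r_k)}(T^kx)-\mu(B(y,r_k))\Bigr).$$ Assume that: (i) $d\mu=h\,dm$ for a density $h\in L^q(m)$ satisfying $h\ge c>0$, for some $q\ge 2$ and $c>0$; (ii) $(r_n)$ satisfies condition $\mathcal S(\gamma,\upsilon)$ for some $\gamma\in(0,1/\dim X)$ and $\upsilon>p/\dim X$, where $p$ is the Hölder conjugate of $q$; (iii) for $\mu$-a.e. $y\in X$, the functions $\frac1{s_n(y)}\sum_{k=1}^n\bigl(\mathbf 1_{B(y,r_k)}\circ T^k-\mu(B(y,r_k))\bigr)$ on $(X,\mu)$ converge in distribution to $N(0,1)$ as $n\to\infty$; (iv) $$\lim_{n\to\infty}\int_X\Bigl|\frac{s_n(y)}{\sigma_n}-\frac{\sqrt{h(y)}}{\sqrt{\mu(h)}}\Bigr|\,d\mu(y)=0.$$ Then, for all $t\in\mathbb R$, $$\lim_{n\to\infty}\int_X\exp\Bigl(\frac{it}{\sigma_n}\sum_{k=1}^n\bigl(\mathbf 1_{B(x,r_k)}(T^kx)-\mu(B(x,r_k))\bigr)\Bigr)d\mu(x)=\int_X\exp\Bigl(-\frac{h(x)}{2\mu(h)}t^2\Bigr)d\mu(x).$$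 The limiting distribution is not Gaussian unless $h=1$ ($\mu$-a.e.).
   Context: $(X,d)$ is a smooth compact Riemannian manifold; $(X,T,\mu)$ is a measure-preserving system: $\mu$ is a non-atomic Borel probability measure on $X$ and $T:X\to X$ is measurable and preserves $\mu$. $m$ denotes the Lebesgue (Riemannian volume) measure on $X$, normalised to $m(X)=1$. $B(x,r)$ is the open ball with centre $x$ and radius $r$. For a function $f$, $\mu(f)=\int_X f\,d\mu$; $\operatorname{Cov}(f,g)=\mu(fg)-\mu(f)\mu(g)$, $\operatorname{Var}(f)=\operatorname{Cov}(f,f)$ (for real $f$). For $\alpha\in(0,1]$, $\mathcal H_\alpha(\mathbb C)$ is the space of complex-valued $\alpha$-Hölder functions on $X$, $\|f\|_\infty=\sup|f|$ and $|f|_\alpha=\sup_{x\ne y}|f(x)-f(y)|/d(x,y)^\alpha$. **Multiple Decorrelation.** For every $\alpha\in(0,1]$ there exist $r\ge1$, $\tau_r>0$ and a polynomial $P_r$ with real non-negative coefficients such that, for all integers $m_1,m_2,N\ge0$, all integer sequences $0\le k_1\le\dots\le k_{m_1}$ and $0\le l_1\le\dots\le l_{m_2}$, and all $\varphi_1,\dots,\varphi_{m_1+m_2}\in\mathcal H_\alpha(\mathbb C)$, $$\Bigl|\operatorname{Cov}\Bigl(\prod_{i=1}^{m_1}\varphi_i\circ T^{k_i},\prod_{j=1}^{m_2}\varphi_{m_1+j}\circ T^{N+l_j}\Bigr)\Bigr|\le\Bigl(\prod_{i=1}^{m_1+m_2}\|\varphi_i\|_\infty+\sum_{i=1}^{m_1+m_2}|\varphi_i|_\alpha\prod_{j\ne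 i}\|\varphi_j\|_\infty\Bigr)P_r(l_{m_2})e^{-\tau_r(N-rk_{m_1})}.$$ **Condition $\mathcal S(\gamma,\upsilon)$** for a sequence $(a_n)$: $(a_n)$ is monotone decreasing and there is a constant $C>0$ with $C^{-1}n^{-\gamma}\le a_n\le C(\log n)^{-\upsilon}$ for all $n\in\mathbb N$ (the upper bound being vacuous for $n=1$). *)

theory Defs
  imports "HOL-Probability.Probability" "HOL-Computational_Algebra.Polynomial"
begin

section \<open>Smooth maps between Euclidean spaces\<close>

text \<open>Intended for open sets only: all derivatives are taken with respect to a full
  neighbourhood. Being \<open>C\<^sup>k\<close> is expressed by iterated directional derivatives.\<close>

fun Ck_on :: "nat \<Rightarrow> 'a::euclidean_space set \<Rightarrow> ('a \<Rightarrow> 'b::real_normed_vector) \<Rightarrow> bool" where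
  "Ck_on 0 S f \<longleftrightarrow> continuous_on S f"
| "Ck_on (Suc k) S f \<longleftrightarrow> (\<forall>x\<in>S. f differentiable (at x)) \<and>
     (\<forall>v. Ck_on k S (\<lambda>x. frechet_derivative f (at x) v))"

definition smooth_on :: "'a::euclidean_space set \<Rightarrow> ('a \<Rightarrow> 'b::real_normed_vector) \<Rightarrow> bool" where
  "smooth_on S f \<longleftrightarrow> (\<forall>k. Ck_on k S f)"

section \<open>Riemannian manifolds\<close>

text \<open>A chart \<open>(U, \<phi>)\<close> consists of its domain and its coordinate map, the values of \<open>\<phi>\<close> outside
  \<open>U\<close> being irrelevant. The manifold is the whole type \<open>'a\<close>, of dimension \<open>CARD('n)\<close>.
  The metric tensor is given by its local representations: \<open>g (U, \<phi>) x\<close> is the Gram matrix at the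
  point \<open>x \<in> U\<close> of the coordinate frame of \<open>\<phi>\<close>.\<close>

type_synonym ('a, 'n) chart = "'a set \<times> ('a \<Rightarrow> real ^ 'n)"
type_synonym ('a, 'n) tensor = "('a, 'n) chart \<Rightarrow> 'a \<Rightarrow> real ^ 'n ^ 'n"

definition smooth_atlas :: "('a::topological_space, 'n::finite) chart set \<Rightarrow> bool" where
  "smooth_atlas A \<longleftrightarrow>
     (\<Union>(U, \<phi>)\<in>A. U) = UNIV \<and>
     (\<forall>(U, \<phi>)\<in>A. open U \<and> open (\<phi> ` U) \<and> homeomorphism U (\<phi> ` U) \<phi> (inv_into U \<phi>)) \<and>
     (\<forall>(U, \<phi>)\<in>A. \<forall>(V, \<psi>)\<in>A. smooth_on (\<phi> ` (U \<inter> V)) (\<psi> \<circ> inv_into U \<phi>))"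

definition riemannian_metric_tensor ::
    "('a::topological_space, 'n::finite) chart set \<Rightarrow> ('a, 'n) tensor \<Rightarrow> bool" where
  "riemannian_metric_tensor A g \<longleftrightarrow>
     (\<forall>(U, \<phi>)\<in>A. smooth_on (\<phi> ` U) (g (U, \<phi>) \<circ> inv_into U \<phi>) \<and>
        (\<forall>x\<in>U. transpose (g (U, \<phi>) x) = g (U, \<phi>) x \<and>
               (\<forall>v. v \<noteq> 0 \<longrightarrow> 0 < v \<bullet> (g (U, \<phi>) x *v v)))) \<and>
     (\<forall>(U, \<phi>)\<in>A. \<forall>(V, \<psi>)\<in>A. \<forall>x\<in>U \<inter> V.
        let J = matrix (frechet_derivative (\<psi> \<circ> inv_into U \<phi>) (at (\<phi> x)))
        in g (U, \<phi>) x = transpose J ** g (V, \<psi>) x ** J)"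

definition piecewise_C1_path ::
    "('a::topological_space, 'n::finite) chart set \<Rightarrow> (real \<Rightarrow> 'a) \<Rightarrow> bool" where
  "piecewise_C1_path A \<gamma> \<longleftrightarrow> path \<gamma> \<and>
     (\<forall>(U, \<phi>)\<in>A. \<forall>a b. 0 \<le> a \<and> a \<le> b \<and> b \<le> 1 \<and> \<gamma> ` {a..b} \<subseteq> U \<longrightarrow>
        (\<phi> \<circ> \<gamma>) piecewise_C1_differentiable_on {a..b})"

text \<open>The chart chosen below does not matter: at every point of differentiability, the speeds
  computed in different charts agree by the transformation rule of the metric tensor.\<close>

definition path_speed ::
    "('a::topological_space, 'n::finite) chart set \<Rightarrow> ('a, 'n) tensor \<Rightarrow> (real \<Rightarrow> 'a) \<Rightarrow> real \<Rightarrow> real"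
  where
  "path_speed A g \<gamma> t =
     (let c = (SOME c. c \<in> A \<and> \<gamma> t \<in> fst c);
          v = vector_derivative (snd c \<circ> \<gamma>) (at t)
      in sqrt (v \<bullet> (g c (\<gamma> t) *v v)))"

text \<open>The derivative of a piecewise \<open>C\<^sup>1\<close> path in the sense of the library may be unbounded near the
  exceptional points, so that the length may be infinite; this does not affect infima.\<close>

definition path_length ::
    "('a::topological_space, 'n::finite) chart set \<Rightarrow> ('a, 'n) tensor \<Rightarrow> (real \<Rightarrow> 'a) \<Rightarrow> ennreal" where
  "path_length A g \<gamma> = (\<integral>\<^sup>+t\<in>{0..1}. ennreal (path_speed A g \<gamma> t) \<partial>lborel)"

text \<open>The metric of the type class is required to be the Riemannian distance. As it is finite,
  the manifold is connected.\<close>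

definition riemannian_manifold ::
    "('a::metric_space, 'n::finite) chart set \<Rightarrow> ('a, 'n) tensor \<Rightarrow> bool" where
  "riemannian_manifold A g \<longleftrightarrow>
     smooth_atlas A \<and> riemannian_metric_tensor A g \<and>
     (\<forall>x y. ennreal (dist x y) =
        (INF \<gamma>\<in>{\<gamma>. piecewise_C1_path A \<gamma> \<and> pathstart \<gamma> = x \<and> pathfinish \<gamma> = y}. path_length A g \<gamma>))"

text \<open>The Riemannian volume is the unique Borel measure given in every chart by
  \<open>sqrt (det g)\<close> times Lebesgue measure.\<close>

definition riemannian_volume ::
    "('a::topological_space, 'n::finite) chart set \<Rightarrow> ('a, 'n) tensor \<Rightarrow> 'a measure \<Rightarrow> bool" where
  "riemannian_volume A g vol \<longleftrightarrow> sets vol = sets borel \<and>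
     (\<forall>(U, \<phi>)\<in>A. \<forall>E\<in>sets borel. E \<subseteq> U \<longrightarrow>
        emeasure vol E =
          (\<integral>\<^sup>+u\<in>\<phi> ` E. ennreal (sqrt (det (g (U, \<phi>) (inv_into U \<phi> u)))) \<partial>lborel))"

section \<open>Measure-preserving systems and decorrelation\<close>

definition non_atomic :: "'a measure \<Rightarrow> bool" where
  "non_atomic M \<longleftrightarrow> (\<forall>A\<in>sets M. 0 < emeasure M A \<longrightarrow>
     (\<exists>B\<in>sets M. B \<subseteq> A \<and> 0 < emeasure M B \<and> emeasure M B < emeasure M A))"

definition measure_preserving_system :: "('a::topological_space) measure \<Rightarrow> ('a \<Rightarrow> 'a) \<Rightarrow> bool" where
  "measure_preserving_system M T \<longleftrightarrow>
     prob_space M \<and> sets M = sets borel \<and> non_atomic M \<and> T \<in> measurable M M \<and> distr M M T = M"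

definition Cov ::
    "'a measure \<Rightarrow> ('a \<Rightarrow> 'b) \<Rightarrow> ('a \<Rightarrow> 'b) \<Rightarrow> 'b::{real_normed_field, banach, second_countable_topology}"
  where
  "Cov M f g = (LINT x|M. f x * g x) - (LINT x|M. f x) * (LINT x|M. g x)"

definition Var :: "'a measure \<Rightarrow> ('a \<Rightarrow> real) \<Rightarrow> real" where
  "Var M f = Cov M f f"

definition holder :: "real \<Rightarrow> ('a::metric_space \<Rightarrow> complex) \<Rightarrow> bool" where
  "holder \<alpha> f \<longleftrightarrow> (\<exists>L. \<forall>x y. norm (f x - f y) \<le> L * dist x y powr \<alpha>)"

definition sup_norm :: "('a \<Rightarrow> complex) \<Rightarrow> real" where
  "sup_norm f = (SUP x. norm (f x))"

definition holder_seminorm :: "real \<Rightarrow> ('a::metric_space \<Rightarrow> complex) \<Rightarrow> real" where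
  "holder_seminorm \<alpha> f = Sup {norm (f x - f y) / dist x y powr \<alpha> |x y. x \<noteq> y}"

text \<open>If \<open>m1 = 0\<close> or \<open>m2 = 0\<close>, the covariance vanishes and the right-hand side is nonnegative, so
  the values \<open>k 0\<close> and \<open>l 0\<close> occurring in that case are irrelevant.\<close>

definition multiple_decorrelation :: "'a::metric_space measure \<Rightarrow> ('a \<Rightarrow> 'a) \<Rightarrow> bool" where
  "multiple_decorrelation M T \<longleftrightarrow>
     (\<forall>\<alpha>::real. 0 < \<alpha> \<and> \<alpha> \<le> 1 \<longrightarrow>
       (\<exists>(r::real) (\<tau>::real) (P::real poly). 1 \<le> r \<and> 0 < \<tau> \<and> (\<forall>i. 0 \<le> coeff P i) \<and>
         (\<forall>(m1::nat) (m2::nat) (N::nat) (k::nat \<Rightarrow> nat) (l::nat \<Rightarrow> nat) (\<phi>::nat \<Rightarrow> 'a \<Rightarrow> complex).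
            mono_on {1..m1} k \<and> mono_on {1..m2} l \<and> (\<forall>i\<in>{1..m1 + m2}. holder \<alpha> (\<phi> i)) \<longrightarrow>
            norm (Cov M (\<lambda>x. \<Prod>i=1..m1. \<phi> i ((T ^^ k i) x))
                        (\<lambda>x. \<Prod>j=1..m2. \<phi> (m1 + j) ((T ^^ (N + l j)) x)))
            \<le> ((\<Prod>i=1..m1 + m2. sup_norm (\<phi> i)) +
                (\<Sum>i=1..m1 + m2. holder_seminorm \<alpha> (\<phi> i) *
                   (\<Prod>j\<in>{1..m1 + m2} - {i}. sup_norm (\<phi> j)))) *
              poly P (real (l m2)) * exp (- \<tau> * (real N - r * real (k m1))))))"

section \<open>Shrinking targets and recurrence\<close>

text \<open>Sequences are indexed by the positive integers; \<open>a 0\<close> is irrelevant.\<close>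

definition condition_S :: "real \<Rightarrow> real \<Rightarrow> (nat \<Rightarrow> real) \<Rightarrow> bool" where
  "condition_S \<gamma> \<upsilon> a \<longleftrightarrow>
     (\<forall>n\<ge>1. a (Suc n) \<le> a n) \<and>
     (\<exists>C>0. (\<forall>n\<ge>1. inverse C * real n powr (- \<gamma>) \<le> a n) \<and>
            (\<forall>n\<ge>2. a n \<le> C * ln (real n) powr (- \<upsilon>)))"

definition target_sum ::
    "'a::metric_space measure \<Rightarrow> ('a \<Rightarrow> 'a) \<Rightarrow> (nat \<Rightarrow> real) \<Rightarrow> 'a \<Rightarrow> nat \<Rightarrow> 'a \<Rightarrow> real" where
  "target_sum M T r y n x =
     (\<Sum>k=1..n. (indicator (ball y (r k)) ((T ^^ k) x) - measure M (ball y (r k))))"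

definition recurrence_sum ::
    "'a::metric_space measure \<Rightarrow> ('a \<Rightarrow> 'a) \<Rightarrow> (nat \<Rightarrow> real) \<Rightarrow> nat \<Rightarrow> 'a \<Rightarrow> real" where
  "recurrence_sum M T r n x =
     (\<Sum>k=1..n. (indicator (ball x (r k)) ((T ^^ k) x) - measure M (ball x (r k))))"

definition target_sd ::
    "'a::metric_space measure \<Rightarrow> ('a \<Rightarrow> 'a) \<Rightarrow> (nat \<Rightarrow> real) \<Rightarrow> nat \<Rightarrow> 'a \<Rightarrow> real" where
  "target_sd M T r n y = sqrt (Var M (target_sum M T r y n))"

definition recurrence_sd ::
    "'a::metric_space measure \<Rightarrow> ('a \<Rightarrow> 'a) \<Rightarrow> (nat \<Rightarrow> real) \<Rightarrow> nat \<Rightarrow> real" where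
  "recurrence_sd M T r n = sqrt (Var M (recurrence_sum M T r n))"

definition gaussian :: "real measure \<Rightarrow> bool" where
  "gaussian \<nu> \<longleftrightarrow> (\<exists>a s. 0 < s \<and> \<nu> = density lborel (\<lambda>x. ennreal (normal_density a s x)))"

end

theory Submission
  imports Defs "HOL-Real_Asymp.Real_Asymp"
begin

text \<open>
  Write \<open>S n y x\<close> for the centred number of visits of the orbit of \<open>x\<close> to the balls around \<open>y\<close>. The recurrence sum
  is the diagonal \<open>S n x x\<close>, whereas the hypothesis on targets concerns \<open>S n y x\<close> for fixed \<open>y\<close>. The idea is that
  after a time of order \<open>ln n\<close> the orbit of \<open>x\<close> no longer depends on \<open>x\<close>, so that the characteristic function of
  the diagonal is close to the average over \<open>y\<close> of the characteristic functions of the target sums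
  (\<open>characteristic_decoupling\<close>). Those converge to Gaussian ones with the deviation \<open>sqrt (h y / \<mu>(h))\<close> that the
  hypothesis on the ratios provides, and averaging them over \<open>y\<close> gives the limit
  (\<open>recurrence_characteristic_limit\<close>).

  Decoupling (\<open>decoupling\<close>) rests on multiple decorrelation, which requires regular functions: the dependence on
  the starting point is discretised by a Lipschitz partition of unity, and the indicators of balls are replaced by
  Lipschitz functions. The errors are governed by the measure of thin annuli, both around fixed points and around the
  starting point of the orbit. All these errors are kept polynomially small in \<open>n\<close>, which the exponential decay permits
  after a delay of order \<open>ln n\<close>.

  The visits before that delay are simply dropped. This is legitimate if the recurrence deviation grows faster than
  \<open>ln n\<close>. By the hypothesis on the ratios it suffices to bound the target variances from below
  (\<open>Var_target_sum_growth\<close>). The sum of the measures of the targets grows like a positive power of \<open>n\<close>, as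
  \<open>\<gamma> * dim X < 1\<close>, and negative correlations at times of order \<open>ln n\<close> cannot destroy it, because the targets have
  measure \<open>o (1 / ln n)\<close> by the upper bound on the radii.

  The geometry enters through two facts. Balls of radius \<open>r\<close> have volume of order \<open>r ^ dim X\<close>
  (\<open>ahlfors_regular_volume\<close>), by comparing the Riemannian distance with the Euclidean one in charts. And annuli of
  relative width \<open>s / r\<close> have measure at most a power of \<open>s / r\<close> (\<open>annulus_regular_of_ahlfors\<close>); this holds in every
  Ahlfors regular length space and needs no smoothness of spheres. A density in \<open>L\<^sup>q\<close> that is bounded below preserves
  such bounds with other exponents (\<open>ahlfors_regular_density\<close>).

  The limit is the characteristic function of a normal variable with an independent random variance proportional to
  \<open>h\<close>. If it were Gaussian, the Laplace transform of the variance would be a pure exponential, which forces the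
  variance, and hence \<open>h\<close>, to be constant; a constant probability density is \<open>1\<close>.
\<close>

section \<open>Path speed and arc length\<close>

locale tensor_atlas =
  fixes A :: "('a::metric_space, 'n::finite) chart set" and g :: "('a, 'n) tensor"
  assumes atlas: "smooth_atlas A" and tensor: "riemannian_metric_tensor A g"
begin

lemma chart_at: obtains U \<phi> where "(U, \<phi>) \<in> A" "x \<in> U"
  using atlas unfolding smooth_atlas_def by blast

lemma chart_props:
  assumes "(U, \<phi>) \<in> A"
  shows "open U" "open (\<phi> ` U)" "continuous_on U \<phi>" "inj_on \<phi> U" "continuous_on (\<phi> ` U) (inv_into U \<phi>)"
    and "\<And>x. x \<in> U \<Longrightarrow> inv_into U \<phi> (\<phi> x) = x"
    and "\<And>u. u \<in> \<phi> ` U \<Longrightarrow> inv_into U \<phi> u \<in> U \<and> \<phi> (inv_into U \<phi> u) = u"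
proof -
  have *: "open U" "open (\<phi> ` U)" and h: "homeomorphism U (\<phi> ` U) \<phi> (inv_into U \<phi>)"
    using atlas assms unfolding smooth_atlas_def by blast+
  then show "open U" "open (\<phi> ` U)" by auto
  show "continuous_on U \<phi>" "continuous_on (\<phi> ` U) (inv_into U \<phi>)"
    using h by (auto simp: homeomorphism_def)
  show i: "\<And>x. x \<in> U \<Longrightarrow> inv_into U \<phi> (\<phi> x) = x"
    using h by (auto simp: homeomorphism_def)
  then show "inj_on \<phi> U" by (metis inj_onI)
  show "\<And>u. u \<in> \<phi> ` U \<Longrightarrow> inv_into U \<phi> u \<in> U \<and> \<phi> (inv_into U \<phi> u) = u"
    by (simp add: f_inv_into_f inv_into_into)
qed

lemma transition_smooth:
  assumes "(U, \<phi>) \<in> A" "(V, \<psi>) \<in> A"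
  shows "smooth_on (\<phi> ` (U \<inter> V)) (\<psi> \<circ> inv_into U \<phi>)"
  using atlas assms unfolding smooth_atlas_def by blast

lemma transition_derivative:
  assumes "(U, \<phi>) \<in> A" "(V, \<psi>) \<in> A" "u \<in> \<phi> ` (U \<inter> V)"
  shows "(\<psi> \<circ> inv_into U \<phi> has_derivative frechet_derivative (\<psi> \<circ> inv_into U \<phi>) (at u)) (at u)"
    and "continuous_on (\<phi> ` (U \<inter> V)) (\<lambda>u. frechet_derivative (\<psi> \<circ> inv_into U \<phi>) (at u) v)"
proof -
  have "Ck_on (Suc 0) (\<phi> ` (U \<inter> V)) (\<psi> \<circ> inv_into U \<phi>)"
    using transition_smooth[OF assms(1,2)] unfolding smooth_on_def by blast
  with assms(3) show "(\<psi> \<circ> inv_into U \<phi> has_derivative frechet_derivative (\<psi> \<circ> inv_into U \<phi>) (at u)) (at u)"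
    "continuous_on (\<phi> ` (U \<inter> V)) (\<lambda>u. frechet_derivative (\<psi> \<circ> inv_into U \<phi>) (at u) v)"
    by (auto simp: frechet_derivative_works[symmetric])
qed

lemma tensor_continuous:
  assumes "(U, \<phi>) \<in> A"
  shows "continuous_on (\<phi> ` U) (\<lambda>u. g (U, \<phi>) (inv_into U \<phi> u))"
proof -
  have "Ck_on 0 (\<phi> ` U) (g (U, \<phi>) \<circ> inv_into U \<phi>)"
    using tensor assms unfolding riemannian_metric_tensor_def smooth_on_def by blast
  then show ?thesis by (simp add: o_def)
qed

lemma tensor_pos:
  assumes "(U, \<phi>) \<in> A" "x \<in> U" "v \<noteq> 0"
  shows "0 < v \<bullet> (g (U, \<phi>) x *v v)"
  using tensor assms unfolding riemannian_metric_tensor_def by blast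

text \<open>The transformation rule of the tensor makes the derivative of the transition map an isometry between
  the two coordinate descriptions of a tangent space.\<close>

lemma tensor_transform:
  assumes "(U, \<phi>) \<in> A" "(V, \<psi>) \<in> A" "x \<in> U" "x \<in> V"
  shows "v \<bullet> (g (U, \<phi>) x *v v) =
    frechet_derivative (\<psi> \<circ> inv_into U \<phi>) (at (\<phi> x)) v \<bullet>
      (g (V, \<psi>) x *v frechet_derivative (\<psi> \<circ> inv_into U \<phi>) (at (\<phi> x)) v)"
proof -
  define F where "F = frechet_derivative (\<psi> \<circ> inv_into U \<phi>) (at (\<phi> x))"
  define J where "J = matrix F"
  have "(\<psi> \<circ> inv_into U \<phi> has_derivative F) (at (\<phi> x))"
    unfolding F_def using assms by (intro transition_derivative(1)) auto
  then have lin: "linear F" by (rule has_derivative_linear)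
  then have J: "J *v v = F v" by (simp add: J_def matrix_works)
  have "g (U, \<phi>) x = transpose J ** g (V, \<psi>) x ** J"
    using tensor assms unfolding riemannian_metric_tensor_def J_def F_def Let_def by blast
  then have "v \<bullet> (g (U, \<phi>) x *v v) = v \<bullet> (transpose J *v (g (V, \<psi>) x *v (J *v v)))"
    by (simp add: matrix_vector_mul_assoc matrix_mul_assoc)
  also have "\<dots> = (J *v v) \<bullet> (g (V, \<psi>) x *v (J *v v))"
    by (metis dot_lmul_matrix transpose_matrix_vector transpose_transpose)
  finally show ?thesis by (simp add: J F_def)
qed

lemma chart_change_derivative:
  assumes "(U, \<phi>) \<in> A" "(V, \<psi>) \<in> A" "\<gamma> t \<in> U" "\<gamma> t \<in> V" "isCont \<gamma> t"
    and "(\<phi> \<circ> \<gamma> has_vector_derivative w) (at t)"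
  shows "(\<psi> \<circ> \<gamma> has_vector_derivative
            frechet_derivative (\<psi> \<circ> inv_into U \<phi>) (at (\<phi> (\<gamma> t))) w) (at t)"
proof -
  note c = chart_props[OF assms(1)]
  let ?F = "frechet_derivative (\<psi> \<circ> inv_into U \<phi>) (at (\<phi> (\<gamma> t)))"
  have F: "(\<psi> \<circ> inv_into U \<phi> has_derivative ?F) (at ((\<phi> \<circ> \<gamma>) t))"
    unfolding o_apply[of \<phi> \<gamma>] using assms by (intro transition_derivative(1)) auto
  have "((\<psi> \<circ> inv_into U \<phi>) \<circ> (\<phi> \<circ> \<gamma>) has_derivative ?F \<circ> (\<lambda>x. x *\<^sub>R w)) (at t)"
    using assms(6) F unfolding has_vector_derivative_def by (rule diff_chain_at)
  moreover have "?F \<circ> (\<lambda>x. x *\<^sub>R w) = (\<lambda>x. x *\<^sub>R ?F w)"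
    using has_derivative_linear[OF F] by (auto simp: linear_cmul)
  ultimately have "((\<psi> \<circ> inv_into U \<phi>) \<circ> (\<phi> \<circ> \<gamma>) has_vector_derivative ?F w) (at t)"
    by (simp add: has_vector_derivative_def)
  moreover have "eventually (\<lambda>s. \<gamma> s \<in> U) (nhds t)"
    using assms(3,5) c(1) by (metis eventually_nhds_conv_at isCont_def topological_tendstoD)
  then have "eventually (\<lambda>s. ((\<psi> \<circ> inv_into U \<phi>) \<circ> (\<phi> \<circ> \<gamma>)) s = (\<psi> \<circ> \<gamma>) s) (nhds t)"
    by eventually_elim (simp add: c)
  ultimately show ?thesis
    by (subst (asm) has_vector_derivative_cong_ev[where g="\<psi> \<circ> \<gamma>"])
      (auto simp: assms c elim: eventually_mono)
qed

text \<open>The speed is defined through an arbitrarily chosen chart. By the chain rule the velocities in two charts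
  correspond under the derivative of the transition map, which is an isometry, so any chart computes it.\<close>

lemma path_speed_in_chart:
  assumes "(U, \<phi>) \<in> A" "\<gamma> t \<in> U" "isCont \<gamma> t"
    and "(\<phi> \<circ> \<gamma> has_vector_derivative w) (at t)"
  shows "path_speed A g \<gamma> t = sqrt (w \<bullet> (g (U, \<phi>) (\<gamma> t) *v w))"
proof -
  obtain V \<psi> where c: "(SOME c. c \<in> A \<and> \<gamma> t \<in> fst c) = (V, \<psi>)" by fastforce
  have "(SOME c. c \<in> A \<and> \<gamma> t \<in> fst c) \<in> A \<and> \<gamma> t \<in> fst (SOME c. c \<in> A \<and> \<gamma> t \<in> fst c)"
    by (rule someI_ex) (use assms in force)
  then have V: "(V, \<psi>) \<in> A" "\<gamma> t \<in> V" using c by auto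
  have "vector_derivative (\<psi> \<circ> \<gamma>) (at t) = frechet_derivative (\<psi> \<circ> inv_into U \<phi>) (at (\<phi> (\<gamma> t))) w"
    using chart_change_derivative[OF assms(1) V(1) assms(2) V(2) assms(3,4)]
    by (rule vector_derivative_at)
  then show ?thesis
    using tensor_transform[OF assms(1) V(1) assms(2) V(2), of w]
    by (simp add: path_speed_def c Let_def)
qed

text \<open>Near a time counted here, one chart sees a \<open>C\<^sup>1\<close> path on a whole interval of times. Asking for an
  interval makes the set open.\<close>

definition regular_times :: "(real \<Rightarrow> 'a) \<Rightarrow> real set" where
  "regular_times \<gamma> = {t \<in> {0<..<1}. \<exists>U \<phi> e w. (U, \<phi>) \<in> A \<and> 0 < e \<and> ball t e \<subseteq> {0<..<1} \<and> \<gamma> ` ball t e \<subseteq> U \<and>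
      continuous_on (ball t e) w \<and> (\<forall>s\<in>ball t e. (\<phi> \<circ> \<gamma> has_vector_derivative w s) (at s))}"

lemma open_regular_times: "open (regular_times \<gamma>)"
  unfolding open_contains_ball
proof
  fix t assume "t \<in> regular_times \<gamma>"
  then obtain U \<phi> e w where *: "(U, \<phi>) \<in> A" "0 < e" "ball t e \<subseteq> {0<..<1}" "\<gamma> ` ball t e \<subseteq> U"
      "continuous_on (ball t e) w" "\<forall>s\<in>ball t e. (\<phi> \<circ> \<gamma> has_vector_derivative w s) (at s)"
    unfolding regular_times_def by blast
  have "s \<in> regular_times \<gamma>" if s: "s \<in> ball t e" for s
  proof -
    obtain d where d: "0 < d" "ball s d \<subseteq> ball t e"
      using s by (metis open_ball open_contains_ball)
    then have "s \<in> {0<..<1}" "ball s d \<subseteq> {0<..<1}" "\<gamma> ` ball s d \<subseteq> U" "continuous_on (ball s d) w"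
       "\<forall>s\<in>ball s d. (\<phi> \<circ> \<gamma> has_vector_derivative w s) (at s)"
      using * s continuous_on_subset[of "ball t e" w "ball s d"] by (blast+)
    with *(1) d show ?thesis unfolding regular_times_def by blast
  qed
  with *(2) show "\<exists>e>0. ball t e \<subseteq> regular_times \<gamma>" by blast
qed

lemma regular_times_subset: "regular_times \<gamma> \<subseteq> {0<..<1}"
  by (auto simp: regular_times_def)

text \<open>Near each time the path stays in one chart domain, where the definition of a piecewise \<open>C\<^sup>1\<close> path allows
  finitely many exceptions; finitely many such neighbourhoods cover the unit interval.\<close>

lemma finite_irregular_times:
  assumes "piecewise_C1_path A \<gamma>"
  shows "finite ({0..1} - regular_times \<gamma>)"
proof -
  have cont: "continuous_on {0..1} \<gamma>" and
    pw: "\<And>U \<phi> a b. (U, \<phi>) \<in> A \<Longrightarrow> 0 \<le> a \<Longrightarrow> a \<le> b \<Longrightarrow> b \<le> 1 \<Longrightarrow> \<gamma> ` {a..b} \<subseteq> U \<Longrightarrow> (\<phi> \<circ> \<gamma>) piecewise_C1_differentiable_on {a..b}"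
    using assms unfolding piecewise_C1_path_def path_def by (simp, fast)
  have "\<exists>d>0. finite (({0..1} - regular_times \<gamma>) \<inter> ball t0 d)" if t0: "t0 \<in> {0..1}" for t0
  proof -
    obtain U \<phi> where U: "(U, \<phi>) \<in> A" "\<gamma> t0 \<in> U" by (rule chart_at)
    note c = chart_props[OF U(1)]
    have "\<exists>T. open T \<and> t0 \<in> T \<and> (\<forall>y\<in>{0..1}. y \<in> T \<longrightarrow> \<gamma> y \<in> U)"
      using cont[unfolded continuous_on_topological, rule_format, OF t0 c(1) U(2)] .
    then obtain T where T: "open T" "t0 \<in> T" "\<forall>y\<in>{0..1}. y \<in> T \<longrightarrow> \<gamma> y \<in> U"
      by blast
    obtain d where d: "d > 0" "cball t0 d \<subseteq> T"
      using T by (metis open_contains_cball)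
    define a where "a = max 0 (t0 - d)"
    define b where "b = min 1 (t0 + d)"
    have ab: "0 \<le> a" "a \<le> b" "b \<le> 1" using t0 d by (auto simp: a_def b_def)
    have "\<gamma> ` {a..b} \<subseteq> U"
    proof -
      have "s \<in> T" if "s \<in> {a..b}" for s
        using that d(2) by (auto simp: a_def b_def subset_eq dist_real_def)
      with T(3) ab show ?thesis by (auto simp: image_subset_iff)
    qed
    note img = this
    from pw[OF U(1) ab img] obtain S where S: "finite S" "(\<phi> \<circ> \<gamma>) C1_differentiable_on ({a..b} - S)"
      unfolding piecewise_C1_differentiable_on_def by blast
    then obtain w where w: "\<And>s. s \<in> {a..b} - S \<Longrightarrow> (\<phi> \<circ> \<gamma> has_vector_derivative w s) (at s)"
        "continuous_on ({a..b} - S) w"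
      unfolding C1_differentiable_on_def by blast
    have reg: "t \<in> regular_times \<gamma>" if t: "t \<in> {0<..<1}" "t \<in> ball t0 d" "t \<notin> S" for t
    proof -
      have "t \<in> {a<..<b} - S"
        using t by (auto simp: a_def b_def dist_real_def)
      moreover have "open ({a<..<b} - S)"
        using S(1) by (simp add: finite_imp_closed open_Diff)
      ultimately obtain e where e: "e > 0" "ball t e \<subseteq> {a<..<b} - S"
        by (metis open_contains_ball)
      then have sub: "ball t e \<subseteq> {a..b} - S" by auto
      have "ball t e \<subseteq> {0<..<1}"
        using e(2) ab by force
      moreover have "\<gamma> ` ball t e \<subseteq> U" using sub img by blast
      moreover have "continuous_on (ball t e) w" using w(2) sub continuous_on_subset by blast
      ultimately have "(U, \<phi>) \<in> A \<and> 0 < e \<and> ball t e \<subseteq> {0<..<1} \<and> \<gamma> ` ball t e \<subseteq> U \<and>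
          continuous_on (ball t e) w \<and> (\<forall>s\<in>ball t e. (\<phi> \<circ> \<gamma> has_vector_derivative w s) (at s))"
        using U(1) e(1) w(1) sub by auto
      then show ?thesis
        unfolding regular_times_def using t(1) by blast
    qed
    have "({0..1} - regular_times \<gamma>) \<inter> ball t0 d \<subseteq> S \<union> {0, 1}"
    proof
      fix t assume "t \<in> ({0..1} - regular_times \<gamma>) \<inter> ball t0 d"
      then show "t \<in> S \<union> {0, 1}"
        using reg[of t] by (cases "t = 0 \<or> t = 1") auto
    qed
    then have "finite (({0..1} - regular_times \<gamma>) \<inter> ball t0 d)"
      using S(1) by (simp add: finite_subset)
    with d(1) show ?thesis by blast
  qed
  then have "\<forall>t\<in>{0..1}. \<exists>d. 0 < d \<and> finite (({0..1} - regular_times \<gamma>) \<inter> ball t d)"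
    by blast
  then obtain d where d: "\<forall>t\<in>{0..1}. 0 < d t \<and> finite (({0..1} - regular_times \<gamma>) \<inter> ball t (d t))"
    unfolding bchoice_iff by blast
  have "compact {0..1::real}" by simp
  moreover have "\<And>t. t \<in> {0..1} \<Longrightarrow> open (ball t (d t))" by simp
  moreover have "{0..1} \<subseteq> (\<Union>t\<in>{0..1}. ball t (d t))"
  proof
    fix t :: real assume "t \<in> {0..1}"
    then show "t \<in> (\<Union>t\<in>{0..1}. ball t (d t))" using d by (intro UN_I[of t]) auto
  qed
  ultimately obtain T where T: "T \<subseteq> {0..1}" "finite T" "{0..1} \<subseteq> (\<Union>t\<in>T. ball t (d t))"
    by (rule compactE_image)
  have "finite (\<Union>t\<in>T. (({0..1} - regular_times \<gamma>) \<inter> ball t (d t)))"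
    using T d by (intro finite_UN_I) auto
  moreover have "{0..1} - regular_times \<gamma> \<subseteq> (\<Union>t\<in>T. (({0..1} - regular_times \<gamma>) \<inter> ball t (d t)))"
    using T(3) by blast
  ultimately show ?thesis by (rule finite_subset[rotated])
qed

lemma regular_time_isCont:
  assumes "piecewise_C1_path A \<gamma>" "t \<in> {0<..<1}"
  shows "isCont \<gamma> t"
proof -
  have "continuous_on {0<..<1} \<gamma>"
    using assms unfolding piecewise_C1_path_def path_def
    by (meson continuous_on_subset greaterThanLessThan_subseteq_atLeastAtMost_iff order_refl)
  with assms(2) show ?thesis by (simp add: continuous_on_eq_continuous_at)
qed

text \<open>The charts chosen in the definition of the speed depend on the time without any regularity. Off a finite
  set, however, the speed is locally given by the continuous formula of a fixed chart. This provides the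
  measurability that additivity and substitution need.\<close>

lemma continuous_on_path_speed:
  assumes p: "piecewise_C1_path A \<gamma>"
  shows "continuous_on (regular_times \<gamma>) (path_speed A g \<gamma>)"
proof (rule continuous_at_imp_continuous_on, rule ballI)
  fix t assume "t \<in> regular_times \<gamma>"
  then obtain U \<phi> e w where *: "(U, \<phi>) \<in> A" "0 < e" "ball t e \<subseteq> {0<..<1}" "\<gamma> ` ball t e \<subseteq> U"
      "continuous_on (ball t e) w" "\<And>s. s\<in>ball t e \<Longrightarrow> (\<phi> \<circ> \<gamma> has_vector_derivative w s) (at s)"
    unfolding regular_times_def by blast
  note c = chart_props[OF *(1)]
  have sp: "path_speed A g \<gamma> s = sqrt (w s \<bullet> (g (U, \<phi>) (\<gamma> s) *v w s))" if "s \<in> ball t e" for s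
    using that * by (intro path_speed_in_chart regular_time_isCont[OF p]) auto
  have c\<gamma>: "continuous_on (ball t e) \<gamma>"
    using * regular_time_isCont[OF p] by (intro continuous_at_imp_continuous_on) blast
  have "continuous_on (ball t e) (\<lambda>s. (\<lambda>u. g (U, \<phi>) (inv_into U \<phi> u)) (\<phi> (\<gamma> s)))"
    by (rule continuous_on_compose2[OF tensor_continuous[OF *(1)]])
      (use *(4) c\<gamma> c(3) in \<open>auto intro!: continuous_on_compose2[OF c(3) c\<gamma>]\<close>)
  then have "continuous_on (ball t e) (\<lambda>s. g (U, \<phi>) (\<gamma> s))"
    by (rule continuous_on_eq) (use *(4) c(6) in \<open>auto simp: image_subset_iff\<close>)
  then have "continuous_on (ball t e) (\<lambda>s. sqrt (w s \<bullet> (g (U, \<phi>) (\<gamma> s) *v w s)))"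
    using *(5) unfolding matrix_vector_mult_def inner_vec_def
    by (auto intro!: continuous_intros)
  then have "continuous_on (ball t e) (path_speed A g \<gamma>)"
    by (rule continuous_on_eq) (simp add: sp)
  then show "isCont (path_speed A g \<gamma>) t"
    using *(2) by (simp add: continuous_on_eq_continuous_at)
qed

text \<open>The half-open interval makes the length additive, and dropping the finitely many irregular times makes
  the integrand Borel.\<close>

definition arc_length :: "(real \<Rightarrow> 'a) \<Rightarrow> real \<Rightarrow> real \<Rightarrow> ennreal" where
  "arc_length \<gamma> a b =
     (\<integral>\<^sup>+t. ennreal (path_speed A g \<gamma> t) * indicator (regular_times \<gamma> \<inter> {a<..b}) t \<partial>lborel)"

lemma arc_integrand_measurable:
  assumes "piecewise_C1_path A \<gamma>"
  shows "(\<lambda>t. ennreal (path_speed A g \<gamma> t) * indicator (regular_times \<gamma> \<inter> {a<..b}) t) \<in> borel_measurable borel"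
proof -
  have "(\<lambda>t. indicator (regular_times \<gamma>) t *\<^sub>R path_speed A g \<gamma> t) \<in> borel_measurable borel"
    by (intro borel_measurable_continuous_on_indicator continuous_on_path_speed assms)
      (simp add: open_regular_times borel_open)
  then have "(\<lambda>t. ennreal (indicator (regular_times \<gamma>) t *\<^sub>R path_speed A g \<gamma> t) * indicator {a<..b} t)
      \<in> borel_measurable borel"
    by measurable
  moreover have "(\<lambda>t. ennreal (indicator (regular_times \<gamma>) t *\<^sub>R path_speed A g \<gamma> t) * indicator {a<..b} t)
     = (\<lambda>t. ennreal (path_speed A g \<gamma> t) * indicator (regular_times \<gamma> \<inter> {a<..b}) t)"
    by (auto simp: fun_eq_iff indicator_def)
  ultimately show ?thesis by simp
qed

lemma arc_length_add:
  assumes "piecewise_C1_path A \<gamma>" "a \<le> b" "b \<le> c"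
  shows "arc_length \<gamma> a b + arc_length \<gamma> b c = arc_length \<gamma> a c"
  unfolding arc_length_def using assms
  by (subst nn_integral_add[symmetric])
    (auto simp: arc_integrand_measurable intro!: nn_integral_cong split: split_indicator)

lemma arc_length_le: "arc_length \<gamma> 0 1 \<le> path_length A g \<gamma>"
  unfolding arc_length_def path_length_def
  by (intro nn_integral_mono) (auto split: split_indicator)

lemma piecewise_C1_segment:
  assumes p: "piecewise_C1_path A \<gamma>" and ab: "0 \<le> a" "a < b" "b \<le> 1"
  shows "piecewise_C1_path A (\<lambda>s. \<gamma> (a + (b - a) * s))"
  unfolding piecewise_C1_path_def
proof (intro conjI ballI, safe)
  have m: "a + (b - a) * s \<in> {0..1}" if "s \<in> {0..1}" for s
  proof -
    have "(b - a) * s \<le> b - a" using that ab by (simp add: mult_left_le)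
    moreover have "0 \<le> (b - a) * s" using that ab by simp
    ultimately show ?thesis using ab unfolding atLeastAtMost_iff by linarith
  qed
  show "path (\<lambda>s. \<gamma> (a + (b - a) * s))"
    unfolding path_def
    by (rule continuous_on_compose2[of "{0..1}" \<gamma>])
      (use p m in \<open>auto simp: piecewise_C1_path_def path_def intro!: continuous_intros\<close>)
  fix U \<phi> c d
  assume c: "(U, \<phi>) \<in> A" "0 \<le> c" "c \<le> (d::real)" "d \<le> 1" and img: "(\<lambda>s. \<gamma> (a + (b - a) * s)) ` {c..d} \<subseteq> U"
  have im: "(\<lambda>s. (b - a) * s + a) ` {c..d} = {(b-a)*c + a..(b-a)*d + a}"
    using ab c(3) by (auto simp: image_affinity_atLeastAtMost)
  have "(b - a) * c \<le> (b - a) * d" using ab c by (intro mult_left_mono) auto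
  moreover have "\<gamma> ` {(b-a)*c + a..(b-a)*d + a} \<subseteq> U"
    using img unfolding im[symmetric] by (auto simp: add.commute)
  ultimately have "(\<phi> \<circ> \<gamma>) piecewise_C1_differentiable_on {(b-a)*c + a..(b-a)*d + a}"
    using p c m[of c] m[of d] unfolding piecewise_C1_path_def
    by (auto simp: add.commute)
  then have "((\<phi> \<circ> \<gamma>) \<circ> (\<lambda>x. (b - a) *\<^sub>R x + a)) piecewise_C1_differentiable_on {c..d}"
    by (intro piecewise_C1_differentiable_affine) (simp add: im)
  then show "(\<phi> \<circ> (\<lambda>s. \<gamma> (a + (b - a) * s))) piecewise_C1_differentiable_on {c..d}"
    by (simp add: o_def add.commute)
qed

lemma path_speed_segment:
  assumes p: "piecewise_C1_path A \<gamma>" and ab: "0 \<le> a" "a < b" "b \<le> 1"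
    and s: "s \<in> {0<..<1}" "a + (b - a) * s \<in> regular_times \<gamma>"
  shows "path_speed A g (\<lambda>s. \<gamma> (a + (b - a) * s)) s = (b - a) * path_speed A g \<gamma> (a + (b - a) * s)"
proof -
  let ?t = "a + (b - a) * s"
  obtain U \<phi> e w where *: "(U, \<phi>) \<in> A" "0 < e" "\<gamma> ` ball ?t e \<subseteq> U"
      "\<And>s. s\<in>ball ?t e \<Longrightarrow> (\<phi> \<circ> \<gamma> has_vector_derivative w s) (at s)"
    using s(2) unfolding regular_times_def by blast
  have U: "\<gamma> ?t \<in> U" using *(2,3) by (auto simp: image_subset_iff)
  have w: "(\<phi> \<circ> \<gamma> has_vector_derivative w ?t) (at ?t)" using *(2,4) by simp
  have t: "?t \<in> {0<..<1}" using s(2) regular_times_subset by blast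
  have "((\<lambda>s. a + (b - a) * s) has_vector_derivative (b - a)) (at s)"
    by (auto intro!: derivative_eq_intros simp: has_real_derivative_iff_has_vector_derivative[symmetric])
  then have "((\<phi> \<circ> \<gamma>) \<circ> (\<lambda>s. a + (b - a) * s) has_vector_derivative (b - a) *\<^sub>R w ?t) (at s)"
    using w by (rule vector_diff_chain_at)
  then have "(\<phi> \<circ> (\<lambda>s. \<gamma> (a + (b - a) * s)) has_vector_derivative (b - a) *\<^sub>R w ?t) (at s)"
    by (simp add: o_def)
  then have "path_speed A g (\<lambda>s. \<gamma> (a + (b - a) * s)) s =
      sqrt (((b - a) *\<^sub>R w ?t) \<bullet> (g (U, \<phi>) (\<gamma> ?t) *v ((b - a) *\<^sub>R w ?t)))"
    using regular_time_isCont[OF piecewise_C1_segment[OF p ab] s(1)] *(1) U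
    by (intro path_speed_in_chart) auto
  also have "\<dots> = sqrt ((b - a)\<^sup>2 * (w ?t \<bullet> (g (U, \<phi>) (\<gamma> ?t) *v w ?t)))"
    by (simp add: matrix_vector_mult_scaleR power2_eq_square ac_simps)
  also have "\<dots> = (b - a) * path_speed A g \<gamma> ?t"
    using ab path_speed_in_chart[OF *(1) U regular_time_isCont[OF p t] w] by (simp add: real_sqrt_mult)
  finally show ?thesis .
qed

end

locale riemannian = tensor_atlas A g for A :: "('a::metric_space, 'n::finite) chart set" and g +
  assumes dist_eq: "\<And>x y. ennreal (dist x y) =
        (INF \<gamma>\<in>{\<gamma>. piecewise_C1_path A \<gamma> \<and> pathstart \<gamma> = x \<and> pathfinish \<gamma> = y}. path_length A g \<gamma>)"
begin

lemma dist_le_path_length: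
  "piecewise_C1_path A \<gamma> \<Longrightarrow> ennreal (dist (\<gamma> 0) (\<gamma> 1)) \<le> path_length A g \<gamma>"
  by (subst dist_eq, rule INF_lower) (auto simp: pathstart_def pathfinish_def)

lemma short_path:
  assumes "dist x y < e"
  obtains \<gamma> where "piecewise_C1_path A \<gamma>" "\<gamma> 0 = x" "\<gamma> 1 = y" "path_length A g \<gamma> < ennreal e"
proof -
  have "(INF \<gamma>\<in>{\<gamma>. piecewise_C1_path A \<gamma> \<and> pathstart \<gamma> = x \<and> pathfinish \<gamma> = y}. path_length A g \<gamma>) < ennreal e"
    using assms by (subst dist_eq[symmetric]) (simp add: ennreal_lessI order.strict_trans1[OF zero_le_dist])
  then show thesis
    using that by (auto simp: INF_less_iff pathstart_def pathfinish_def)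
qed

text \<open>The piece of the path between the two times, reparametrised affinely over the unit interval, competes
  in the infimum that defines the distance; its speed is scaled by \<open>b - a\<close>, which substitution undoes.\<close>

lemma dist_le_arc_length:
  assumes p: "piecewise_C1_path A \<gamma>" and ab: "0 \<le> a" "a \<le> b" "b \<le> 1"
  shows "ennreal (dist (\<gamma> a) (\<gamma> b)) \<le> arc_length \<gamma> a b"
proof (cases "a = b")
  case True then show ?thesis by simp
next
  case False
  with ab have ab': "a < b" by simp
  let ?h = "\<lambda>s. a + (b - a) * s" and ?I = "\<lambda>t. ennreal (path_speed A g \<gamma> t) * indicator (regular_times \<gamma> \<inter> {a<..b}) t"
  have "ennreal (dist (\<gamma> a) (\<gamma> b)) \<le> path_length A g (\<lambda>s. \<gamma> (?h s))"
    using dist_le_path_length[OF piecewise_C1_segment[OF p ab(1) ab' ab(3)]] by simp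
  also have "\<dots> \<le> (\<integral>\<^sup>+s. ennreal (b - a) * ?I (?h s) \<partial>lborel)"
    unfolding path_length_def
  proof (rule nn_integral_mono_AE)
    have "finite (?h -` ({0..1} - regular_times \<gamma>))"
      using finite_irregular_times[OF p] ab' by (intro finite_vimageI) (auto intro!: injI)
    then have "finite (?h -` ({0..1} - regular_times \<gamma>) \<union> {0, 1})" by simp
    then have "AE s in lborel. s \<notin> ?h -` ({0..1} - regular_times \<gamma>) \<union> {0, 1}"
      by (intro AE_not_in finite_imp_null_set_lborel)
    then show "AE s in lborel. ennreal (path_speed A g (\<lambda>s. \<gamma> (?h s)) s) * indicator {0..1} s \<le> ennreal (b - a) * ?I (?h s)"
    proof eventually_elim
      case (elim s)
      show ?case
      proof (cases "s \<in> {0<..<1}")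
        case True
        have "(b - a) * s < (b - a) * 1" "0 < (b - a) * s" using True ab' by (auto intro!: mult_strict_left_mono)
        then have 1: "?h s \<in> {a<..b}" "?h s \<in> {0..1}" using ab by auto
        with elim have 2: "?h s \<in> regular_times \<gamma>" by auto
        from path_speed_segment[OF p ab(1) ab' ab(3) True 2] 1 2 show ?thesis
          using ab' True by (simp add: ennreal_mult')
      qed (use elim in \<open>auto simp: indicator_def\<close>)
    qed
  qed
  also have "\<dots> = ennreal (b - a) * (\<integral>\<^sup>+s. ?I (?h s) \<partial>lborel)"
    by (intro nn_integral_cmult measurable_compose[OF _ arc_integrand_measurable[OF p]]) simp
  also have "\<dots> = arc_length \<gamma> a b"
    unfolding arc_length_def
    using nn_integral_real_affine[OF arc_integrand_measurable[OF p, of a b], of "b - a" a] ab' by simp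
  finally show ?thesis .
qed

text \<open>An almost shortest path from \<open>x\<close> to \<open>y\<close> reaches the distance \<open>s\<close> at some time; the rest of it is then
  hardly longer than \<open>dist x y - s\<close>. This is the only property of the distance used for thin annuli.\<close>

lemma intermediate_point:
  fixes x y :: 'a
  assumes "0 \<le> s" "s \<le> dist x y" "0 < e"
  obtains z where "dist x z = s" "dist z y < dist x y - s + e"
proof -
  obtain \<gamma> where p: "piecewise_C1_path A \<gamma>" "\<gamma> 0 = x" "\<gamma> 1 = y" "path_length A g \<gamma> < ennreal (dist x y + e)"
    by (rule short_path[of x y "dist x y + e"]) (use assms in auto)
  have "continuous_on {0..1} \<gamma>" using p(1) by (simp add: piecewise_C1_path_def path_def)
  then have "continuous_on {0..1} (\<lambda>t. dist x (\<gamma> t))" by (intro continuous_intros)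
  then obtain t where t: "0 \<le> t" "t \<le> 1" "dist x (\<gamma> t) = s"
    using IVT'[of "\<lambda>t. dist x (\<gamma> t)" 0 s 1] assms p by auto
  have "ennreal (s + dist (\<gamma> t) y) = ennreal (dist (\<gamma> 0) (\<gamma> t)) + ennreal (dist (\<gamma> t) (\<gamma> 1))"
    using t p assms by (simp add: ennreal_plus)
  also have "\<dots> \<le> arc_length \<gamma> 0 t + arc_length \<gamma> t 1"
    using t by (intro add_mono dist_le_arc_length p) auto
  also have "\<dots> \<le> path_length A g \<gamma>"
    using t by (simp add: arc_length_add p arc_length_le)
  also note p(4)
  finally have "s + dist (\<gamma> t) y < dist x y + e"
    using assms by (subst (asm) ennreal_less_iff) auto
  with that[of "\<gamma> t"] t show thesis by simp
qed

end

section \<open>The Riemannian distance in coordinates\<close>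

context tensor_atlas
begin

lemma piecewise_C1_chart_segment:
  assumes c: "(U, \<phi>) \<in> A" and seg: "\<And>t. t \<in> {0..1} \<Longrightarrow> u + t *\<^sub>R v \<in> \<phi> ` U"
  shows "piecewise_C1_path A (\<lambda>t. inv_into U \<phi> (u + t *\<^sub>R v))"
  unfolding piecewise_C1_path_def
proof (intro conjI ballI, safe)
  note cp = chart_props[OF c]
  have cont: "continuous_on {0..1} (\<lambda>t. inv_into U \<phi> (u + t *\<^sub>R v))"
    by (rule continuous_on_compose2[OF cp(5)]) (intro continuous_intros, rule image_subsetI, rule seg)
  then show "path (\<lambda>t. inv_into U \<phi> (u + t *\<^sub>R v))" by (simp add: path_def)
  fix V \<psi> a b
  assume d: "(V, \<psi>) \<in> A" "0 \<le> a" "a \<le> (b::real)" "b \<le> 1"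
    and img: "(\<lambda>t. inv_into U \<phi> (u + t *\<^sub>R v)) ` {a..b} \<subseteq> V"
  have sub: "{a..b} \<subseteq> {0..1}" using d by auto
  have "u + t *\<^sub>R v \<in> \<phi> ` (U \<inter> V)" if "t \<in> {a..b}" for t
  proof -
    have 1: "u + t *\<^sub>R v \<in> \<phi> ` U" using that sub seg by blast
    have "inv_into U \<phi> (u + t *\<^sub>R v) \<in> V" using that img by blast
    with cp(7)[OF 1] show ?thesis
      by (intro image_eqI[of _ _ "inv_into U \<phi> (u + t *\<^sub>R v)"]) auto
  qed
  note UV = this
  let ?F = "\<lambda>t. frechet_derivative (\<psi> \<circ> inv_into U \<phi>) (at (u + t *\<^sub>R v)) v"
  have D: "(\<psi> \<circ> (\<lambda>t. inv_into U \<phi> (u + t *\<^sub>R v)) has_vector_derivative ?F t) (at t)" if t: "t \<in> {a..b}" for t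
  proof -
    note D = transition_derivative(1)[OF c d(1) UV[OF t]]
    have "((\<lambda>t. u + t *\<^sub>R v) has_derivative (\<lambda>x. x *\<^sub>R v)) (at t)"
      by (auto intro!: derivative_eq_intros)
    from diff_chain_at[OF this D] show ?thesis
      using has_derivative_linear[OF D] by (simp add: has_vector_derivative_def o_def linear_cmul)
  qed
  have C: "continuous_on {a..b} ?F"
  proof (rule continuous_on_compose2[where g="\<lambda>u. frechet_derivative (\<psi> \<circ> inv_into U \<phi>) (at u) v"])
    have "a \<in> {a..b}" using d by simp
    from transition_derivative(2)[OF c d(1) UV[OF this]]
    show "continuous_on (\<phi> ` (U \<inter> V)) (\<lambda>u. frechet_derivative (\<psi> \<circ> inv_into U \<phi>) (at u) v)" .
    show "(\<lambda>t. u + t *\<^sub>R v) ` {a..b} \<subseteq> \<phi> ` (U \<inter> V)"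
      by (rule image_subsetI) (rule UV)
  qed (intro continuous_intros)
  have "(\<psi> \<circ> (\<lambda>t. inv_into U \<phi> (u + t *\<^sub>R v))) C1_differentiable_on {a..b}"
    unfolding C1_differentiable_on_def by (rule exI[of _ ?F], rule conjI, rule ballI, rule D, assumption, rule C)
  then show "(\<psi> \<circ> (\<lambda>t. inv_into U \<phi> (u + t *\<^sub>R v))) piecewise_C1_differentiable_on {a..b}"
    by (simp add: C1_differentiable_imp_piecewise)
qed

text \<open>The quadratic form is continuous and positive on the product of \<open>K\<close> with the unit sphere, which is
  compact; the general case follows by homogeneity.\<close>

lemma tensor_bounds:
  assumes c: "(U, \<phi>) \<in> A" and K: "compact K" "K \<subseteq> \<phi> ` U" "K \<noteq> {}"
  obtains a b where "0 < a" "0 < b"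
    "\<And>u v. u \<in> K \<Longrightarrow> a * norm v \<le> sqrt (v \<bullet> (g (U, \<phi>) (inv_into U \<phi> u) *v v))"
    "\<And>u v. u \<in> K \<Longrightarrow> sqrt (v \<bullet> (g (U, \<phi>) (inv_into U \<phi> u) *v v)) \<le> b * norm v"
proof -
  note cp = chart_props[OF c]
  let ?Q = "\<lambda>(u, v). v \<bullet> (g (U, \<phi>) (inv_into U \<phi> u) *v v)"
  let ?C = "K \<times> sphere (0::real^'n) 1"
  have "continuous_on ?C (\<lambda>p. g (U, \<phi>) (inv_into U \<phi> (fst p)))"
    by (rule continuous_on_compose2[OF tensor_continuous[OF c]]) (use K in \<open>auto intro!: continuous_intros\<close>)
  then have cont: "continuous_on ?C ?Q"
    unfolding matrix_vector_mult_def inner_vec_def case_prod_beta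
    by (auto intro!: continuous_intros)
  have comp: "compact ?C" using K by (intro compact_Times) auto
  have "axis undefined 1 \<in> sphere (0::real^'n) 1" by simp
  then have ne: "?C \<noteq> {}" using K(3) by blast
  obtain p where p: "p \<in> ?C" "\<And>y. y \<in> ?C \<Longrightarrow> ?Q p \<le> ?Q y"
    using continuous_attains_inf[OF comp ne cont] by blast
  obtain q where q: "q \<in> ?C" "\<And>y. y \<in> ?C \<Longrightarrow> ?Q y \<le> ?Q q"
    using continuous_attains_sup[OF comp ne cont] by blast
  have pos: "0 < ?Q y" if "y \<in> ?C" for y
  proof -
    obtain u v where y: "y = (u, v)" by (cases y)
    then have "u \<in> \<phi> ` U" "v \<noteq> 0" using that K by auto
    then show ?thesis using cp(7)[of u] tensor_pos[OF c, of "inv_into U \<phi> u" v] by (simp add: y)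
  qed
  have scale: "(k *\<^sub>R e) \<bullet> (G *v (k *\<^sub>R e)) = k\<^sup>2 * (e \<bullet> (G *v e))" for k e and G :: "real^'n^'n"
    by (simp add: matrix_vector_mult_scaleR power2_eq_square)
  have hom: "v \<bullet> (g (U, \<phi>) (inv_into U \<phi> u) *v v) = (norm v)\<^sup>2 * ?Q (u, v /\<^sub>R norm v)" if "v \<noteq> 0" for u v
    using scale[of "norm v" "v /\<^sub>R norm v" "g (U, \<phi>) (inv_into U \<phi> u)"] that by simp
  have s: "(u, v /\<^sub>R norm v) \<in> ?C" if "u \<in> K" "v \<noteq> 0" for u v using that by simp
  show thesis
  proof (rule that[of "sqrt (?Q p)" "sqrt (?Q q)"])
    show "0 < sqrt (?Q p)" "0 < sqrt (?Q q)" using pos p q by auto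
    fix u v assume u: "u \<in> K"
    show "sqrt (?Q p) * norm v \<le> sqrt (v \<bullet> (g (U, \<phi>) (inv_into U \<phi> u) *v v))"
    proof (cases "v = 0")
      case False
      have "(norm v)\<^sup>2 * ?Q p \<le> (norm v)\<^sup>2 * ?Q (u, v /\<^sub>R norm v)"
        using p(2)[OF s[OF u False]] by (intro mult_left_mono) auto
      then have "sqrt ((norm v)\<^sup>2 * ?Q p) \<le> sqrt (v \<bullet> (g (U, \<phi>) (inv_into U \<phi> u) *v v))"
        unfolding hom[OF False] by (rule real_sqrt_le_mono)
      then show ?thesis by (simp add: real_sqrt_mult mult.commute)
    qed simp
    show "sqrt (v \<bullet> (g (U, \<phi>) (inv_into U \<phi> u) *v v)) \<le> sqrt (?Q q) * norm v"
    proof (cases "v = 0")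
      case False
      have "(norm v)\<^sup>2 * ?Q (u, v /\<^sub>R norm v) \<le> (norm v)\<^sup>2 * ?Q q"
        using q(2)[OF s[OF u False]] by (intro mult_left_mono) auto
      then have "sqrt (v \<bullet> (g (U, \<phi>) (inv_into U \<phi> u) *v v)) \<le> sqrt ((norm v)\<^sup>2 * ?Q q)"
        unfolding hom[OF False] by (rule real_sqrt_le_mono)
      then show ?thesis by (simp add: real_sqrt_mult mult.commute)
    qed simp
  qed
qed

text \<open>The displacement is the integral of the velocity by the fundamental theorem of calculus. A priori the
  velocity has only a gauge integral, since it may be unbounded near exceptional times; its norm is
  controlled by the speed, so if the arc length is finite, it is Lebesgue integrable and the norm of the
  integral is at most the integral of the norm.\<close>

lemma chart_displacement_le_arc_length:
  assumes p: "piecewise_C1_path A \<gamma>" and c: "(U, \<phi>) \<in> A" and K: "K \<subseteq> \<phi> ` U" and a: "0 < a"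
    and low: "\<And>u v. u \<in> K \<Longrightarrow> a * norm v \<le> sqrt (v \<bullet> (g (U, \<phi>) (inv_into U \<phi> u) *v v))"
    and t: "0 \<le> t" "t \<le> 1" and img: "\<And>s. s \<in> {0..t} \<Longrightarrow> \<gamma> s \<in> U \<and> \<phi> (\<gamma> s) \<in> K"
  shows "ennreal (a * norm (\<phi> (\<gamma> t) - \<phi> (\<gamma> 0))) \<le> arc_length \<gamma> 0 t"
proof (cases "arc_length \<gamma> 0 t = \<infinity>")
  case False
  note cp = chart_props[OF c]
  define w where "w s = vector_derivative (\<phi> \<circ> \<gamma>) (at s)" for s
  have w: "(\<phi> \<circ> \<gamma> has_vector_derivative w s) (at s)"
    and sp: "a * norm (w s) \<le> path_speed A g \<gamma> s"
    if s: "s \<in> regular_times \<gamma>" "s \<in> {0..t}" for s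
  proof -
    have s01: "s \<in> {0<..<1}" using s(1) regular_times_subset by blast
    note isc = regular_time_isCont[OF p s01]
    obtain V \<psi> e v where *: "(V, \<psi>) \<in> A" "0 < e" "\<gamma> ` ball s e \<subseteq> V"
      "\<And>r. r\<in>ball s e \<Longrightarrow> (\<psi> \<circ> \<gamma> has_vector_derivative v r) (at r)"
      using s(1) unfolding regular_times_def by blast
    have "\<gamma> s \<in> V" "(\<psi> \<circ> \<gamma> has_vector_derivative v s) (at s)" using * by auto
    from chart_change_derivative[OF *(1) c this(1) _ isc this(2)] img[OF s(2)]
    show W: "(\<phi> \<circ> \<gamma> has_vector_derivative w s) (at s)"
      unfolding w_def by (metis vector_derivative_at)
    have "path_speed A g \<gamma> s = sqrt (w s \<bullet> (g (U, \<phi>) (\<gamma> s) *v w s))"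
      using img[OF s(2)] by (intro path_speed_in_chart[OF c _ isc W]) simp
    moreover have "inv_into U \<phi> (\<phi> (\<gamma> s)) = \<gamma> s" using img[OF s(2)] cp(6) by blast
    ultimately show "a * norm (w s) \<le> path_speed A g \<gamma> s"
      using low[of "\<phi> (\<gamma> s)" "w s"] img[OF s(2)] by simp
  qed
  have cg: "continuous_on {0..t} \<gamma>"
    using p t unfolding piecewise_C1_path_def path_def by (auto elim: continuous_on_subset)
  have "(w has_integral ((\<phi> \<circ> \<gamma>) t - (\<phi> \<circ> \<gamma>) 0)) {0..t}"
  proof (rule fundamental_theorem_of_calculus_strong[OF finite_irregular_times[OF p] t(1)])
    show "(\<phi> \<circ> \<gamma> has_vector_derivative w s) (at s)" if "s \<in> {0..t} - ({0..1} - regular_times \<gamma>)" for s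
      using w[of s] that t by auto
    show "continuous_on {0..t} (\<phi> \<circ> \<gamma>)"
      by (rule continuous_on_compose[OF cg continuous_on_subset[OF cp(3)]]) (use img in auto)
  qed
  note int = this
  let ?w = "\<lambda>s. indicator {0..t} s *\<^sub>R w s"
  have meas: "?w \<in> borel_measurable lebesgue"
    by (rule has_integral_implies_lebesgue_measurable[OF int])
  have ae: "AE s in lborel. ennreal (a * norm (?w s))
      \<le> ennreal (path_speed A g \<gamma> s) * indicator (regular_times \<gamma> \<inter> {0<..t}) s"
  proof -
    have "AE s in lborel. s \<notin> {0..1} - regular_times \<gamma> \<union> {0}"
      using finite_irregular_times[OF p] by (intro AE_not_in finite_imp_null_set_lborel) simp
    then show ?thesis
    proof eventually_elim
      case (elim s)
      show ?case
      proof (cases "s \<in> {0..t}")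
        case True
        with elim t have "s \<in> regular_times \<gamma>" by auto
        with sp[OF this True] True elim show ?thesis by (auto intro!: ennreal_leI)
      qed simp
    qed
  qed
  have le: "ennreal a * (\<integral>\<^sup>+s. ennreal (norm (?w s)) \<partial>lebesgue) \<le> arc_length \<gamma> 0 t"
  proof -
    have "(\<lambda>s. ennreal (norm (?w s))) \<in> borel_measurable lebesgue"
      by (rule measurable_compose[OF meas]) simp
    then have "ennreal a * (\<integral>\<^sup>+s. ennreal (norm (?w s)) \<partial>lebesgue) = (\<integral>\<^sup>+s. ennreal a * ennreal (norm (?w s)) \<partial>lebesgue)"
      by (rule nn_integral_cmult[symmetric])
    also have "\<dots> = (\<integral>\<^sup>+s. ennreal (a * norm (?w s)) \<partial>lebesgue)"
      using a by (intro nn_integral_cong ennreal_mult[symmetric]) auto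
    also have "\<dots> = (\<integral>\<^sup>+s. ennreal (a * norm (?w s)) \<partial>lborel)" by (rule nn_integral_completion)
    also have "\<dots> \<le> arc_length \<gamma> 0 t" unfolding arc_length_def by (rule nn_integral_mono_AE[OF ae])
    finally show ?thesis .
  qed
  have fin: "(\<integral>\<^sup>+s. ennreal (norm (?w s)) \<partial>lebesgue) < \<infinity>"
  proof (rule ccontr)
    assume "\<not> ?thesis"
    then have "(\<integral>\<^sup>+s. ennreal (norm (?w s)) \<partial>lebesgue) = top" by (simp add: less_top[symmetric])
    with le False a show False by (auto simp: ennreal_mult_top top_unique)
  qed
  have intw: "integrable lebesgue ?w" using meas fin by (rule integrableI_bounded)
  then have "(?w has_integral (integral\<^sup>L lebesgue ?w)) UNIV"
    by (rule has_integral_integral_lebesgue)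
  moreover have "(?w has_integral ((\<phi> \<circ> \<gamma>) t - (\<phi> \<circ> \<gamma>) 0)) UNIV"
  proof -
    have "?w = (\<lambda>s. if s \<in> {0..t} then w s else 0)" by (auto simp: indicator_def)
    with int show ?thesis by (simp only: has_integral_restrict_UNIV)
  qed
  ultimately have eq: "integral\<^sup>L lebesgue ?w = (\<phi> \<circ> \<gamma>) t - (\<phi> \<circ> \<gamma>) 0" by (rule has_integral_unique)
  have "ennreal (a * norm (\<phi> (\<gamma> t) - \<phi> (\<gamma> 0))) = ennreal a * ennreal (norm (integral\<^sup>L lebesgue ?w))"
    using a by (simp add: eq ennreal_mult)
  also have "\<dots> \<le> ennreal a * (\<integral>\<^sup>+s. ennreal (norm (?w s)) \<partial>lebesgue)"
    by (intro mult_left_mono integral_norm_bound_ennreal intw) simp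
  also note le
  finally show ?thesis .
qed simp

end

context riemannian
begin

text \<open>The preimage of the coordinate segment is a competitor for the distance, of speed at most
  \<open>b * norm (u' - u)\<close>.\<close>

lemma dist_le_chart_norm:
  assumes c: "(U, \<phi>) \<in> A" and K: "K \<subseteq> \<phi> ` U" "convex K" and b: "0 < b"
    and up: "\<And>u v. u \<in> K \<Longrightarrow> sqrt (v \<bullet> (g (U, \<phi>) (inv_into U \<phi> u) *v v)) \<le> b * norm v"
    and u: "u \<in> K" "u' \<in> K"
  shows "dist (inv_into U \<phi> u) (inv_into U \<phi> u') \<le> b * norm (u' - u)"
proof -
  note cp = chart_props[OF c]
  let ?\<gamma> = "\<lambda>t. inv_into U \<phi> (u + t *\<^sub>R (u' - u))"
  have seg: "u + t *\<^sub>R (u' - u) \<in> K" if "t \<in> {0..1}" for t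
  proof -
    have "u + t *\<^sub>R (u' - u) = (1 - t) *\<^sub>R u + t *\<^sub>R u'" by (simp add: algebra_simps)
    then show ?thesis using that K(2) u by (simp add: convex_alt)
  qed
  have p: "piecewise_C1_path A ?\<gamma>" using seg K by (intro piecewise_C1_chart_segment[OF c]) auto
  have sp: "path_speed A g ?\<gamma> t \<le> b * norm (u' - u)" if t: "t \<in> {0<..<1}" for t
  proof -
    have k: "u + t *\<^sub>R (u' - u) \<in> K" using t seg by auto
    have op: "open (\<phi> ` U)" by (rule cp)
    have "((\<lambda>t. u + t *\<^sub>R (u' - u)) has_vector_derivative (u' - u)) (at t)"
      by (auto intro!: derivative_eq_intros)
    moreover have "eventually (\<lambda>s. (\<phi> \<circ> ?\<gamma>) s = u + s *\<^sub>R (u' - u)) (nhds t)"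
    proof -
      have "((\<lambda>s. u + s *\<^sub>R (u' - u)) \<longlongrightarrow> u + t *\<^sub>R (u' - u)) (nhds t)"
        by (intro tendsto_intros filterlim_ident)
      then have "eventually (\<lambda>s. u + s *\<^sub>R (u' - u) \<in> \<phi> ` U) (nhds t)"
        using op k K(1) by (intro topological_tendstoD) auto
      then show ?thesis by eventually_elim (simp add: cp)
    qed
    ultimately have "(\<phi> \<circ> ?\<gamma> has_vector_derivative (u' - u)) (at t)"
      by (subst has_vector_derivative_cong_ev[where g="\<lambda>s. u + s *\<^sub>R (u' - u)"]) (auto dest: eventually_nhds_x_imp_x elim: eventually_mono)
    then have "path_speed A g ?\<gamma> t = sqrt ((u' - u) \<bullet> (g (U, \<phi>) (?\<gamma> t) *v (u' - u)))"
      using t k K(1) cp(7) by (intro path_speed_in_chart[OF c] regular_time_isCont[OF p]) auto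
    then show ?thesis using up[OF k, of "u' - u"] by simp
  qed
  have "ennreal (dist (?\<gamma> 0) (?\<gamma> 1)) \<le> path_length A g ?\<gamma>" by (rule dist_le_path_length[OF p])
  also have "\<dots> \<le> (\<integral>\<^sup>+t. ennreal (b * norm (u' - u)) * indicator {0..1::real} t \<partial>lborel)"
  proof (unfold path_length_def, rule nn_integral_mono_AE)
    have "AE s in lborel. s \<notin> {0, 1::real}" by (intro AE_not_in finite_imp_null_set_lborel) simp
    then show "AE t in lborel. ennreal (path_speed A g ?\<gamma> t) * indicator {0..1} t \<le> ennreal (b * norm (u' - u)) * indicator {0..1} t"
      by eventually_elim (use sp in \<open>auto simp: indicator_def intro!: ennreal_leI\<close>)
  qed
  also have "\<dots> = ennreal (b * norm (u' - u))" by (simp add: nn_integral_cmult_indicator)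
  finally show ?thesis using b by simp
qed

text \<open>A path of length less than \<open>a * \<rho>\<close> cannot leave the coordinate ball of radius \<open>\<rho>\<close>, because before its first
  exit it would have covered the coordinate distance \<open>\<rho>\<close>. Hence every short path stays where the tensor
  dominates the Euclidean norm, and its length bounds the coordinate displacement.\<close>

lemma chart_norm_le_dist:
  assumes c: "(U, \<phi>) \<in> A" and K: "K \<subseteq> \<phi> ` U" and a: "0 < a" and \<rho>: "0 < \<rho>"
    and low: "\<And>u v. u \<in> K \<Longrightarrow> a * norm v \<le> sqrt (v \<bullet> (g (U, \<phi>) (inv_into U \<phi> u) *v v))"
    and x: "x \<in> U" "cball (\<phi> x) \<rho> \<subseteq> K" and d: "dist x z < a * \<rho>"
  shows "z \<in> U \<and> a * norm (\<phi> z - \<phi> x) \<le> dist x z"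
proof -
  note cp = chart_props[OF c]
  have *: "z \<in> U \<and> a * norm (\<phi> z - \<phi> x) \<le> L" if L: "dist x z < L" "L < a * \<rho>" for L
  proof -
    have L0: "0 < L" using L(1) zero_le_dist[of x z] by linarith
    obtain \<gamma> where p: "piecewise_C1_path A \<gamma>" "\<gamma> 0 = x" "\<gamma> 1 = z" "path_length A g \<gamma> < ennreal L"
      by (rule short_path[OF L(1)])
    have cg: "continuous_on {0..1} \<gamma>" using p(1) by (simp add: piecewise_C1_path_def path_def)
    define W where "W = {y \<in> U. \<phi> y \<in> ball (\<phi> x) \<rho>}"
    have oW: "open W"
    proof -
      have "W = U \<inter> \<phi> -` ball (\<phi> x) \<rho>" by (auto simp: W_def)
      then show ?thesis using cp(1,3) by (simp add: continuous_open_preimage)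
    qed
    have key: "a * norm (\<phi> (\<gamma> t) - \<phi> x) \<le> L" if t: "t \<in> {0..1}" and tw: "\<And>s. s \<in> {0..t} \<Longrightarrow> \<gamma> s \<in> W" for t
    proof -
      have "\<gamma> s \<in> U \<and> \<phi> (\<gamma> s) \<in> K" if "s \<in> {0..t}" for s
        using tw[OF that] subsetD[OF x(2), of "\<phi> (\<gamma> s)"] by (auto simp: W_def)
      then have "ennreal (a * norm (\<phi> (\<gamma> t) - \<phi> (\<gamma> 0))) \<le> arc_length \<gamma> 0 t"
        using t by (intro chart_displacement_le_arc_length[OF p(1) c K a low]) auto
      also have "\<dots> \<le> arc_length \<gamma> 0 t + arc_length \<gamma> t 1" by simp
      also have "\<dots> \<le> path_length A g \<gamma>" using t by (simp add: arc_length_add p arc_length_le)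
      also note p(4)
      finally show ?thesis using L0 p(2) by (simp add: ennreal_less_iff a less_imp_le)
    qed
    have "{0..1} \<inter> \<gamma> -` (- W) = {}"
    proof (rule ccontr)
      assume ne: "{0..1} \<inter> \<gamma> -` (- W) \<noteq> {}"
      have "closed ({0..1} \<inter> \<gamma> -` (- W))"
        using cg oW by (intro continuous_closed_preimage) auto
      then have "compact ({0..1} \<inter> \<gamma> -` (- W))"
        by (metis compact_Icc compact_Int_closed inf.left_idem)
      \<comment> \<open>The first time outside of \<open>W\<close>.\<close>
      then obtain s0 where s0: "s0 \<in> {0..1} \<inter> \<gamma> -` (- W)" "\<And>s. s \<in> {0..1} \<inter> \<gamma> -` (- W) \<Longrightarrow> s0 \<le> s"
        using compact_attains_inf[OF _ ne] by blast
      have before: "\<gamma> s \<in> W" if "0 \<le> s" "s < s0" for s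
      proof (rule ccontr)
        assume "\<gamma> s \<notin> W"
        then have "s0 \<le> s" using that s0(1) by (intro s0(2)) auto
        with that show False by simp
      qed
      define K' where "K' = inv_into U \<phi> ` cball (\<phi> x) (L / a)"
      have La: "L / a < \<rho>" using L(2) a by (simp add: field_simps)
      then have sub: "cball (\<phi> x) (L / a) \<subseteq> \<phi> ` U" using x(2) K by (force simp: subset_eq)
      have "compact K'"
        unfolding K'_def using sub
        by (intro compact_continuous_image[OF continuous_on_subset[OF cp(5)]]) auto
      then have clK: "closed K'" by (rule compact_imp_closed)
      have KW: "K' \<subseteq> W" 
      proof
        fix y assume "y \<in> K'"
        then obtain u where u: "y = inv_into U \<phi> u" "u \<in> cball (\<phi> x) (L / a)" by (auto simp: K'_def)
        then have "u \<in> \<phi> ` U" using sub by auto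
        from cp(7)[OF this] u La show "y \<in> W" by (auto simp: W_def)
      qed
      \<comment> \<open>Up to that time the path stays in a compact subset of \<open>W\<close>, which contains the exit point by continuity.\<close>
      have inK: "\<gamma> s \<in> K'" if s: "0 \<le> s" "s < s0" for s
      proof -
        have "a * norm (\<phi> (\<gamma> s) - \<phi> x) \<le> L"
          using s s0(1) by (intro key before) auto
        then have "\<phi> (\<gamma> s) \<in> cball (\<phi> x) (L / a)" using a by (simp add: dist_norm norm_minus_commute field_simps)
        then show ?thesis using before[OF s] cp(6)[of "\<gamma> s"] unfolding K'_def W_def by (metis (lifting) image_eqI mem_Collect_eq)
      qed
      have "\<gamma> 0 \<in> W" using p(2) x \<rho> by (simp add: W_def)
      then have "s0 \<noteq> 0" using s0(1) by auto
      then have pos: "0 < s0" "s0 \<le> 1" using s0(1) by auto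
      have "(\<gamma> \<longlongrightarrow> \<gamma> s0) (at s0 within {0..s0})"
        using cg pos by (metis atLeastAtMost_iff atLeastatMost_subset_iff continuous_on_def continuous_on_subset less_imp_le order_refl)
      then have lim: "(\<gamma> \<longlongrightarrow> \<gamma> s0) (at_left s0)"
        using pos by (simp add: at_within_Icc_at_left)
      have ev: "eventually (\<lambda>s. s \<in> {0<..<s0}) (at_left s0)"
        by (rule eventually_at_left_real[OF pos(1)])
      have "\<gamma> s0 \<in> K'"
        by (rule Lim_in_closed_set[OF clK _ _ lim]) (use ev in \<open>auto elim!: eventually_mono intro!: inK\<close>)
      with KW s0(1) show False by auto
    qed
    then have all: "\<gamma> s \<in> W" if "s \<in> {0..1}" for s using that by blast
    have "a * norm (\<phi> (\<gamma> 1) - \<phi> x) \<le> L" using all by (intro key) auto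
    moreover have "\<gamma> 1 \<in> U" using all[of 1] by (simp add: W_def)
    ultimately show ?thesis by (simp add: p(3))
  qed
  obtain L where "dist x z < L" "L < a * \<rho>" using d dense by blast
  with * have "z \<in> U" by blast
  moreover have "a * norm (\<phi> z - \<phi> x) \<le> dist x z"
  proof (rule field_le_epsilon)
    fix e :: real assume e: "0 < e"
    obtain L where "dist x z < L" "L < min (a * \<rho>) (dist x z + e)"
      using d e dense[of "dist x z" "min (a * \<rho>) (dist x z + e)"] by auto
    with *[of L] show "a * norm (\<phi> z - \<phi> x) \<le> dist x z + e" by auto
  qed
  ultimately show ?thesis by blast
qed

end

section \<open>Volume growth of balls\<close>

text \<open>Only radii up to \<open>1\<close> are considered, since a finite measure has no growth at large radii.\<close>

definition ahlfors_regular :: "nat \<Rightarrow> 'a::metric_space measure \<Rightarrow> bool" where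
  "ahlfors_regular d M \<longleftrightarrow> (\<exists>c>0. \<exists>C>0. \<forall>x r. 0 < r \<and> r \<le> 1 \<longrightarrow>
     c * r ^ d \<le> measure M (ball x r) \<and> measure M (ball x r) \<le> C * r ^ d)"

text \<open>All matrices on the segment from the identity to \<open>M\<close> are positive definite, hence invertible, so the
  determinant keeps the sign that it has at the identity.\<close>

lemma det_pos_if_positive_definite:
  fixes M :: "real^'n^'n"
  assumes pos: "\<And>v. v \<noteq> 0 \<Longrightarrow> 0 < v \<bullet> (M *v v)"
  shows "0 < det M"
proof (rule ccontr)
  assume neg: "\<not> 0 < det M"
  let ?N = "\<lambda>s. (1 - s) *\<^sub>R mat 1 + s *\<^sub>R M :: real^'n^'n"
  have "continuous_on {0..1} (\<lambda>s. det (?N s))"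
    unfolding det_def by (auto intro!: continuous_intros)
  then obtain s where s: "0 \<le> s" "s \<le> 1" "det (?N s) = 0"
    using IVT2'[of "\<lambda>s. det (?N s)" 1 0 0] neg by auto
  then have "\<not> invertible (?N s)" by (simp add: invertible_det_nz)
  then have "\<not> inj ((*v) (?N s))"
    by (simp add: invertible_left_inverse matrix_left_invertible_injective)
  then obtain v where v: "v \<noteq> 0" "?N s *v v = 0"
    using matrix_left_invertible_ker[of "?N s"] matrix_left_invertible_injective[of "?N s"] by blast
  have "0 = v \<bullet> (?N s *v v)" using v(2) by simp
  also have "\<dots> = (1 - s) * (v \<bullet> v) + s * (v \<bullet> (M *v v))"
    by (simp add: matrix_vector_mult_add_rdistrib inner_add_right scaleR_matrix_vector_assoc[symmetric])
  also have "\<dots> > 0"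
  proof (cases "s = 0")
    case False
    then have "0 < s * (v \<bullet> (M *v v))" using s pos[OF v(1)] by simp
    moreover have "0 \<le> (1 - s) * (v \<bullet> v)" using s by simp
    ultimately show ?thesis by linarith
  qed (use v in simp)
  finally show False by simp
qed

context riemannian
begin

lemma tensor_det_pos: "(U, \<phi>) \<in> A \<Longrightarrow> x \<in> U \<Longrightarrow> 0 < det (g (U, \<phi>) x)"
  by (intro det_pos_if_positive_definite tensor_pos)

lemma continuous_on_tensor_det:
  assumes "(U, \<phi>) \<in> A"
  shows "continuous_on (\<phi> ` U) (\<lambda>u. det (g (U, \<phi>) (inv_into U \<phi> u)))"
  unfolding det_def using tensor_continuous[OF assms]
  by (auto intro!: continuous_intros)

text \<open>A small metric ball lies between two coordinate balls with comparable radii, and the volume density is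
  bounded above and away from zero on a compact coordinate ball.\<close>

lemma local_volume_growth:
  assumes vol: "riemannian_volume A g vol"
  obtains W r0 c C where "open W" "x0 \<in> W" "0 < r0" "0 < c" "0 < C"
    "\<And>x r. x \<in> W \<Longrightarrow> 0 < r \<Longrightarrow> r \<le> r0 \<Longrightarrow> ennreal (c * r ^ CARD('n)) \<le> emeasure vol (ball x r)
        \<and> emeasure vol (ball x r) \<le> ennreal (C * r ^ CARD('n))"
proof -
  obtain U \<phi> where c: "(U, \<phi>) \<in> A" and x0: "x0 \<in> U" by (rule chart_at)
  note cp = chart_props[OF c]
  obtain e where e: "0 < e" "cball (\<phi> x0) e \<subseteq> \<phi> ` U"
    using cp(2) x0 by (metis imageI open_contains_cball)
  define K where "K = cball (\<phi> x0) e"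
  define \<rho> where "\<rho> = e / 2"
  have \<rho>: "0 < \<rho>" using e by (simp add: \<rho>_def)
  have K: "compact K" "K \<subseteq> \<phi> ` U" "K \<noteq> {}" "convex K"
    using e by (auto simp: K_def)
  obtain a b where ab: "0 < a" "0 < b"
    and low: "\<And>u v. u \<in> K \<Longrightarrow> a * norm v \<le> sqrt (v \<bullet> (g (U, \<phi>) (inv_into U \<phi> u) *v v))"
    and up: "\<And>u v. u \<in> K \<Longrightarrow> sqrt (v \<bullet> (g (U, \<phi>) (inv_into U \<phi> u) *v v)) \<le> b * norm v"
    using tensor_bounds[OF c K(1-3)] by blast
  let ?J = "\<lambda>u. sqrt (det (g (U, \<phi>) (inv_into U \<phi> u)))"
  have contJ: "continuous_on K ?J"
    by (intro continuous_intros continuous_on_subset[OF continuous_on_tensor_det[OF c] K(2)])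
  obtain p where p: "p \<in> K" "\<And>u. u \<in> K \<Longrightarrow> ?J p \<le> ?J u"
    using continuous_attains_inf[OF K(1) K(3) contJ] by blast
  obtain q where q: "q \<in> K" "\<And>u. u \<in> K \<Longrightarrow> ?J u \<le> ?J q"
    using continuous_attains_sup[OF K(1) K(3) contJ] by blast
  have Jpos: "0 < ?J u" if "u \<in> K" for u
    using that K(2) cp(7)[of u] tensor_det_pos[OF c] by auto
  have volE: "emeasure vol E = (\<integral>\<^sup>+u\<in>\<phi> ` E. ennreal (?J u) \<partial>lborel)" if "E \<in> sets borel" "E \<subseteq> U" for E
    using vol c that unfolding riemannian_volume_def by blast
  have sets: "sets vol = sets borel" using vol by (simp add: riemannian_volume_def)
  define W where "W = U \<inter> \<phi> -` ball (\<phi> x0) \<rho>"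
  define w where "w = unit_ball_vol (real CARD('n))"
  have w: "0 < w" by (simp add: w_def)
  show thesis
  proof (rule that[of W "min (a * \<rho> / 2) (b * \<rho>)" "?J p * w / b ^ CARD('n)" "?J q * w / a ^ CARD('n)"])
    show "open W" unfolding W_def using cp(1,3) by (simp add: continuous_open_preimage)
    show "x0 \<in> W" using x0 \<rho> by (simp add: W_def)
    show "0 < min (a * \<rho> / 2) (b * \<rho>)" using ab \<rho> by simp
    show "0 < ?J p * w / b ^ CARD('n)" using Jpos[OF p(1)] w ab by simp
    show "0 < ?J q * w / a ^ CARD('n)" using Jpos[OF q(1)] w ab by simp
    fix x r assume x: "x \<in> W" and r: "0 < r" "r \<le> min (a * \<rho> / 2) (b * \<rho>)"
    have xU: "x \<in> U" and cb: "cball (\<phi> x) \<rho> \<subseteq> K"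
    proof -
      show "x \<in> U" using x by (simp add: W_def)
      show "cball (\<phi> x) \<rho> \<subseteq> K"
      proof
        fix u assume "u \<in> cball (\<phi> x) \<rho>"
        then have "dist (\<phi> x0) u \<le> dist (\<phi> x0) (\<phi> x) + dist (\<phi> x) u" "dist (\<phi> x) u \<le> \<rho>"
          by (auto intro: dist_triangle)
        then show "u \<in> K" using x by (auto simp: W_def K_def \<rho>_def)
      qed
    qed
    have ra: "r < a * \<rho>"
    proof -
      have "0 < a * \<rho>" using ab \<rho> by simp
      then show ?thesis using r(2) by linarith
    qed
    have B: "z \<in> U \<and> \<phi> z \<in> cball (\<phi> x) (r / a)" if "z \<in> ball x r" for z
    proof -
      have "z \<in> U \<and> a * norm (\<phi> z - \<phi> x) \<le> dist x z"
        using that ra by (intro chart_norm_le_dist[OF c K(2) ab(1) \<rho> low xU cb]) auto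
      with that ab show ?thesis by (auto simp: dist_norm norm_minus_commute field_simps)
    qed
    have rrho: "r / a \<le> \<rho>" "r / b \<le> \<rho>" using r ab ra by (auto simp: field_simps)
    have "emeasure vol (ball x r) = (\<integral>\<^sup>+u\<in>\<phi> ` ball x r. ennreal (?J u) \<partial>lborel)"
      using B by (intro volE) auto
    also have "\<dots> \<le> (\<integral>\<^sup>+u\<in>cball (\<phi> x) (r / a). ennreal (?J q) \<partial>lborel)"
    proof (rule nn_integral_mono)
      fix u
      show "ennreal (?J u) * indicator (\<phi> ` ball x r) u \<le> ennreal (?J q) * indicator (cball (\<phi> x) (r / a)) u"
      proof (cases "u \<in> \<phi> ` ball x r")
        case True
        then have *: "u \<in> cball (\<phi> x) (r / a)" using B by blast
        then have "u \<in> K" using cb rrho by auto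
        with q(2) True * show ?thesis by (auto intro!: ennreal_leI)
      qed simp
    qed
    also have "\<dots> = ennreal (?J q * w / a ^ CARD('n) * r ^ CARD('n))"
      using Jpos[OF q(1)] r ab w
      by (simp add: nn_integral_cmult_indicator emeasure_cball w_def ennreal_mult[symmetric] power_divide)
    finally have upper: "emeasure vol (ball x r) \<le> ennreal (?J q * w / a ^ CARD('n) * r ^ CARD('n))" .
    \<comment> \<open>For the lower bound, the coordinate ball of radius \<open>r / b\<close> lies in the metric ball.\<close>
    define E where "E = U \<inter> \<phi> -` ball (\<phi> x) (r / b)"
    have "open E" unfolding E_def using cp(1,3) by (simp add: continuous_open_preimage)
    have bK: "ball (\<phi> x) (r / b) \<subseteq> K" using cb rrho by auto
    have img: "\<phi> ` E = ball (\<phi> x) (r / b)"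
    proof
      show "ball (\<phi> x) (r / b) \<subseteq> \<phi> ` E"
      proof
        fix u assume u: "u \<in> ball (\<phi> x) (r / b)"
        then have "u \<in> \<phi> ` U" using bK K(2) by blast
        with u cp(7)[OF this] show "u \<in> \<phi> ` E" unfolding E_def by (intro image_eqI[of _ _ "inv_into U \<phi> u"]) auto
      qed
    qed (auto simp: E_def)
    have EB: "E \<subseteq> ball x r"
    proof
      fix z assume z: "z \<in> E"
      then have zU: "z \<in> U" and zb: "\<phi> z \<in> ball (\<phi> x) (r / b)" by (auto simp: E_def)
      have "\<phi> x \<in> K" "\<phi> z \<in> K" using cb \<rho> zb bK by auto
      then have "dist (inv_into U \<phi> (\<phi> x)) (inv_into U \<phi> (\<phi> z)) \<le> b * norm (\<phi> z - \<phi> x)"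
        by (intro dist_le_chart_norm[OF c K(2) K(4) ab(2) up])
      moreover have "b * norm (\<phi> z - \<phi> x) < r"
        using zb ab by (simp add: dist_norm norm_minus_commute field_simps)
      ultimately show "z \<in> ball x r" using cp(6)[OF xU] cp(6)[OF zU] by simp
    qed
    have "ennreal (?J p * w / b ^ CARD('n) * r ^ CARD('n)) = (\<integral>\<^sup>+u\<in>ball (\<phi> x) (r / b). ennreal (?J p) \<partial>lborel)"
      using Jpos[OF p(1)] r ab w
      by (simp add: nn_integral_cmult_indicator emeasure_ball w_def ennreal_mult[symmetric] power_divide)
    also have "\<dots> \<le> (\<integral>\<^sup>+u\<in>\<phi> ` E. ennreal (?J u) \<partial>lborel)"
      unfolding img
    proof (rule nn_integral_mono)
      fix u
      show "ennreal (?J p) * indicator (ball (\<phi> x) (r / b)) u \<le> ennreal (?J u) * indicator (ball (\<phi> x) (r / b)) u"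
      proof (cases "u \<in> ball (\<phi> x) (r / b)")
        case True
        then have "u \<in> K" using bK by blast
        then show ?thesis using p(2) by (intro mult_right_mono ennreal_leI) auto
      qed simp
    qed
    also have "\<dots> = emeasure vol E" using \<open>open E\<close> by (intro volE[symmetric]) (auto simp: E_def)
    also have "\<dots> \<le> emeasure vol (ball x r)" using EB sets by (intro emeasure_mono) auto
    finally show "ennreal (?J p * w / b ^ CARD('n) * r ^ CARD('n)) \<le> emeasure vol (ball x r)
        \<and> emeasure vol (ball x r) \<le> ennreal (?J q * w / a ^ CARD('n) * r ^ CARD('n))"
      using upper by blast
  qed
qed

lemma volume_growth:
  assumes vol: "riemannian_volume A g vol" and comp: "compact (UNIV :: 'a set)"
  obtains r0 c C where "0 < r0" "r0 \<le> 1" "0 < c" "0 < C"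
    "\<And>x r. 0 < r \<Longrightarrow> r \<le> r0 \<Longrightarrow> ennreal (c * r ^ CARD('n)) \<le> emeasure vol (ball x r)
        \<and> emeasure vol (ball x r) \<le> ennreal (C * r ^ CARD('n))"
proof -
  have "\<forall>x0. \<exists>W r0 c C. open W \<and> x0 \<in> W \<and> 0 < r0 \<and> 0 < c \<and> 0 < C \<and>
    (\<forall>x r. x \<in> W \<longrightarrow> 0 < r \<longrightarrow> r \<le> r0 \<longrightarrow> ennreal (c * r ^ CARD('n)) \<le> emeasure vol (ball x r)
        \<and> emeasure vol (ball x r) \<le> ennreal (C * r ^ CARD('n)))" (is "\<forall>x0. \<exists>W r0 c C. ?P x0 W r0 c C")
  proof
    fix x0 show "\<exists>W r0 c C. ?P x0 W r0 c C"
      by (rule local_volume_growth[OF vol, of x0]) blast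
  qed
  then obtain W r0 c C where P: "\<And>x0. ?P x0 (W x0) (r0 x0) (c x0) (C x0)" by metis
  have oW: "open (W s)" and mW: "s \<in> W s" for s using P[of s] by auto
  then have cover: "(UNIV :: 'a set) \<subseteq> (\<Union>s\<in>UNIV. W s)" by blast
  obtain S where "S \<subseteq> UNIV" and S: "finite S" "UNIV \<subseteq> (\<Union>s\<in>S. W s)"
    by (rule compactE_image[OF comp, of UNIV W]) (rule oW, rule cover)
  then have ne: "S \<noteq> {}" by auto
  show thesis
  proof (rule that[of "min 1 (Min (r0 ` S))" "Min (c ` S)" "Max (C ` S)"])
    show "0 < min 1 (Min (r0 ` S))" "0 < Min (c ` S)" "min 1 (Min (r0 ` S)) \<le> 1"
      using S ne P by auto
    show "0 < Max (C ` S)" using S ne P by (subst Max_gr_iff) auto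
    fix x r assume r: "0 < r" "r \<le> min 1 (Min (r0 ` S))"
    obtain s where s: "s \<in> S" "x \<in> W s" using S by blast
    have "Min (r0 ` S) \<le> r0 s" "Min (c ` S) \<le> c s" "C s \<le> Max (C ` S)"
      using s S by auto
    moreover from this have "ennreal (c s * r ^ CARD('n)) \<le> emeasure vol (ball x r)"
        "emeasure vol (ball x r) \<le> ennreal (C s * r ^ CARD('n))"
      using P[of s] s r by auto
    moreover have "0 \<le> r ^ CARD('n)" using r by simp
    ultimately show "ennreal (Min (c ` S) * r ^ CARD('n)) \<le> emeasure vol (ball x r)
        \<and> emeasure vol (ball x r) \<le> ennreal (Max (C ` S) * r ^ CARD('n))"
      by (meson ennreal_leI mult_right_mono order_trans)
  qed
qed

text \<open>The restriction to radii below \<open>r0\<close> is removed at the cost of the constants.\<close>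

lemma ahlfors_regular_volume:
  assumes vol: "riemannian_volume A g vol" and comp: "compact (UNIV :: 'a set)"
    and m: "m = uniform_measure vol UNIV" and fin: "0 < emeasure vol UNIV" "emeasure vol UNIV < \<infinity>"
  shows "ahlfors_regular CARD('n) m"
proof -
  obtain r0 c C where *: "0 < r0" "r0 \<le> 1" "0 < c" "0 < C"
    "\<And>x r. 0 < r \<Longrightarrow> r \<le> r0 \<Longrightarrow> ennreal (c * r ^ CARD('n)) \<le> emeasure vol (ball x r)
        \<and> emeasure vol (ball x r) \<le> ennreal (C * r ^ CARD('n))"
    using volume_growth[OF vol comp] by blast
  have sets: "sets vol = sets borel" using vol by (simp add: riemannian_volume_def)
  then have sp: "space vol = UNIV" by (metis sets_eq_imp_space_eq space_borel)
  define V where "V = measure vol UNIV"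
  have V: "emeasure vol UNIV = ennreal V" "0 < V"
  proof -
    show "emeasure vol UNIV = ennreal V"
      unfolding V_def measure_def using fin(2) by (simp add: ennreal_enn2real_if)
    show "0 < V"
      unfolding V_def measure_def using fin by (simp add: enn2real_positive_iff)
  qed
  have finE: "emeasure vol E < \<infinity>" for E
    using emeasure_space[of vol E] fin(2) sp by (metis order.strict_trans1)
  have finv: "finite_measure vol" by (rule finite_measureI) (use fin sp in auto)
  interpret v: finite_measure vol by fact
  have mm: "measure m (ball x r) = measure vol (ball x r) / V" for x r
    using V unfolding m by (subst measure_uniform_measure) (auto simp: sets V_def)
  have b: "c * r ^ CARD('n) \<le> measure vol (ball x r)" "measure vol (ball x r) \<le> C * r ^ CARD('n)"
    if "0 < r" "r \<le> r0" for x r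
    using *(5)[OF that] *(3,4) that by (auto simp: v.emeasure_eq_measure)
  have mono: "measure vol (ball x r) \<le> measure vol (ball x s)" if "r \<le> s" for x r s
    using that sets by (intro v.finite_measure_mono) auto
  show ?thesis
    unfolding ahlfors_regular_def
  proof (intro exI conjI allI impI)
    let ?d = "CARD('n)"
    show "0 < c * r0 ^ ?d / V" "0 < C / V + 1 / r0 ^ ?d" using * V by (auto intro!: add_pos_pos)
    fix x r assume r: "0 < r \<and> r \<le> (1::real)"
    have "r0 * r \<le> r0" "r0 * r \<le> r" using r * by (auto simp: mult_left_le mult_left_le_one_le)
    then have "c * (r0 * r) ^ ?d \<le> measure vol (ball x r)"
      using b(1)[of "r0 * r" x] mono[of "r0 * r" r x] r * by auto
    then show "c * r0 ^ ?d / V * r ^ ?d \<le> measure m (ball x r)"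
      unfolding mm using V by (simp add: power_mult_distrib field_simps)
    show "measure m (ball x r) \<le> (C / V + 1 / r0 ^ ?d) * r ^ ?d"
    proof (cases "r \<le> r0")
      case True
      then have "measure m (ball x r) \<le> C / V * r ^ ?d"
        unfolding mm using b(2)[of r x] V r by (simp add: field_simps)
      also have "\<dots> \<le> (C / V + 1 / r0 ^ ?d) * r ^ ?d"
        using r * by (intro mult_right_mono) auto
      finally show ?thesis .
    next
      case False
      have "measure vol (ball x r) \<le> V" unfolding V_def using sets by (intro v.finite_measure_mono) auto
      then have "measure m (ball x r) \<le> 1" unfolding mm using V by (simp add: field_simps)
      also have "1 \<le> (r / r0) ^ ?d" using False * by (intro one_le_power) auto
      also have "\<dots> = 1 / r0 ^ ?d * r ^ ?d" by (simp add: power_divide)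
      also have "\<dots> \<le> (C / V + 1 / r0 ^ ?d) * r ^ ?d"
        using r * V by (intro mult_right_mono) auto
      finally show ?thesis .
    qed
  qed
qed

end

section \<open>Thin annuli\<close>

text \<open>A compact metric space has a countable dense set, and \<open>dist x y < a\<close> holds iff some point \<open>s\<close> of it and
  some rational \<open>q\<close> satisfy \<open>dist s x < q\<close> and \<open>dist s y < a - q\<close>. So the distance is measurable with
  respect to the product of the Borel \<open>\<sigma>\<close>-algebras.\<close>

lemma borel_measurable_dist_compact:
  assumes comp: "compact (UNIV :: 'a::metric_space set)"
  shows "(\<lambda>(x, y). dist x y :: real) \<in> borel_measurable (borel \<Otimes>\<^sub>M (borel :: 'a measure))"
proof -
  have "\<exists>S. finite S \<and> (\<forall>x::'a. \<exists>s\<in>S. dist x s < 1 / real (Suc n))" for n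
  proof -
    have "0 < 1 / real (Suc n)" by simp
    then obtain S where "finite S" "(UNIV :: 'a set) \<subseteq> (\<Union>s\<in>S. ball s (1 / real (Suc n)))"
      using comp unfolding compact_eq_totally_bounded by blast
    then show ?thesis by (intro exI[of _ S]) (auto simp: dist_commute subset_eq)
  qed
  then obtain S where S: "\<And>n. finite (S n)" "\<And>n (x::'a). \<exists>s\<in>S n. dist x s < 1 / real (Suc n)" by metis
  define D where "D = (\<Union>n. S n)"
  have cD: "countable D" unfolding D_def using S(1) by (intro countable_UN) (auto intro: countable_finite)
  have dense: "\<exists>s\<in>D. dist x s < e" if e: "0 < e" for x e
  proof -
    obtain n where "inverse (real (Suc n)) < e" using reals_Archimedean[OF e] by blast
    moreover obtain s where "s \<in> S n" "dist x s < 1 / real (Suc n)" using S(2) by blast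
    ultimately show ?thesis unfolding D_def by (intro bexI[of _ s]) (auto simp: inverse_eq_divide)
  qed
  have "{w \<in> space (borel \<Otimes>\<^sub>M (borel :: 'a measure)). (case w of (x, y) \<Rightarrow> dist x y) < a} \<in> sets ((borel :: 'a measure) \<Otimes>\<^sub>M (borel :: 'a measure))" for a :: real
  proof -
    have "{w \<in> space (borel \<Otimes>\<^sub>M (borel :: 'a measure)). (case w of (x, y) \<Rightarrow> dist x y) < a} =
       (\<Union>s\<in>D. \<Union>q\<in>\<rat>. ball s q \<times> ball s (a - q))" (is "?L = ?R")
    proof
      show "?R \<subseteq> ?L"
      proof
        fix w assume "w \<in> ?R"
        then obtain x y s q where w: "w = (x, y)" "dist s x < q" "dist s y < a - q" by auto
        have "dist x y \<le> dist s x + dist s y" by (rule dist_triangle3)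
        with w show "w \<in> ?L" by (simp add: space_pair_measure)
      qed
      show "?L \<subseteq> ?R"
      proof
        fix w assume "w \<in> ?L"
        then obtain x y where w: "w = (x, y)" "dist x y < a" by (cases w) auto
        define e where "e = (a - dist x y) / 4"
        have e: "0 < e" using w by (simp add: e_def)
        obtain s where s: "s \<in> D" "dist x s < e" using dense[OF e] by blast
        obtain q where q: "q \<in> \<rat>" "e < q" "q < 2 * e" using Rats_dense_in_real[of e "2*e"] e by auto
        have "dist s y \<le> dist x s + dist x y" by (rule dist_triangle3)
        then have "dist s y < a - q" using s q by (auto simp: e_def field_simps)
        then show "w \<in> ?R" using s q by (auto simp: w dist_commute intro!: bexI[of _ s] bexI[of _ q])
      qed
    qed
    moreover have "?R \<in> sets ((borel :: 'a measure) \<Otimes>\<^sub>M (borel :: 'a measure))"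
      using cD countable_rat by (intro sets.countable_UN' ) auto
    ultimately show ?thesis by simp
  qed
  then show ?thesis by (rule borel_measurableI_less)
qed

lemma measurable_dist_pair:
  assumes "compact (UNIV :: 'a::metric_space set)" "f \<in> measurable M (borel :: 'a measure)" "g \<in> measurable M borel"
  shows "(\<lambda>x. dist (f x) (g x)) \<in> borel_measurable M"
  using measurable_compose[OF measurable_Pair[OF assms(2,3)] borel_measurable_dist_compact[OF assms(1)]] by simp

abbreviation annulus :: "'a::metric_space \<Rightarrow> real \<Rightarrow> real \<Rightarrow> 'a set" where
  "annulus y r s \<equiv> {z. r - s \<le> dist y z \<and> dist y z < r}"

lemma annulus_borel: "annulus y r s \<in> sets borel"
proof -
  have "annulus y r s = ball y r - ball y (r - s)" by auto
  then show ?thesis by simp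
qed

text \<open>From a point \<open>z\<close> of the outer layer of width \<open>s\<close> one can move towards \<open>y\<close> and find a ball of radius \<open>s / 2\<close>
  that lies in the layer below, of width \<open>2 * s\<close>, and within \<open>4 * s\<close> of \<open>z\<close>. Integrating the measure of the
  points of the lower layer close to \<open>z\<close> over all \<open>z\<close> in the outer layer, and exchanging the integrals,
  bounds the outer layer by a constant times the lower one.\<close>

lemma annulus_measure_step:
  fixes M :: "'a::metric_space measure"
  assumes comp: "compact (UNIV :: 'a set)" and M: "prob_space M" "sets M = sets borel"
    and between: "\<And>(u::'a) v a e. 0 \<le> a \<Longrightarrow> a \<le> dist u v \<Longrightarrow> 0 < e \<Longrightarrow> \<exists>z. dist u z = a \<and> dist z v < dist u v - a + e"
    and reg: "\<And>x r. 0 < r \<Longrightarrow> r \<le> 1 \<Longrightarrow> c * r ^ d \<le> measure M (ball x r) \<and> measure M (ball x r) \<le> C * r ^ d"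
    and c: "0 < c" and C: "0 < C" and s: "0 < s" "4 * s \<le> 1" "4 * s \<le> r"
  shows "measure M (annulus y r s) \<le> C * 8 ^ d / c * (measure M (annulus y r (3 * s)) - measure M (annulus y r s))"
proof -
  interpret prob_space M by fact
  interpret P: pair_prob_space M M by standard
  note M(2)[measurable_cong]
  define D where "D = annulus y r (3 * s) - annulus y r s"
  have [measurable]: "annulus y r s \<in> sets borel" "D \<in> sets borel" "annulus y r (3 * s) \<in> sets borel"
    by (auto simp: D_def annulus_borel)
  have dm: "(\<lambda>w. dist (fst w) (snd w)) \<in> borel_measurable (M \<Otimes>\<^sub>M M)"
    by (intro measurable_dist_pair[OF comp]) measurable
  let ?f = "\<lambda>(z, w). indicator (annulus y r s) z * indicator D w * indicator {z. dist z w < 4 * s} z :: ennreal"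
  have f: "?f \<in> borel_measurable (M \<Otimes>\<^sub>M M)"
  proof -
    have "(\<lambda>w. indicator (annulus y r s) (fst w) * indicator D (snd w) * indicator {x. x < 4 * s} (dist (fst w) (snd w)) :: ennreal)
      \<in> borel_measurable (M \<Otimes>\<^sub>M M)" using dm by measurable
    then show ?thesis by (simp add: case_prod_beta indicator_def)
  qed
  have lower: "ennreal (c * (s / 2) ^ d) \<le> (\<integral>\<^sup>+w. ?f (z, w) \<partial>M)" if z: "z \<in> annulus y r s" for z
  proof -
    \<comment> \<open>Around a point at distance \<open>r - 5 * s / 2\<close> from \<open>y\<close>, the ball of radius \<open>s / 2\<close> has distances between
      \<open>r - 3 * s\<close> and \<open>r - 2 * s\<close> from \<open>y\<close>.\<close>
    obtain z' where z': "dist y z' = r - 5 * s / 2" "dist z' z < dist y z - (r - 5 * s / 2) + s / 2"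
      using between[where a="r - 5 * s / 2" and u=y and v=z and e="s / 2"] z s by auto
    have sub: "ball z' (s / 2) \<subseteq> D \<inter> {w. dist z w < 4 * s}"
    proof
      fix w assume w: "w \<in> ball z' (s / 2)"
      have "dist y w \<le> dist y z' + dist z' w" by (rule dist_triangle)
      moreover have "dist y z' \<le> dist y w + dist z' w" by (metis dist_commute dist_triangle)
      moreover have "dist z w \<le> dist z' z + dist z' w" by (rule dist_triangle3)
      ultimately show "w \<in> D \<inter> {w. dist z w < 4 * s}" using w z z' s by (auto simp: D_def)
    qed
    have "ennreal (c * (s / 2) ^ d) \<le> emeasure M (ball z' (s / 2))"
      using reg[of "s/2" z'] s by (simp add: emeasure_eq_measure)
    also have "\<dots> = (\<integral>\<^sup>+w. indicator (ball z' (s / 2)) w \<partial>M)" by simp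
    also have "\<dots> \<le> (\<integral>\<^sup>+w. ?f (z, w) \<partial>M)"
      using sub z by (intro nn_integral_mono) (auto simp: indicator_def)
    finally show ?thesis .
  qed
  have "ennreal (c * (s / 2) ^ d) * emeasure M (annulus y r s) = (\<integral>\<^sup>+z. ennreal (c * (s / 2) ^ d) * indicator (annulus y r s) z \<partial>M)"
    by (simp add: nn_integral_cmult_indicator)
  also have "\<dots> \<le> (\<integral>\<^sup>+z. (\<integral>\<^sup>+w. ?f (z, w) \<partial>M) \<partial>M)"
    using lower by (intro nn_integral_mono) (simp add: indicator_def)
  also have "\<dots> = (\<integral>\<^sup>+w. (\<integral>\<^sup>+z. ?f (z, w) \<partial>M) \<partial>M)"
    by (rule P.Fubini'[symmetric]) (use f in simp)
  also have "\<dots> \<le> (\<integral>\<^sup>+w. ennreal (C * (4 * s) ^ d) * indicator D w \<partial>M)"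
  proof (rule nn_integral_mono)
    fix w
    have "(\<integral>\<^sup>+z. ?f (z, w) \<partial>M) \<le> (\<integral>\<^sup>+z. indicator D w * indicator (ball w (4 * s)) z \<partial>M)"
      by (intro nn_integral_mono) (auto simp: indicator_def dist_commute)
    also have "\<dots> = indicator D w * emeasure M (ball w (4 * s))" by (rule nn_integral_cmult_indicator) simp
    also have "\<dots> \<le> indicator D w * ennreal (C * (4 * s) ^ d)"
      using reg[of "4 * s" w] s by (intro mult_left_mono) (auto simp: emeasure_eq_measure intro!: ennreal_leI)
    finally show "(\<integral>\<^sup>+z. ?f (z, w) \<partial>M) \<le> ennreal (C * (4 * s) ^ d) * indicator D w" by (simp add: mult.commute)
  qed
  also have "\<dots> = ennreal (C * (4 * s) ^ d) * emeasure M D" by (simp add: nn_integral_cmult_indicator)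
  finally have "c * (s / 2) ^ d * measure M (annulus y r s) \<le> C * (4 * s) ^ d * measure M D"
    using c C s by (simp add: emeasure_eq_measure ennreal_mult[symmetric])
  moreover have "measure M D = measure M (annulus y r (3 * s)) - measure M (annulus y r s)"
    unfolding D_def using s by (intro finite_measure_Diff) auto
  moreover have "(4 * s) ^ d = 8 ^ d * (s / 2) ^ d" unfolding power_mult_distrib[symmetric] by simp
  ultimately have "(s / 2) ^ d * (c * measure M (annulus y r s)) \<le> (s / 2) ^ d * (C * 8 ^ d * (measure M (annulus y r (3 * s)) - measure M (annulus y r s)))"
    by (simp only: ac_simps)
  then have "c * measure M (annulus y r s) \<le> C * 8 ^ d * (measure M (annulus y r (3 * s)) - measure M (annulus y r s))"
    using s by (simp only: mult_le_cancel_left_pos zero_less_power half_gt_zero)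
  then show ?thesis using c by (simp add: field_simps)
qed

text \<open>The parameter \<open>\<rho>\<close> stands for \<open>min r 1\<close>; any smaller value gives a weaker bound and is convenient when only
  a lower bound for \<open>r\<close> is known.\<close>

definition annulus_regular :: "'a::metric_space measure \<Rightarrow> bool" where
  "annulus_regular M \<longleftrightarrow> (\<exists>\<beta>>0. \<exists>C>0. \<forall>y r s \<rho>. 0 < s \<longrightarrow> 0 < \<rho> \<longrightarrow> \<rho> \<le> r \<longrightarrow> \<rho> \<le> 1 \<longrightarrow>
     measure M (annulus y r s) \<le> C * (s / \<rho>) powr \<beta>)"

text \<open>The previous lemma bounds the outer third of a layer by a fixed fraction \<open>\<theta>\<close> of the whole layer.
  Tripling the width \<open>j\<close> times gives \<open>\<theta> ^ j\<close> for widths of order \<open>\<rho> / 3 ^ j\<close>, that is, a power of \<open>s / \<rho>\<close>.\<close>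

lemma annulus_regular_of_ahlfors:
  fixes M :: "'a::metric_space measure"
  assumes comp: "compact (UNIV :: 'a set)" and M: "prob_space M" "sets M = sets borel"
    and between: "\<And>(u::'a) v a e. 0 \<le> a \<Longrightarrow> a \<le> dist u v \<Longrightarrow> 0 < e \<Longrightarrow> \<exists>z. dist u z = a \<and> dist z v < dist u v - a + e"
    and reg: "ahlfors_regular d M"
  shows "annulus_regular M"
proof -
  interpret prob_space M by fact
  obtain c C where c: "0 < c" "0 < C" and r: "\<And>x r. 0 < r \<Longrightarrow> r \<le> 1 \<Longrightarrow> c * r ^ d \<le> measure M (ball x r) \<and> measure M (ball x r) \<le> C * r ^ d"
    using reg unfolding ahlfors_regular_def by blast
  define K where "K = C * 8 ^ d / c"
  have K: "0 < K" using c by (simp add: K_def)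
  define \<theta> where "\<theta> = K / (1 + K)"
  have \<theta>: "0 < \<theta>" "\<theta> < 1" using K by (auto simp: \<theta>_def)
  have step: "measure M (annulus y r s) \<le> \<theta> * measure M (annulus y r (3 * s))"
    if "0 < s" "4 * s \<le> 1" "4 * s \<le> r" for y r s
  proof -
    have "measure M (annulus y r s) * (1 + K) \<le> K * measure M (annulus y r (3 * s))"
      using annulus_measure_step[OF comp M between r c that, of y] by (simp add: K_def[symmetric] algebra_simps)
    then show ?thesis using K by (simp add: \<theta>_def field_simps)
  qed
  have iter: "measure M (annulus y r s) \<le> \<theta> ^ j"
    if "0 < s" "4 * 3 ^ j * s \<le> 3 * \<rho>" "\<rho> \<le> r" "\<rho> \<le> 1" for y r s \<rho> j
    using that
  proof (induction j arbitrary: s)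
    case (Suc j)
    have "1 * s \<le> 3 ^ j * s" using Suc.prems(1) by (intro mult_right_mono) auto
    moreover have "4 * (3 ^ j * s) \<le> \<rho>" using Suc.prems(2) by (simp add: mult.commute)
    ultimately have 4: "4 * s \<le> \<rho>" by linarith
    have "measure M (annulus y r s) \<le> \<theta> * measure M (annulus y r (3 * s))"
      using 4 Suc.prems by (intro step) auto
    also have "\<dots> \<le> \<theta> * \<theta> ^ j" using Suc.prems \<theta> by (intro mult_left_mono Suc.IH) auto
    finally show ?case by simp
  qed simp
  define \<beta> where "\<beta> = - log 3 \<theta>"
  have \<beta>: "0 < \<beta>" using \<theta> by (simp add: \<beta>_def)
  show ?thesis
    unfolding annulus_regular_def
  proof (intro exI conjI allI impI)
    show "0 < \<beta>" "0 < (4 / 3) powr \<beta> / \<theta>" using \<beta> \<theta> by auto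
    fix y :: 'a and r s \<rho> :: real
    assume s: "0 < s" "0 < \<rho>" "\<rho> \<le> r" "\<rho> \<le> 1"
    \<comment> \<open>The width can be tripled about \<open>log 3 X\<close> times; the exponent \<open>\<beta>\<close> is chosen such that
      \<open>\<theta> powr log 3 X\<close> is \<open>X powr (- \<beta>)\<close>.\<close>
    define X where "X = 3 * \<rho> / (4 * s)"
    have X: "0 < X" using s by (simp add: X_def)
    have eq: "(4 / 3) powr \<beta> / \<theta> * (s / \<rho>) powr \<beta> = \<theta> powr (log 3 X - 1)"
    proof -
      have "\<theta> powr (log 3 X - 1) = X powr log 3 \<theta> / \<theta>"
      proof -
        have "\<theta> powr log 3 X = X powr log 3 \<theta>" using \<theta> X by (simp add: powr_def log_def)
        then show ?thesis using \<theta> by (simp add: powr_diff)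
      qed
      also have "X powr log 3 \<theta> = (1 / X) powr \<beta>"
        using X \<theta> by (simp add: \<beta>_def powr_minus_divide powr_divide)
      also have "1 / X = 4 / 3 * (s / \<rho>)" by (simp add: X_def)
      also have "\<dots> powr \<beta> = (4 / 3) powr \<beta> * (s / \<rho>) powr \<beta>" by (rule powr_mult)
      finally show ?thesis by (simp add: field_simps)
    qed
    show "measure M (annulus y r s) \<le> (4 / 3) powr \<beta> / \<theta> * (s / \<rho>) powr \<beta>"
    proof (cases "1 \<le> X")
      case True
      define j where "j = nat \<lfloor>log 3 X\<rfloor>"
      have l0: "0 \<le> log 3 X" using True by simp
      have jl: "real j \<le> log 3 X" "log 3 X - 1 \<le> real j"
        unfolding j_def using l0 by linarith+
      have "3 ^ j = (3::real) powr real j" by (simp add: powr_realpow)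
      also have "\<dots> \<le> 3 powr log 3 X" using jl by (intro powr_mono) auto
      also have "\<dots> = X" using X by simp
      finally have "4 * 3 ^ j * s \<le> 3 * \<rho>" using s by (simp add: X_def field_simps)
      then have "measure M (annulus y r s) \<le> \<theta> ^ j" using s by (intro iter) auto
      also have "\<dots> = \<theta> powr real j" using \<theta> by (simp add: powr_realpow)
      also have "\<dots> \<le> \<theta> powr (log 3 X - 1)" using jl \<theta> by (intro powr_mono') auto
      finally show ?thesis by (simp only: eq)
    next
      case False
      have "1 = \<theta> powr 0" using \<theta> by simp
      also have "\<dots> \<le> \<theta> powr (log 3 X - 1)"
      proof (rule powr_mono')
        show "log 3 X - 1 \<le> 0" using False X by simp
      qed (use \<theta> in auto)
      finally show ?thesis unfolding eq using prob_le_1 order_trans by blast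
    qed
  qed
qed

text \<open>This is the Hoelder inequality for \<open>h\<close> and an indicator, up to the constant. It follows by integrating
  \<open>h \<le> l + l powr (1 - q) * h powr q\<close> over \<open>E\<close>, with the threshold \<open>l\<close> chosen to balance the two terms.\<close>

lemma density_measure_le_powr:
  assumes m: "prob_space m" and h: "h \<in> borel_measurable m" "AE x in m. 0 \<le> h x"
    and q: "1 < q" and hq: "integrable m (\<lambda>x. \<bar>h x\<bar> powr q)" and fin: "prob_space (density m (\<lambda>x. ennreal (h x)))"
    and E: "E \<in> sets m"
  shows "measure (density m (\<lambda>x. ennreal (h x))) E \<le> (1 + (LINT x|m. \<bar>h x\<bar> powr q)) * measure m E powr (1 - 1 / q)"
proof -
  interpret prob_space m by fact
  interpret \<mu>: prob_space "density m (\<lambda>x. ennreal (h x))" by fact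
  define H where "H = (LINT x|m. \<bar>h x\<bar> powr q)"
  have H: "0 \<le> H" by (simp add: H_def)
  note [measurable] = h(1) E
  show ?thesis
  proof (cases "measure m E = 0")
    case True
    then have "E \<in> null_sets m" using E by (simp add: null_sets_def emeasure_eq_measure)
    then have "emeasure (density m (\<lambda>x. ennreal (h x))) E = 0"
      using h(1) absolutely_continuousI_density[of "\<lambda>x. ennreal (h x)" m] unfolding absolutely_continuous_def by auto
    then show ?thesis using True by (simp add: measure_def)
  next
    case False
    then have P: "0 < measure m E" using measure_nonneg[of m E] by linarith
    define l where "l = measure m E powr (- 1 / q)"
    have l: "0 < l" using P by (simp add: l_def)
    have pt: "a \<le> l + l powr (1 - q) * \<bar>a\<bar> powr q" for a
    proof (cases "a \<le> l")
      case True then show ?thesis by (simp add: add_increasing2)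
    next
      case False
      then have a: "l < a" "0 < a" using l by auto
      have "a = a powr (1 - q) * a powr q" using a by (simp add: powr_add[symmetric])
      also have "\<dots> \<le> l powr (1 - q) * a powr q" using a l q by (intro mult_right_mono powr_mono2') auto
      finally show ?thesis using a l by simp
    qed
    have "emeasure (density m (\<lambda>x. ennreal (h x))) E = (\<integral>\<^sup>+x. ennreal (h x) * indicator E x \<partial>m)"
      by (simp add: emeasure_density)
    also have "\<dots> \<le> (\<integral>\<^sup>+x. ennreal l * indicator E x + ennreal (l powr (1 - q)) * ennreal (\<bar>h x\<bar> powr q) \<partial>m)"
    proof (rule nn_integral_mono)
      fix x
      have "ennreal (h x) \<le> ennreal (l + l powr (1 - q) * \<bar>h x\<bar> powr q)" by (intro ennreal_leI pt)
      also have "\<dots> = ennreal l + ennreal (l powr (1 - q)) * ennreal (\<bar>h x\<bar> powr q)"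
        using l by (simp add: ennreal_mult)
      finally show "ennreal (h x) * indicator E x \<le> ennreal l * indicator E x + ennreal (l powr (1 - q)) * ennreal (\<bar>h x\<bar> powr q)"
        by (auto simp: indicator_def)
    qed
    also have "\<dots> = ennreal l * emeasure m E + ennreal (l powr (1 - q)) * (\<integral>\<^sup>+x. ennreal (\<bar>h x\<bar> powr q) \<partial>m)"
      by (simp add: nn_integral_add nn_integral_cmult nn_integral_cmult_indicator)
    also have "(\<integral>\<^sup>+x. ennreal (\<bar>h x\<bar> powr q) \<partial>m) = ennreal H"
      unfolding H_def by (intro nn_integral_eq_integral hq) simp
    also have "ennreal l * emeasure m E + ennreal (l powr (1 - q)) * ennreal H = ennreal (l * measure m E + l powr (1 - q) * H)"
      using l H by (simp add: emeasure_eq_measure ennreal_mult)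
    finally have "measure (density m (\<lambda>x. ennreal (h x))) E \<le> l * measure m E + l powr (1 - q) * H"
      using l H by (simp add: \<mu>.emeasure_eq_measure ennreal_plus[symmetric] del: ennreal_plus)
    also have "l * measure m E = measure m E powr (1 - 1 / q)"
      using P by (simp add: l_def powr_diff powr_minus divide_inverse)
    also have "l powr (1 - q) = measure m E powr (1 - 1 / q)"
    proof -
      have "- 1 / q * (1 - q) = 1 - 1 / q" using q by (simp add: field_simps)
      then show ?thesis by (simp only: l_def powr_powr)
    qed
    finally show ?thesis by (simp add: H_def algebra_simps)
  qed
qed

section \<open>Decoupling an orbit from its starting point\<close>

text \<open>In a maximal \<open>\<delta>\<close>-separated set the balls of radius \<open>\<delta> / 2\<close> are disjoint, and the lower bound for their
  measures limits their number.\<close>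

lemma separated_net:
  fixes M :: "'a::metric_space measure"
  assumes M: "prob_space M" "sets M = sets borel" and c: "0 < c"
    and low: "\<And>x r. 0 < r \<Longrightarrow> r \<le> 1 \<Longrightarrow> c * r ^ d \<le> measure M (ball x r)"
    and \<delta>: "0 < \<delta>" "\<delta> \<le> 1"
  obtains S :: "'a set" where "finite S" "real (card S) \<le> 2 ^ d / c * (1 / \<delta>) ^ d" "\<And>x. \<exists>s\<in>S. dist x s < \<delta>"
proof -
  interpret prob_space M by fact
  let ?P = "\<lambda>S::'a set. finite S \<and> pairwise (\<lambda>x y. \<delta> \<le> dist x y) S"
  have bound: "real (card S) \<le> 2 ^ d / c * (1 / \<delta>) ^ d" if S: "?P S" for S
  proof -
    have disj: "disjoint_family_on (\<lambda>s. ball s (\<delta> / 2)) S"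
      unfolding disjoint_family_on_def
    proof (intro ballI impI)
      fix s t assume st: "s \<in> S" "t \<in> S" "s \<noteq> t"
      then have d: "\<delta> \<le> dist s t" using S by (auto simp: pairwise_def)
      show "ball s (\<delta> / 2) \<inter> ball t (\<delta> / 2) = {}"
      proof (rule ccontr)
        assume "ball s (\<delta> / 2) \<inter> ball t (\<delta> / 2) \<noteq> {}"
        then obtain w where "dist s w < \<delta> / 2" "dist t w < \<delta> / 2" by auto
        then show False using d dist_triangle2[of s t w] by linarith
      qed
    qed
    have fin: "finite S" using S by blast
    have "(\<lambda>s. ball s (\<delta> / 2)) ` S \<subseteq> sets M" by (auto simp: M(2))
    from finite_measure_finite_Union[OF fin this disj]
    have "measure M (\<Union>s\<in>S. ball s (\<delta> / 2)) = (\<Sum>s\<in>S. measure M (ball s (\<delta> / 2)))" .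
    then have "(\<Sum>s\<in>S. measure M (ball s (\<delta> / 2))) \<le> 1" using prob_le_1[of "\<Union>s\<in>S. ball s (\<delta> / 2)"] by simp
    moreover have "(\<Sum>s\<in>S. c * (\<delta> / 2) ^ d) \<le> (\<Sum>s\<in>S. measure M (ball s (\<delta> / 2)))"
      using \<delta> by (intro sum_mono low) auto
    ultimately have "real (card S) * (c * (\<delta> / 2) ^ d) \<le> 1" by simp
    moreover have "0 < c * (\<delta> / 2) ^ d" using c \<delta> by simp
    ultimately have "real (card S) \<le> 1 / (c * (\<delta> / 2) ^ d)" by (simp add: field_simps)
    also have "\<dots> = 2 ^ d / c * (1 / \<delta>) ^ d" by (simp add: power_divide)
    finally show ?thesis .
  qed
  have "\<forall>S. ?P S \<longrightarrow> card S < Suc (nat \<lceil>2 ^ d / c * (1 / \<delta>) ^ d\<rceil>)"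
  proof (intro allI impI)
    fix S assume "?P S"
    from bound[OF this] show "card S < Suc (nat \<lceil>2 ^ d / c * (1 / \<delta>) ^ d\<rceil>)" by linarith
  qed
  moreover have "?P {}" by simp
  ultimately have "\<exists>S. ?P S \<and> (\<forall>S'. ?P S' \<longrightarrow> card S' \<le> card S)"
    by (rule ex_has_greatest_nat[rotated])
  then obtain S where S: "?P S" "\<And>S'. ?P S' \<Longrightarrow> card S' \<le> card S"
    by (elim exE conjE) (rule that, auto)
  show thesis
  proof (rule that[of S])
    show "finite S" "real (card S) \<le> 2 ^ d / c * (1 / \<delta>) ^ d" using S bound by auto
    fix x
    show "\<exists>s\<in>S. dist x s < \<delta>"
    proof (rule ccontr)
      assume "\<not> ?thesis"
      then have far: "\<And>s. s \<in> S \<Longrightarrow> \<delta> \<le> dist x s" by force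
      then have "x \<notin> S" using \<delta> by force
      moreover have "?P (insert x S)"
        using S(1) far by (auto simp: pairwise_insert dist_commute)
      ultimately show False using S(2)[of "insert x S"] S(1) by simp
    qed
  qed
qed

text \<open>Normalise the tents \<open>max 0 (2 * \<delta> - dist x s)\<close>; their sum is at least \<open>\<delta>\<close> because of the net.\<close>

lemma lipschitz_partition_of_unity:
  fixes S :: "'a::metric_space set"
  assumes S: "finite S" and net: "\<And>x. \<exists>s\<in>S. dist x s < \<delta>" and \<delta>: "0 < \<delta>"
  obtains \<rho> :: "'a \<Rightarrow> 'a \<Rightarrow> real" where "\<And>x. (\<Sum>s\<in>S. \<rho> s x) = 1" "\<And>s x. 0 \<le> \<rho> s x" "\<And>s x. s \<in> S \<Longrightarrow> \<rho> s x \<le> 1"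
    "\<And>s x. \<rho> s x \<noteq> 0 \<Longrightarrow> dist x s < 2 * \<delta>"
    "\<And>s x y. s \<in> S \<Longrightarrow> \<bar>\<rho> s x - \<rho> s y\<bar> \<le> (1 + real (card S)) / \<delta> * dist x y"
proof -
  define \<psi> where "\<psi> s x = max 0 (2 * \<delta> - dist x s)" for s x :: 'a
  define Z where "Z x = (\<Sum>s\<in>S. \<psi> s x)" for x
  have \<psi>0: "0 \<le> \<psi> s x" for s x by (simp add: \<psi>_def)
  have \<psi>Z: "\<psi> s x \<le> Z x" if "s \<in> S" for s x
    unfolding Z_def using S that \<psi>0 by (intro member_le_sum) auto
  have Z: "\<delta> \<le> Z x" for x
  proof -
    obtain s where s: "s \<in> S" "dist x s < \<delta>" using net by blast
    then have "\<delta> \<le> \<psi> s x" by (simp add: \<psi>_def)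
    with \<psi>Z[OF s(1), of x] show ?thesis by linarith
  qed
  then have Zpos: "0 < Z x" for x using \<delta> by (metis order.strict_trans2)
  have \<psi>L: "\<bar>\<psi> s x - \<psi> s y\<bar> \<le> dist x y" for s x y
    using dist_triangle[of x s y] dist_triangle[of y s x] by (auto simp: \<psi>_def dist_commute)
  have ZL: "\<bar>Z x - Z y\<bar> \<le> real (card S) * dist x y" for x y
  proof -
    have "\<bar>Z x - Z y\<bar> \<le> (\<Sum>s\<in>S. \<bar>\<psi> s x - \<psi> s y\<bar>)" unfolding Z_def sum_subtractf[symmetric] by (rule sum_abs)
    also have "\<dots> \<le> (\<Sum>s\<in>S. dist x y)" by (intro sum_mono \<psi>L)
    finally show ?thesis by simp
  qed
  show thesis
  proof (rule that[of "\<lambda>s x. \<psi> s x / Z x"])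
    show "(\<Sum>s\<in>S. \<psi> s x / Z x) = 1" for x
      using Zpos[of x] by (simp add: sum_divide_distrib[symmetric] Z_def[symmetric])
    show "0 \<le> \<psi> s x / Z x" for s x using \<psi>0 Zpos[of x] by simp
    show "\<psi> s x / Z x \<le> 1" if "s \<in> S" for s x using \<psi>Z[OF that, of x] Zpos[of x] by simp
    show "dist x s < 2 * \<delta>" if "\<psi> s x / Z x \<noteq> 0" for s x using that by (auto simp: \<psi>_def max_def split: if_splits)
    fix s x y assume s: "s \<in> S"
    have "\<psi> s x / Z x - \<psi> s y / Z y = (\<psi> s x - \<psi> s y) / Z x + \<psi> s y / Z y * ((Z y - Z x) / Z x)"
      using Zpos[of x] Zpos[of y] by (simp add: field_simps)
    then have "\<bar>\<psi> s x / Z x - \<psi> s y / Z y\<bar> \<le> \<bar>\<psi> s x - \<psi> s y\<bar> / Z x + \<psi> s y / Z y * (\<bar>Z y - Z x\<bar> / Z x)"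
      using abs_triangle_ineq[of "(\<psi> s x - \<psi> s y) / Z x" "\<psi> s y / Z y * ((Z y - Z x) / Z x)"] Zpos[of x] Zpos[of y] \<psi>0[of s y]
      by (simp add: abs_mult)
    also have "\<dots> \<le> dist x y / \<delta> + 1 * (real (card S) * dist x y / \<delta>)"
    proof (intro add_mono mult_mono frac_le)
      show "\<psi> s y / Z y \<le> 1" using \<psi>Z[OF s, of y] Zpos[of y] by simp
      show "\<bar>Z y - Z x\<bar> \<le> real (card S) * dist x y" using ZL[of x y] by (simp add: abs_minus_commute)
    qed (use \<psi>L \<delta> Z Zpos[of x] in auto)
    also have "\<dots> = (1 + real (card S)) / \<delta> * dist x y" by (simp add: distrib_right add_divide_distrib)
    finally show "\<bar>\<psi> s x / Z x - \<psi> s y / Z y\<bar> \<le> (1 + real (card S)) / \<delta> * dist x y" .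
  qed
qed

lemma poly_le_power:
  fixes P :: "real poly"
  assumes "\<And>i. 0 \<le> coeff P i" "0 \<le> x" "x \<le> y" "1 \<le> y"
  shows "poly P x \<le> (\<Sum>i\<le>degree P. coeff P i) * y ^ degree P"
proof -
  have "poly P x = (\<Sum>i\<le>degree P. coeff P i * x ^ i)" by (rule poly_altdef)
  also have "\<dots> \<le> (\<Sum>i\<le>degree P. coeff P i * y ^ degree P)"
  proof (intro sum_mono mult_left_mono assms)
    fix i assume "i \<in> {..degree P}"
    then have "x ^ i \<le> y ^ i" "y ^ i \<le> y ^ degree P"
      using assms by (auto intro: power_mono power_increasing)
    then show "x ^ i \<le> y ^ degree P" by linarith
  qed
  finally show ?thesis by (simp add: sum_distrib_right)
qed

text \<open>What the dynamical argument needs: besides mixing, a lower bound for the measures of balls, which limits the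
  size of nets, and the smallness of thin annuli, which allows one to smooth indicators. If the space were a
  single point, the supremum defining the Hoelder seminorm would range over the empty set.\<close>

locale mixing_system = prob_space M for M :: "'a::metric_space measure" +
  fixes T :: "'a \<Rightarrow> 'a" and d :: nat
  assumes compact_space: "compact (UNIV :: 'a set)"
    and sets_M: "sets M = sets borel"
    and measurable_T: "T \<in> measurable M M" and invariant: "distr M M T = M"
    and nontrivial: "\<exists>x y :: 'a. x \<noteq> y"
    and mixing: "multiple_decorrelation M T"
    and ball_lower: "\<exists>c>0. \<forall>x r. 0 < r \<longrightarrow> r \<le> 1 \<longrightarrow> c * r ^ d \<le> measure M (ball x r)"
    and annuli: "annulus_regular M"
begin

lemma space_M: "space M = UNIV" using sets_M by (metis sets_eq_imp_space_eq space_borel)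

lemma measurable_iter: "T ^^ k \<in> measurable M M"
  by (induction k) (auto intro: measurable_compose[OF _ measurable_T] simp: id_def)

lemma invariant_iter: "distr M M (T ^^ k) = M"
proof (induction k)
  case (Suc k)
  have "distr M M (T ^^ Suc k) = distr (distr M M (T ^^ k)) M T"
    by (simp add: distr_distr measurable_T measurable_iter o_def)
  then show ?case by (simp only: Suc invariant)
qed (simp add: id_def distr_id)

lemma integral_iter:
  fixes f :: "'a \<Rightarrow> 'b::{banach, second_countable_topology}"
  assumes "f \<in> borel_measurable M"
  shows "(LINT x|M. f ((T ^^ k) x)) = (LINT x|M. f x)"
  using integral_distr[OF measurable_iter assms, of k] by (simp add: invariant_iter)

lemma borel_measurable_lipschitz:
  fixes f :: "'a \<Rightarrow> 'b::real_normed_vector"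
  assumes "\<And>x y. norm (f x - f y) \<le> L * dist x y"
  shows "f \<in> borel_measurable M"
proof -
  have "continuous_on UNIV f"
  proof (rule continuous_onI)
    fix x :: 'a and e :: real assume e: "0 < e"
    show "\<exists>\<delta>>0. \<forall>x'\<in>UNIV. dist x' x < \<delta> \<longrightarrow> dist (f x') (f x) \<le> e"
    proof (intro exI conjI ballI impI)
      show "0 < e / (\<bar>L\<bar> + 1)" using e by simp
      fix x' assume "dist x' x < e / (\<bar>L\<bar> + 1)"
      then have "(\<bar>L\<bar> + 1) * dist x' x \<le> e" by (simp add: field_simps)
      moreover have "L * dist x' x \<le> (\<bar>L\<bar> + 1) * dist x' x" by (intro mult_right_mono) auto
      ultimately show "dist (f x') (f x) \<le> e" using assms[of x' x] by (simp add: dist_norm)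
    qed
  qed
  then have "f \<in> borel_measurable borel" by (rule borel_measurable_continuous_onI)
  then show ?thesis by (simp add: measurable_def sets_M space_M space_borel)
qed

lemma holder_lipschitz:
  fixes f :: "'a \<Rightarrow> complex"
  assumes "\<And>x y. norm (f x - f y) \<le> L * dist x y"
  shows "holder 1 f" "0 \<le> holder_seminorm 1 f" "holder_seminorm 1 f \<le> L"
proof -
  show "holder 1 f" unfolding holder_def using assms by (intro exI[of _ L]) simp
  let ?A = "{norm (f x - f y) / dist x y powr 1 |x y. x \<noteq> y}"
  have le: "a \<le> L" if "a \<in> ?A" for a using that assms by (auto simp: pos_divide_le_eq)
  obtain x y :: 'a where xy: "x \<noteq> y" using nontrivial by blast
  then have mem: "norm (f x - f y) / dist x y powr 1 \<in> ?A" by blast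
  have "0 \<le> norm (f x - f y) / dist x y powr 1" by simp
  also have "\<dots> \<le> Sup ?A" using mem le by (intro cSup_upper bdd_aboveI) auto
  finally show "0 \<le> holder_seminorm 1 f" by (simp add: holder_seminorm_def)
  show "holder_seminorm 1 f \<le> L" unfolding holder_seminorm_def using mem le by (intro cSup_least) auto
qed

lemma sup_norm_bounds:
  fixes f :: "'a \<Rightarrow> complex"
  assumes "\<And>x. norm (f x) \<le> 1"
  shows "0 \<le> sup_norm f" "sup_norm f \<le> 1"
proof -
  show "sup_norm f \<le> 1" unfolding sup_norm_def using assms by (intro cSUP_least) auto
  have "0 \<le> norm (f undefined)" by simp
  also have "\<dots> \<le> sup_norm f" unfolding sup_norm_def using assms by (intro cSUP_upper bdd_aboveI) auto
  finally show "0 \<le> sup_norm f" .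
qed

definition lipschitz_test :: "real \<Rightarrow> ('a \<Rightarrow> complex) \<Rightarrow> bool" where
  "lipschitz_test L f \<longleftrightarrow> (\<forall>x. norm (f x) \<le> 1) \<and> (\<forall>x y. norm (f x - f y) \<le> L * dist x y)"

text \<open>Kernels \<open>G y z\<close> couple the target \<open>y\<close> with the orbit point \<open>z = (T ^^ k) x\<close>. On the diagonal \<open>y = x\<close> they
  describe recurrence, for fixed \<open>y\<close> they describe hits of a target.\<close>

definition lipschitz_kernel :: "real \<Rightarrow> ('a \<Rightarrow> 'a \<Rightarrow> complex) \<Rightarrow> bool" where
  "lipschitz_kernel L G \<longleftrightarrow> (\<forall>y z. norm (G y z) \<le> 1) \<and>
     (\<forall>y y' z z'. norm (G y z - G y' z') \<le> L * (dist y y' + dist z z')) \<and>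
     (\<lambda>(y, z). G y z) \<in> borel_measurable (M \<Otimes>\<^sub>M M)"

definition decoupling_error :: "nat \<Rightarrow> nat \<Rightarrow> (nat \<Rightarrow> 'a \<Rightarrow> 'a \<Rightarrow> complex) \<Rightarrow> real" where
  "decoupling_error N n G = norm ((LINT x|M. (\<Prod>k=N..n. G k x ((T ^^ k) x))) -
     (LINT y|M. LINT x|M. (\<Prod>k=N..n. G k y ((T ^^ k) x))))"

text \<open>The case of multiple decorrelation with a single past factor at time \<open>0\<close> and exponent \<open>1\<close>. As the past ends
  at time \<open>0\<close>, the gap is \<open>N\<close> itself.\<close>

lemma lipschitz_decorrelation:
  obtains B \<tau> :: real and e :: nat where "0 < B" "0 < \<tau>"
    "\<And>N n' n L \<phi> G. N \<le> n' \<Longrightarrow> n' \<le> n \<Longrightarrow> 1 \<le> n \<Longrightarrow> 0 \<le> L \<Longrightarrow>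
      lipschitz_test L \<phi> \<Longrightarrow> (\<And>k. lipschitz_test L (G k)) \<Longrightarrow>
      norm (Cov M \<phi> (\<lambda>x. \<Prod>k=N..n'. G k ((T ^^ k) x))) \<le> B * (1 + L) * real n ^ e * exp (- \<tau> * real N)"
proof -
  have "0 < (1::real) \<and> (1::real) \<le> 1" by simp
  from mixing[unfolded multiple_decorrelation_def, rule_format, OF this] obtain r \<tau> :: real and P :: "real poly"
    where r: "1 \<le> r" and \<tau>: "0 < \<tau>" and P: "\<forall>i. 0 \<le> coeff P i"
    and all: "\<forall>(m1::nat) (m2::nat) (N::nat) (k::nat \<Rightarrow> nat) (l::nat \<Rightarrow> nat) (\<phi>::nat \<Rightarrow> 'a \<Rightarrow> complex). mono_on {1..m1} k \<and> mono_on {1..m2} l \<and> (\<forall>i\<in>{1..m1 + m2}. holder 1 (\<phi> i)) \<longrightarrow>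
            norm (Cov M (\<lambda>x. \<Prod>i=1..m1. \<phi> i ((T ^^ k i) x))
                        (\<lambda>x. \<Prod>j=1..m2. \<phi> (m1 + j) ((T ^^ (N + l j)) x)))
            \<le> ((\<Prod>i=1..m1 + m2. sup_norm (\<phi> i)) +
                (\<Sum>i=1..m1 + m2. holder_seminorm 1 (\<phi> i) *
                   (\<Prod>j\<in>{1..m1 + m2} - {i}. sup_norm (\<phi> j)))) *
              poly P (real (l m2)) * exp (- \<tau> * (real N - r * real (k m1)))"
    by (elim exE conjE) (rule that)
  have P: "\<And>i. 0 \<le> coeff P i" using P by blast
  define Q where "Q = (\<Sum>i\<le>degree P. coeff P i)"
  have Q: "0 \<le> Q" unfolding Q_def by (intro sum_nonneg P)
  show thesis
  proof (rule that[of "3 * (Q + 1)" \<tau> "Suc (degree P)"])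
    show "0 < 3 * (Q + 1)" using Q by simp
    show "0 < \<tau>" by fact
    fix N n' n :: nat and L :: real and \<phi> :: "'a \<Rightarrow> complex" and G :: "nat \<Rightarrow> 'a \<Rightarrow> complex"
    assume n: "N \<le> n'" "n' \<le> n" "1 \<le> n" and L: "0 \<le> L"
      and \<phi>: "lipschitz_test L \<phi>" and G: "\<And>k. lipschitz_test L (G k)"
    define F where "F i = (if i = 1 then \<phi> else G (N + i - 2))" for i :: nat
    define m2 where "m2 = Suc n' - N"
    have F: "\<And>x. norm (F i x) \<le> 1" "\<And>x y. norm (F i x - F i y) \<le> L * dist x y" for i
      using \<phi> G by (auto simp: F_def lipschitz_test_def)
    note hol = holder_lipschitz[OF F(2)] and sup = sup_norm_bounds[OF F(1)]
    have 1: "(\<lambda>x. \<Prod>i=1..1. F i ((T ^^ 0) x)) = \<phi>" by (simp add: F_def)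
    have 2: "(\<Prod>j=1..m2. F (1 + j) ((T ^^ (N + (j - 1))) x)) = (\<Prod>k=N..n'. G k ((T ^^ k) x))" for x
      by (rule prod.reindex_bij_witness[of _ "\<lambda>k. k - N + 1" "\<lambda>j. N + (j - 1)"])
        (use n in \<open>auto simp: m2_def F_def\<close>)
    have "norm (Cov M (\<lambda>x. \<Prod>i=1..1. F i ((T ^^ 0) x)) (\<lambda>x. \<Prod>j=1..m2. F (1 + j) ((T ^^ (N + (j - 1))) x)))
        \<le> ((\<Prod>i=1..1 + m2. sup_norm (F i)) + (\<Sum>i=1..1 + m2. holder_seminorm 1 (F i) * (\<Prod>j\<in>{1..1 + m2} - {i}. sup_norm (F j)))) *
              poly P (real (m2 - 1)) * exp (- \<tau> * (real N - r * real 0))"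
      by (rule all[THEN spec, THEN spec, THEN spec, of 1 m2 N, THEN spec, of "\<lambda>_. 0", THEN spec, of "\<lambda>j. j - 1", THEN spec, of F, THEN mp])
        (auto simp: mono_on_def hol)
    then have "norm (Cov M \<phi> (\<lambda>x. \<Prod>k=N..n'. G k ((T ^^ k) x)))
        \<le> ((\<Prod>i=1..1 + m2. sup_norm (F i)) + (\<Sum>i=1..1 + m2. holder_seminorm 1 (F i) * (\<Prod>j\<in>{1..1 + m2} - {i}. sup_norm (F j)))) *
              poly P (real (m2 - 1)) * exp (- \<tau> * (real N - r * real 0))"
      unfolding 1 2 .
    also have "\<dots> \<le> (3 * real n * (1 + L)) * (Q * real n ^ degree P) * exp (- \<tau> * real N)"
    proof (intro mult_mono)
      have "(\<Prod>i=1..1 + m2. sup_norm (F i)) \<le> 1" by (intro prod_le_1) (use sup in auto)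
      moreover have "(\<Sum>i=1..1 + m2. holder_seminorm 1 (F i) * (\<Prod>j\<in>{1..1 + m2} - {i}. sup_norm (F j))) \<le> (\<Sum>i=1..1 + m2. L * 1)"
        using L by (intro sum_mono mult_mono prod_le_1 prod_nonneg) (use sup hol in auto)
      moreover have "(\<Sum>i=1..1 + m2. L * 1) \<le> 3 * real n * L"
        using n L by (auto simp: m2_def intro!: mult_right_mono)
      moreover have "1 \<le> 3 * real n" using n by simp
      ultimately show "(\<Prod>i=1..1 + m2. sup_norm (F i)) + (\<Sum>i=1..1 + m2. holder_seminorm 1 (F i) * (\<Prod>j\<in>{1..1 + m2} - {i}. sup_norm (F j)))
          \<le> 3 * real n * (1 + L)" by (simp add: distrib_left)
      show "poly P (real (m2 - 1)) \<le> Q * real n ^ degree P"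
        unfolding Q_def using n by (intro poly_le_power P) (auto simp: m2_def)
      show "0 \<le> poly P (real (m2 - 1))" unfolding poly_altdef by (intro sum_nonneg mult_nonneg_nonneg P) auto
    qed (use L Q in auto)
    also have "\<dots> = 3 * Q * (1 + L) * real n ^ Suc (degree P) * exp (- \<tau> * real N)" by simp
    also have "\<dots> \<le> 3 * (Q + 1) * (1 + L) * real n ^ Suc (degree P) * exp (- \<tau> * real N)"
      using L by (intro mult_right_mono) auto
    finally show "norm (Cov M \<phi> (\<lambda>x. \<Prod>k=N..n'. G k ((T ^^ k) x))) \<le> 3 * (Q + 1) * (1 + L) * real n ^ Suc (degree P) * exp (- \<tau> * real N)" .
  qed
qed

end

lemma norm_prod_le_one:
  fixes f :: "'i \<Rightarrow> 'b::{real_normed_field}"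
  assumes "\<And>i. i \<in> I \<Longrightarrow> norm (f i) \<le> 1"
  shows "norm (\<Prod>i\<in>I. f i) \<le> 1"
  unfolding prod_norm[symmetric] by (intro prod_le_1) (use assms in auto)

context mixing_system
begin

lemma integrable_bounded:
  fixes f :: "'a \<Rightarrow> 'b::{banach, second_countable_topology}"
  assumes "f \<in> borel_measurable M" "\<And>x. norm (f x) \<le> b"
  shows "integrable M f"
  by (rule integrable_const_bound[of _ b]) (use assms in auto)

lemma norm_integral_le:
  fixes f :: "'a \<Rightarrow> 'b::{banach, second_countable_topology}"
  assumes "f \<in> borel_measurable M" "\<And>x. norm (f x) \<le> b"
  shows "norm (LINT x|M. f x) \<le> b"
proof -
  have "norm (LINT x|M. f x) \<le> (LINT x|M. norm (f x))" by (rule integral_norm_bound)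
  also have "\<dots> \<le> (LINT x|M. b)"
    using integrable_bounded[OF assms] assms(2) by (intro integral_mono) auto
  also have "\<dots> = b" by (simp add: prob_space)
  finally show ?thesis .
qed

text \<open>At times after \<open>N\<close> the orbit has forgotten its starting point: in a product of kernels, the starting
  point in the first argument may be replaced by an independent one. To apply decorrelation, the first argument
  is discretised by a partition of unity subordinate to a net of mesh \<open>\<delta>\<close>: near the net point \<open>s\<close> the product
  is \<open>\<rho> s x * (\<Prod>k. G k s ((T ^^ k) x))\<close> up to the Lipschitz error, and here the two factors decorrelate. The
  number of net points and the Lipschitz constants of the \<open>\<rho> s\<close> cost a power of \<open>1 / \<delta>\<close>.\<close>

lemma decoupling:
  obtains B \<tau> :: real and e u :: nat where "0 < B" "0 < \<tau>"
    "\<And>N n' n L \<delta> (G :: nat \<Rightarrow> 'a \<Rightarrow> 'a \<Rightarrow> complex). N \<le> n' \<Longrightarrow> n' \<le> n \<Longrightarrow> 1 \<le> n \<Longrightarrow> 0 \<le> L \<Longrightarrow> 0 < \<delta> \<Longrightarrow> \<delta> \<le> 1 \<Longrightarrow>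
      (\<And>k. lipschitz_kernel L (G k)) \<Longrightarrow>
      decoupling_error N n' G \<le> 8 * real n * L * \<delta> + B * (1 + L) * real n ^ e * exp (- \<tau> * real N) / \<delta> ^ u"
proof -
  obtain B \<tau> e where B: "0 < B" "0 < \<tau>" and dec:
    "\<And>N n' n L \<phi> G. N \<le> n' \<Longrightarrow> n' \<le> n \<Longrightarrow> 1 \<le> n \<Longrightarrow> 0 \<le> L \<Longrightarrow>
      lipschitz_test L \<phi> \<Longrightarrow> (\<And>k. lipschitz_test L (G k)) \<Longrightarrow>
      norm (Cov M \<phi> (\<lambda>x. \<Prod>k=N..n'. G k ((T ^^ k) x))) \<le> B * (1 + L) * real n ^ e * exp (- \<tau> * real N)"
    using lipschitz_decorrelation by blast
  obtain c where c: "0 < c" and low: "\<And>x r. 0 < r \<Longrightarrow> r \<le> 1 \<Longrightarrow> c * r ^ d \<le> measure M (ball x r)"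
    using ball_lower by blast
  define Q where "Q = 1 + 2 ^ d / c"
  have Q: "1 \<le> Q" using c by (simp add: Q_def)
  show thesis
  proof (rule that[of "B * Q * (1 + Q)" \<tau> e "2 * d + 1"])
    show "0 < B * Q * (1 + Q)" "0 < \<tau>" using B Q by auto
    fix N n' n :: nat and L \<delta> :: real and G :: "nat \<Rightarrow> 'a \<Rightarrow> 'a \<Rightarrow> complex"
    assume n: "N \<le> n'" "n' \<le> n" "1 \<le> n" and L: "0 \<le> L" and \<delta>: "0 < \<delta>" "\<delta> \<le> 1"
      and G: "\<And>k. lipschitz_kernel L (G k)"
    from G have G1: "\<And>k y z. norm (G k y z) \<le> 1"
      and GL: "\<And>k y y' z z'. norm (G k y z - G k y' z') \<le> L * (dist y y' + dist z z')"
      and Gm: "\<And>k. (\<lambda>(y, z). G k y z) \<in> borel_measurable (M \<Otimes>\<^sub>M M)"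
      unfolding lipschitz_kernel_def by blast+
    define F where "F y x = (\<Prod>k=N..n'. G k y ((T ^^ k) x))" for y x
    define f where "f y = (LINT x|M. F y x)" for y
    have F1: "norm (F y x) \<le> 1" for y x unfolding F_def by (intro norm_prod_le_one G1)
    have Gm': "(\<lambda>x. G k (a x) (b x)) \<in> borel_measurable K" if "a \<in> measurable K M" "b \<in> measurable K M" for k a b and K :: "'k measure"
      using measurable_compose[OF measurable_Pair[OF that] Gm[of k]] by simp
    note [measurable] = measurable_iter
    have Fd: "(\<lambda>x. F x x) \<in> borel_measurable M" unfolding F_def
      by (intro borel_measurable_prod Gm') auto
    have Fs: "(\<lambda>x. F y x) \<in> borel_measurable M" for y unfolding F_def
      by (intro borel_measurable_prod Gm') (auto simp: space_M)
    have Fm: "(\<lambda>(y, x). F y x) \<in> borel_measurable (M \<Otimes>\<^sub>M M)" unfolding F_def case_prod_beta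
      by (intro borel_measurable_prod Gm') auto
    have fm: "f \<in> borel_measurable M" unfolding f_def
      by (rule borel_measurable_lebesgue_integral) (rule Fm)
    have f1: "norm (f y) \<le> 1" for y unfolding f_def by (intro norm_integral_le Fs F1)
    have FL: "norm (F y x - F y' x) \<le> 2 * real n * L * dist y y'" for y y' x
    proof -
      have "norm (F y x - F y' x) \<le> (\<Sum>k=N..n'. norm (G k y ((T ^^ k) x) - G k y' ((T ^^ k) x)))"
        unfolding F_def by (intro norm_prod_diff G1)
      also have "\<dots> \<le> (\<Sum>k=N..n'. L * (dist y y' + dist ((T ^^ k) x) ((T ^^ k) x)))" by (intro sum_mono GL)
      also have "\<dots> = real (Suc n' - N) * (L * dist y y')" by simp
      also have "\<dots> \<le> (2 * real n) * (L * dist y y')" using n L by (intro mult_right_mono) auto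
      finally show ?thesis by (simp add: mult.assoc)
    qed
    have fL: "norm (f y - f y') \<le> 2 * real n * L * dist y y'" for y y'
    proof -
      have "f y - f y' = (LINT x|M. F y x - F y' x)"
        unfolding f_def using Fs F1 by (intro Bochner_Integration.integral_diff[symmetric] integrable_bounded) auto
      also have "norm \<dots> \<le> 2 * real n * L * dist y y'" by (intro norm_integral_le FL borel_measurable_diff Fs)
      finally show ?thesis .
    qed
    obtain S where S: "finite S" "real (card S) \<le> 2 ^ d / c * (1 / \<delta>) ^ d" "\<And>x::'a. \<exists>s\<in>S. dist x s < \<delta>"
      using separated_net[OF prob_space_axioms sets_M c low \<delta>] by blast
    obtain \<rho> where \<rho>: "\<And>x. (\<Sum>s\<in>S. \<rho> s x) = 1" "\<And>s x. 0 \<le> \<rho> s x" "\<And>s x. s \<in> S \<Longrightarrow> \<rho> s x \<le> 1"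
      "\<And>s x. \<rho> s x \<noteq> 0 \<Longrightarrow> dist x s < 2 * \<delta>"
      "\<And>s x y. s \<in> S \<Longrightarrow> \<bar>\<rho> s x - \<rho> s y\<bar> \<le> (1 + real (card S)) / \<delta> * dist x y"
      using lipschitz_partition_of_unity[OF S(1,3) \<delta>(1)] by blast
    have \<rho>m: "(\<lambda>x. complex_of_real (\<rho> s x)) \<in> borel_measurable M" if "s \<in> S" for s
      by (rule borel_measurable_lipschitz[where L="(1 + real (card S)) / \<delta>"]) (use \<rho>(5)[OF that] in \<open>simp add: norm_of_real of_real_diff[symmetric] del: of_real_diff\<close>)
    have approx: "norm ((LINT x|M. H x x) - (\<Sum>s\<in>S. LINT x|M. of_real (\<rho> s x) * H s x)) \<le> 4 * real n * L * \<delta>"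
      if Hd: "(\<lambda>x. H x x) \<in> borel_measurable M" and Hs: "\<And>s. (\<lambda>x. H s x) \<in> borel_measurable M"
        and H1: "\<And>y x. norm (H y x :: complex) \<le> 1" and HL: "\<And>y y' x. norm (H y x - H y' x) \<le> 2 * real n * L * dist y y'" for H :: "'a \<Rightarrow> 'a \<Rightarrow> complex"
    proof -
      have int: "integrable M (\<lambda>x. of_real (\<rho> s x) * H s x)" if "s \<in> S" for s
      proof (rule integrable_bounded)
        show "(\<lambda>x. of_real (\<rho> s x) * H s x) \<in> borel_measurable M" using \<rho>m[OF that] Hs by measurable
        show "norm (of_real (\<rho> s x) * H s x) \<le> 1" for x
          using \<rho>(2)[of s x] \<rho>(3)[OF that, of x] H1[of s x] by (simp add: norm_mult mult_le_one)
      qed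
      have "(LINT x|M. H x x) - (\<Sum>s\<in>S. LINT x|M. of_real (\<rho> s x) * H s x)
         = (LINT x|M. H x x - (\<Sum>s\<in>S. of_real (\<rho> s x) * H s x))"
        using int integrable_bounded[OF Hd H1] S(1) by simp
      also have "norm \<dots> \<le> 4 * real n * L * \<delta>"
      proof (rule norm_integral_le)
        show "(\<lambda>x. H x x - (\<Sum>s\<in>S. of_real (\<rho> s x) * H s x)) \<in> borel_measurable M"
          using int Hd by (intro borel_measurable_diff borel_measurable_sum) auto
        fix x
        have "H x x = (\<Sum>s\<in>S. of_real (\<rho> s x) * H x x)"
          using \<rho>(1)[of x] by (simp add: sum_distrib_right[symmetric] of_real_sum[symmetric] del: of_real_sum)
        then have "H x x - (\<Sum>s\<in>S. of_real (\<rho> s x) * H s x) = (\<Sum>s\<in>S. of_real (\<rho> s x) * (H x x - H s x))"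
          by (simp add: sum_subtractf right_diff_distrib)
        also have "norm \<dots> \<le> (\<Sum>s\<in>S. \<rho> s x * (4 * real n * L * \<delta>))"
        proof (rule sum_norm_le)
          fix s assume "s \<in> S"
          show "norm (of_real (\<rho> s x) * (H x x - H s x)) \<le> \<rho> s x * (4 * real n * L * \<delta>)"
          proof (cases "\<rho> s x = 0")
            case False
            have "norm (H x x - H s x) \<le> 2 * real n * L * dist x s" by (rule HL)
            also have "\<dots> \<le> 2 * real n * L * (2 * \<delta>)" using \<rho>(4)[OF False] L by (intro mult_left_mono) auto
            finally show ?thesis using \<rho>(2)[of s x] by (simp add: norm_mult mult_left_mono)
          qed simp
        qed
        also have "\<dots> = 4 * real n * L * \<delta>" using \<rho>(1)[of x] by (simp add: sum_distrib_right[symmetric])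
        finally show "norm (H x x - (\<Sum>s\<in>S. of_real (\<rho> s x) * H s x)) \<le> 4 * real n * L * \<delta>" .
      qed
      finally show ?thesis .
    qed
    let ?L = "L + (1 + real (card S)) / \<delta>"
    have cov: "norm (Cov M (\<lambda>x. of_real (\<rho> s x)) (F s)) \<le> B * (1 + ?L) * real n ^ e * exp (- \<tau> * real N)" if s: "s \<in> S" for s
      unfolding F_def
    proof (rule dec[OF n])
      have pos: "0 \<le> (1 + real (card S)) / \<delta>" using \<delta> by simp
      show "0 \<le> ?L" using L pos by linarith
      show "lipschitz_test ?L (\<lambda>x. complex_of_real (\<rho> s x))"
        unfolding lipschitz_test_def
      proof (intro conjI allI)
        show "norm (complex_of_real (\<rho> s x)) \<le> 1" for x using \<rho>(2,3)[of s x] s by simp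
        show "norm (complex_of_real (\<rho> s x) - complex_of_real (\<rho> s y)) \<le> ?L * dist x y" for x y
        proof -
          have "norm (complex_of_real (\<rho> s x) - complex_of_real (\<rho> s y)) = \<bar>\<rho> s x - \<rho> s y\<bar>"
            by (simp add: norm_of_real of_real_diff[symmetric] del: of_real_diff)
          also have "\<dots> \<le> (1 + real (card S)) / \<delta> * dist x y" by (rule \<rho>(5)[OF s])
          also have "\<dots> \<le> ?L * dist x y" using L by (intro mult_right_mono) auto
          finally show ?thesis .
        qed
      qed
      show "lipschitz_test ?L (G k s)" for k
        unfolding lipschitz_test_def
      proof (intro conjI allI)
        show "norm (G k s x) \<le> 1" for x by (rule G1)
        show "norm (G k s x - G k s y) \<le> ?L * dist x y" for x y
        proof -
          have "norm (G k s x - G k s y) \<le> L * dist x y" using GL[of k s x s y] by simp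
          also have "\<dots> \<le> ?L * dist x y" using pos by (intro mult_right_mono) auto
          finally show ?thesis .
        qed
      qed
    qed
    \<comment> \<open>The chain of approximations: discretise the diagonal integral, decorrelate at each net point, and undo the
      discretisation in the averaged integrand.\<close>
    have a1: "norm ((LINT x|M. F x x) - (\<Sum>s\<in>S. LINT x|M. of_real (\<rho> s x) * F s x)) \<le> 4 * real n * L * \<delta>"
      by (rule approx[OF Fd Fs F1 FL])
    have a2: "norm ((LINT y|M. f y) - (\<Sum>s\<in>S. LINT x|M. of_real (\<rho> s x) * f s)) \<le> 4 * real n * L * \<delta>"
      by (rule approx[of "\<lambda>y x. f y"]) (use fm f1 fL in auto)
    have a3: "norm ((\<Sum>s\<in>S. LINT x|M. of_real (\<rho> s x) * F s x) - (\<Sum>s\<in>S. LINT x|M. of_real (\<rho> s x) * f s))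
        \<le> real (card S) * (B * (1 + ?L) * real n ^ e * exp (- \<tau> * real N))"
    proof -
      have "(\<Sum>s\<in>S. LINT x|M. of_real (\<rho> s x) * F s x) - (\<Sum>s\<in>S. LINT x|M. of_real (\<rho> s x) * f s)
        = (\<Sum>s\<in>S. Cov M (\<lambda>x. of_real (\<rho> s x)) (F s))"
        by (simp add: sum_subtractf[symmetric] Cov_def f_def)
      also have "norm \<dots> \<le> (\<Sum>s\<in>S. B * (1 + ?L) * real n ^ e * exp (- \<tau> * real N))"
        by (intro sum_norm_le cov)
      finally show ?thesis by simp
    qed
    define E where "E = (1 / \<delta>) ^ d"
    have E: "1 \<le> E" unfolding E_def using \<delta> by (intro one_le_power) simp
    have card: "real (card S) \<le> Q * E" "1 + real (card S) \<le> Q * E"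
    proof -
      have "Q * E = E + 2 ^ d / c * E" by (simp add: Q_def distrib_right)
      then show "real (card S) \<le> Q * E" "1 + real (card S) \<le> Q * E" using S(2) E unfolding E_def[symmetric] by linarith+
    qed
    have "1 + ?L \<le> (1 + L) * (1 + Q) * (E / \<delta>)"
    proof -
      have E\<delta>: "1 \<le> E / \<delta>" using E \<delta> by (simp add: field_simps)
      have "(1 + real (card S)) / \<delta> \<le> Q * (E / \<delta>)" using card(2) \<delta> by (simp add: divide_right_mono)
      also have "\<dots> \<le> (1 + L) * (Q * (E / \<delta>))" 

      proof -
        have "0 \<le> Q * (E / \<delta>)" using Q E\<delta> by (intro mult_nonneg_nonneg) auto
        from mult_right_mono[of 1 "1 + L", OF _ this] show ?thesis using L by simp
      qed
      finally have 1: "(1 + real (card S)) / \<delta> \<le> (1 + L) * (Q * (E / \<delta>))" .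
      have "1 + L \<le> (1 + L) * (E / \<delta>)" using mult_left_mono[OF E\<delta>, of "1 + L"] L by simp
      then have "1 + ?L \<le> (1 + L) * (E / \<delta>) + (1 + L) * (Q * (E / \<delta>))" using 1 by linarith
      also have "\<dots> = (1 + L) * (1 + Q) * (E / \<delta>)" by (simp only: distrib_left distrib_right mult.assoc mult_1_left)
      finally show ?thesis .
    qed
    then have "real (card S) * (B * (1 + ?L) * real n ^ e * exp (- \<tau> * real N))
       \<le> (Q * E) * (B * ((1 + L) * (1 + Q) * (E / \<delta>)) * real n ^ e * exp (- \<tau> * real N))"
      using B L \<delta> E Q card by (intro mult_mono) auto
    also have "\<dots> = B * Q * (1 + Q) * (1 + L) * real n ^ e * exp (- \<tau> * real N) * (E * E / \<delta>)"
      by (simp add: ac_simps)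
    also have "E * E / \<delta> = 1 / \<delta> ^ (2 * d + 1)"
      by (simp add: E_def power_add power_divide mult_2)
    finally have card_bound: "real (card S) * (B * (1 + ?L) * real n ^ e * exp (- \<tau> * real N))
      \<le> B * Q * (1 + Q) * (1 + L) * real n ^ e * exp (- \<tau> * real N) / \<delta> ^ (2 * d + 1)" by simp
    have tri: "norm (a - b) \<le> norm (a - p) + norm (p - q) + norm (b - q)" for a b p q :: complex
      by norm
    have "norm ((LINT x|M. F x x) - (LINT y|M. f y)) \<le> 8 * real n * L * \<delta> + B * Q * (1 + Q) * (1 + L) * real n ^ e * exp (- \<tau> * real N) / \<delta> ^ (2 * d + 1)"
      using tri[of "LINT x|M. F x x" "LINT y|M. f y" "\<Sum>s\<in>S. LINT x|M. of_real (\<rho> s x) * F s x" "\<Sum>s\<in>S. LINT x|M. of_real (\<rho> s x) * f s"]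
        a1 a2 a3 card_bound by linarith
    then show "decoupling_error N n' G
        \<le> 8 * real n * L * \<delta> + B * Q * (1 + Q) * (1 + L) * real n ^ e * exp (- \<tau> * real N) / \<delta> ^ (2 * d + 1)"
      by (simp add: decoupling_error_def F_def f_def)
  qed
qed

lemma exp_log_le:
  assumes "1 \<le> n" "real E / \<tau> * ln (real n) \<le> real N" "0 < \<tau>"
  shows "exp (- \<tau> * real N) \<le> 1 / real n ^ E"
proof -
  have "real E * ln (real n) \<le> \<tau> * real N" using assms by (simp add: field_simps)
  then have "exp (- \<tau> * real N) \<le> exp (- (real E * ln (real n)))" by simp
  also have "\<dots> = 1 / real n ^ E" using assms(1) by (simp add: exp_minus exp_of_nat_mult inverse_eq_divide)
  finally show ?thesis .
qed

text \<open>Exponential decay beats every polynomial: after a delay of order \<open>ln n\<close>, kernels whose Lipschitz constants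
  grow polynomially decouple with a polynomially small error.\<close>

lemma decoupling_polynomial:
  obtains K C :: real where "0 \<le> K" "0 \<le> C"
    "\<And>N n' n L (G :: nat \<Rightarrow> 'a \<Rightarrow> 'a \<Rightarrow> complex). N \<le> n' \<Longrightarrow> n' \<le> n \<Longrightarrow> 1 \<le> n \<Longrightarrow> K * ln (real n) \<le> real N \<Longrightarrow>
      0 \<le> L \<Longrightarrow> L \<le> real n ^ a \<Longrightarrow> (\<And>k. lipschitz_kernel L (G k)) \<Longrightarrow>
      decoupling_error N n' G \<le> C / real n ^ 3"
proof -
  obtain B \<tau> e u where B: "0 < B" "0 < \<tau>" and dec:
    "\<And>N n' n L \<delta> (G :: nat \<Rightarrow> 'a \<Rightarrow> 'a \<Rightarrow> complex). N \<le> n' \<Longrightarrow> n' \<le> n \<Longrightarrow> 1 \<le> n \<Longrightarrow> 0 \<le> L \<Longrightarrow> 0 < \<delta> \<Longrightarrow> \<delta> \<le> 1 \<Longrightarrow>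
      (\<And>k. lipschitz_kernel L (G k)) \<Longrightarrow>
      decoupling_error N n' G \<le> 8 * real n * L * \<delta> + B * (1 + L) * real n ^ e * exp (- \<tau> * real N) / \<delta> ^ u"
    using decoupling by blast
  \<comment> \<open>The decay has to absorb \<open>n ^ a\<close> from the Lipschitz constant, \<open>n ^ e\<close> from decorrelation, and
    \<open>n ^ ((a + 4) * u)\<close> from the mesh, and to leave \<open>n powr (- 3)\<close>.\<close>
  define E where "E = a + e + (a + 4) * u + 3"
  show thesis
  proof (rule that[of "real E / \<tau>" "8 + 2 * B"])
    show "0 \<le> real E / \<tau>" "0 \<le> 8 + 2 * B" using B by auto
    fix N n' n :: nat and L :: real and G :: "nat \<Rightarrow> 'a \<Rightarrow> 'a \<Rightarrow> complex"
    assume n: "N \<le> n'" "n' \<le> n" "1 \<le> n" "real E / \<tau> * ln (real n) \<le> real N" and L: "0 \<le> L" "L \<le> real n ^ a"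
      and G: "\<And>k. lipschitz_kernel L (G k)"
    have n1: "1 \<le> real n" "0 < real n" using n by auto
    \<comment> \<open>The mesh that makes the Lipschitz error \<open>8 * n * L * \<delta>\<close> of order \<open>n powr (- 3)\<close>.\<close>
    define \<delta> where "\<delta> = 1 / real n ^ (a + 4)"
    have \<delta>: "0 < \<delta>" "\<delta> \<le> 1" using n1 one_le_power[OF n1(1), of "a + 4"] by (auto simp: \<delta>_def field_simps)
    have "decoupling_error N n' G \<le> 8 * real n * L * \<delta> + B * (1 + L) * real n ^ e * exp (- \<tau> * real N) / \<delta> ^ u"
      by (rule dec[OF n(1-3) L(1) \<delta> G])
    also have "8 * real n * L * \<delta> \<le> 8 * real n * real n ^ a * \<delta>"
      using L \<delta> by (intro mult_right_mono mult_left_mono) auto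
    also have "8 * real n * real n ^ a * \<delta> = 8 / real n ^ 3"
      using n1 by (simp add: \<delta>_def power_add field_simps power3_eq_cube power4_eq_xxxx)
    also have "B * (1 + L) * real n ^ e * exp (- \<tau> * real N) / \<delta> ^ u
        \<le> B * (2 * real n ^ a) * real n ^ e * (1 / real n ^ E) / \<delta> ^ u"
    proof (intro divide_right_mono mult_mono exp_log_le n B)
      show "1 + L \<le> 2 * real n ^ a" using L one_le_power[OF n1(1), of a] by simp
    qed (use B L \<delta> in auto)
    also have "\<dots> = 2 * B / real n ^ 3"
      using n1 by (simp add: \<delta>_def E_def power_add power_mult[symmetric] field_simps)
    finally show "decoupling_error N n' G \<le> (8 + 2 * B) / real n ^ 3"
      by (simp add: add_divide_distrib)
  qed
qed

end

section \<open>Smoothed targets\<close>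

text \<open>A Lipschitz version of the indicator of \<open>t < r\<close>; it differs from it only on the layer \<open>r - \<delta> < t < r\<close>.\<close>

definition ramp :: "real \<Rightarrow> real \<Rightarrow> real \<Rightarrow> real" where
  "ramp \<delta> r t = max 0 (min 1 ((r - t) / \<delta>))"

lemma ramp_range: "0 \<le> ramp \<delta> r t" "ramp \<delta> r t \<le> 1"
  by (auto simp: ramp_def)

lemma ramp_lipschitz:
  assumes "0 < \<delta>"
  shows "\<bar>ramp \<delta> r s - ramp \<delta> r t\<bar> \<le> \<bar>s - t\<bar> / \<delta>"
proof -
  have "\<bar>ramp \<delta> r s - ramp \<delta> r t\<bar> \<le> \<bar>(r - s) / \<delta> - (r - t) / \<delta>\<bar>"
    by (auto simp: ramp_def max_def min_def)
  also have "(r - s) / \<delta> - (r - t) / \<delta> = (t - s) / \<delta>" using assms by (simp add: diff_divide_distrib)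
  finally show ?thesis using assms by (simp add: abs_minus_commute)
qed

lemma ramp_eq_1: "0 < \<delta> \<Longrightarrow> t \<le> r - \<delta> \<Longrightarrow> ramp \<delta> r t = 1"
  by (auto simp: ramp_def field_simps)

lemma ramp_eq_0: "0 < \<delta> \<Longrightarrow> r \<le> t \<Longrightarrow> ramp \<delta> r t = 0"
  by (auto simp: ramp_def field_simps divide_nonpos_pos max_def)

lemma indicator_minus_ramp:
  assumes "0 < \<delta>"
  shows "\<bar>indicator (ball y r) z - ramp \<delta> r (dist y z)\<bar> \<le> indicator (annulus y r \<delta>) z"
proof -
  consider "r \<le> dist y z" | "dist y z \<le> r - \<delta>" | "r - \<delta> \<le> dist y z" "dist y z < r" by linarith
  then show ?thesis
  proof cases
    case 3
    then show ?thesis using ramp_range[of \<delta> r "dist y z"] by (auto simp: indicator_def)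
  qed (use assms in \<open>auto simp: ramp_eq_0 ramp_eq_1 indicator_def\<close>)
qed

text \<open>A Lipschitz function between the indicators of a layer of width \<open>\<delta>\<close> and of the layer of width \<open>3 * \<delta>\<close>
  around it.\<close>

lemma annulus_bump:
  fixes \<delta> r s t :: real and y z :: "'a::metric_space"
  assumes "0 < \<delta>"
  defines "b \<equiv> \<lambda>t. ramp \<delta> (r + \<delta>) t - ramp \<delta> (r - \<delta>) t"
  shows "indicator (annulus y r \<delta>) z \<le> b (dist y z)" "b (dist y z) \<le> indicator (annulus y (r + \<delta>) (3 * \<delta>)) z"
    "0 \<le> b t" "b t \<le> 1" "\<bar>b s - b t\<bar> \<le> 2 / \<delta> * \<bar>s - t\<bar>"
proof -
  show 0: "0 \<le> b t" for t
    unfolding b_def ramp_def using assms(1) by (auto simp: max_def min_def field_simps)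
  show "b t \<le> 1" unfolding b_def using ramp_range[of \<delta> "r + \<delta>" t] ramp_range[of \<delta> "r - \<delta>" t] by linarith
  show "indicator (annulus y r \<delta>) z \<le> b (dist y z)"
    using 0[of "dist y z"] assms(1) by (auto simp: indicator_def b_def ramp_eq_0 ramp_eq_1)
  show "b (dist y z) \<le> indicator (annulus y (r + \<delta>) (3 * \<delta>)) z"
  proof -
    consider "r + \<delta> \<le> dist y z" | "dist y z \<le> r - 2 * \<delta>" | "r - 2 * \<delta> \<le> dist y z" "dist y z < r + \<delta>" by linarith
    then show ?thesis
    proof cases
      case 3
      then show ?thesis unfolding b_def
        using ramp_range[of \<delta> "r + \<delta>" "dist y z"] ramp_range[of \<delta> "r - \<delta>" "dist y z"] by (auto simp: indicator_def)
    qed (use assms(1) in \<open>auto simp: b_def ramp_eq_0 ramp_eq_1 indicator_def\<close>)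
  qed
  have "\<bar>b s - b t\<bar> \<le> \<bar>s - t\<bar> / \<delta> + \<bar>s - t\<bar> / \<delta>"
    using ramp_lipschitz[OF assms(1), of "r + \<delta>" s t] ramp_lipschitz[OF assms(1), of "r - \<delta>" s t]
    unfolding b_def by linarith
  then show "\<bar>b s - b t\<bar> \<le> 2 / \<delta> * \<bar>s - t\<bar>" by simp
qed

lemma abs_dist_diff_le: "\<bar>dist y z - dist y' z'\<bar> \<le> dist y y' + dist z (z' :: 'a::metric_space)"
proof -
  have "dist y z \<le> dist y y' + dist y' z' + dist z' z" 
    using dist_triangle[of y z y'] dist_triangle[of y' z z'] by linarith
  moreover have "dist y' z' \<le> dist y' y + dist y z + dist z z'"
    using dist_triangle[of y' z' y] dist_triangle[of y z' z] by linarith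
  ultimately show ?thesis by (simp add: dist_commute abs_le_iff)
qed

text \<open>The exponent \<open>\<kappa> > 1\<close> means that target measures decay faster than \<open>1 / ln n\<close>. Short time correlations, which
  extend over times of order \<open>ln n\<close> and are not controlled by mixing, are then negligible.\<close>

locale shrinking_targets = mixing_system M T d for M :: "'a::metric_space measure" and T d +
  fixes r :: "nat \<Rightarrow> real"
  assumes radius_lower: "\<exists>c>0. \<exists>\<gamma>\<ge>0. \<forall>k\<ge>1. c * real k powr (- \<gamma>) \<le> r k"
    and target_lower: "\<exists>c>0. \<exists>a<1. 0 \<le> a \<and> (\<forall>k\<ge>1. \<forall>y. c * real k powr (- a) \<le> measure M (ball y (r k)))"
    and target_upper: "\<exists>\<kappa>>1. \<exists>C>0. \<forall>k\<ge>2. \<forall>y. measure M (ball y (r k)) \<le> C * ln (real k) powr (- \<kappa>)"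
begin

text \<open>Radii up to time \<open>n\<close> are at least a power of \<open>1 / n\<close>, so a smoothing scale that is a higher power of \<open>1 / n\<close> is
  small relative to all of them. The factor \<open>3\<close> leaves room for the bump functions.\<close>

lemma annuli_small:
  obtains a :: nat and C :: real where "0 \<le> C"
    "\<And>n k y r'. 1 \<le> k \<Longrightarrow> k \<le> n \<Longrightarrow> r k \<le> r' \<Longrightarrow> measure M (annulus y r' (3 * (1 / real n ^ a))) \<le> C / real n ^ 3"
proof -
  obtain \<beta> C where \<beta>: "0 < \<beta>" "0 < C" and ann: "\<And>y r s \<rho>. 0 < s \<Longrightarrow> 0 < \<rho> \<Longrightarrow> \<rho> \<le> r \<Longrightarrow> \<rho> \<le> 1 \<Longrightarrow>
     measure M (annulus y r s) \<le> C * (s / \<rho>) powr \<beta>"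
    using annuli unfolding annulus_regular_def by blast
  obtain c \<gamma> where c: "0 < c" "0 \<le> \<gamma>" and low: "\<And>k. 1 \<le> k \<Longrightarrow> c * real k powr (- \<gamma>) \<le> r k"
    using radius_lower by blast
  define c' where "c' = min c 1"
  have c': "0 < c'" "c' \<le> c" "c' \<le> 1" using c by (auto simp: c'_def)
  \<comment> \<open>With this exponent \<open>(n powr (\<gamma> - a)) powr \<beta>\<close> is at most \<open>n powr (- 3)\<close>.\<close>
  define a where "a = nat \<lceil>\<gamma> + 3 / \<beta>\<rceil>"
  have a: "\<gamma> + 3 / \<beta> \<le> real a" unfolding a_def by linarith
  show thesis
  proof (rule that[of "C * (3 / c') powr \<beta>" a])
    show "0 \<le> C * (3 / c') powr \<beta>" using \<beta> by simp
    fix n k :: nat and y :: 'a and r' :: real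
    assume k: "1 \<le> k" "k \<le> n" "r k \<le> r'"
    have n: "1 \<le> real n" "0 < real n" using k by auto
    define \<rho> where "\<rho> = c' * real n powr (- \<gamma>)"
    have \<rho>: "0 < \<rho>" using c' n by (simp add: \<rho>_def)
    have "real n powr (- \<gamma>) \<le> real k powr (- \<gamma>)" using k c by (intro powr_mono2') auto
    then have "\<rho> \<le> c * real k powr (- \<gamma>)" unfolding \<rho>_def using c' c by (intro mult_mono) auto
    also have "\<dots> \<le> r k" using k by (intro low)
    finally have 1: "\<rho> \<le> r'" using k by simp
    have "real n powr (- \<gamma>) \<le> 1" using n c powr_mono[of "-\<gamma>" 0 "real n"] by simp
    then have 2: "\<rho> \<le> 1" unfolding \<rho>_def using c' mult_mono[of c' 1 "real n powr (- \<gamma>)" 1] by simp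
    have "measure M (annulus y r' (3 * (1 / real n ^ a))) \<le> C * ((3 * (1 / real n ^ a)) / \<rho>) powr \<beta>"
      using n by (intro ann \<rho> 1 2) simp
    also have "(3 * (1 / real n ^ a)) / \<rho> = 3 / c' * real n powr (\<gamma> - real a)"
      using n by (simp add: \<rho>_def powr_diff powr_minus powr_realpow field_simps)
    also have "(3 / c' * real n powr (\<gamma> - real a)) powr \<beta> = (3 / c') powr \<beta> * real n powr ((\<gamma> - real a) * \<beta>)"
      by (simp only: powr_mult powr_powr)
    finally have *: "measure M (annulus y r' (3 * (1 / real n ^ a))) \<le> C * ((3 / c') powr \<beta> * real n powr ((\<gamma> - real a) * \<beta>))" .
    have "real n powr ((\<gamma> - real a) * \<beta>) \<le> real n powr (- 3)"
    proof (intro powr_mono n)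
      have "3 / \<beta> * \<beta> \<le> (real a - \<gamma>) * \<beta>" using a \<beta> by (intro mult_right_mono) auto
      then show "(\<gamma> - real a) * \<beta> \<le> - 3" using \<beta> by (simp add: algebra_simps)
    qed
    also have "real n powr (- 3) = 1 / real n ^ 3"
      using n powr_realpow[of "real n" 3] by (simp add: powr_minus divide_inverse)
    finally have "C * ((3 / c') powr \<beta> * real n powr ((\<gamma> - real a) * \<beta>)) \<le> C * ((3 / c') powr \<beta> * (1 / real n ^ 3))"
      using \<beta> by (intro mult_left_mono) auto
    with * show "measure M (annulus y r' (3 * (1 / real n ^ a))) \<le> C * (3 / c') powr \<beta> / real n ^ 3"
      by simp
  qed
qed

lemma annulus_mono: "s \<le> t \<Longrightarrow> annulus y q s \<subseteq> annulus y q t" by auto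

lemma annulus_sets [measurable]: "annulus y q s \<in> sets M"
  by (simp add: sets_M annulus_borel)

lemma ball_sets [measurable]: "ball y q \<in> sets M"
  by (simp add: sets_M)

lemma measurable_dist_M:
  assumes "f \<in> measurable K M" "g \<in> measurable K M"
  shows "(\<lambda>x. dist (f x) (g x)) \<in> borel_measurable K"
  using assms measurable_cong_sets[OF refl sets_M, of K] by (intro measurable_dist_pair[OF compact_space]) simp_all

lemma integrable_indicator_M: "B \<in> sets M \<Longrightarrow> integrable M (indicator B :: 'a \<Rightarrow> real)"
  by (rule integrable_real_indicator) (auto simp: less_top[symmetric])

lemma borel_measurable_ramp [measurable]: "ramp \<delta> q \<in> borel_measurable borel"
  unfolding ramp_def[abs_def] by measurable

text \<open>The layer now moves with the starting point. Decoupling a bump function reduces the estimate to fixed layers,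
  provided that the return time exceeds a multiple of \<open>ln n\<close>.\<close>

lemma diagonal_annuli_small:
  fixes a :: nat and C0 :: real
  assumes C0: "0 \<le> C0" and small: "\<And>n k y r'. 1 \<le> k \<Longrightarrow> k \<le> n \<Longrightarrow> r k \<le> r' \<Longrightarrow> measure M (annulus y r' (3 * (1 / real n ^ a))) \<le> C0 / real n ^ 3"
  obtains K C :: real where "0 \<le> K" "0 \<le> C"
    "\<And>n k. 1 \<le> k \<Longrightarrow> k \<le> n \<Longrightarrow> K * ln (real n) \<le> real k \<Longrightarrow>
       measure M {x. (T ^^ k) x \<in> annulus x (r k) (1 / real n ^ a)} \<le> C / real n ^ 3"
proof -
  obtain K C where KC: "0 \<le> K" "0 \<le> C" and dec: "\<And>N n' n L (G :: nat \<Rightarrow> 'a \<Rightarrow> 'a \<Rightarrow> complex). N \<le> n' \<Longrightarrow> n' \<le> n \<Longrightarrow> 1 \<le> n \<Longrightarrow> K * ln (real n) \<le> real N \<Longrightarrow>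
      0 \<le> L \<Longrightarrow> L \<le> real n ^ (a + 1) \<Longrightarrow> (\<And>k. lipschitz_kernel L (G k)) \<Longrightarrow>
      decoupling_error N n' G \<le> C / real n ^ 3"
    using decoupling_polynomial[of "a + 1"] by blast
  show thesis
  proof (rule that[of K "C + C0 + 1"])
    show "0 \<le> K" "0 \<le> C + C0 + 1" using KC C0 by auto
    fix n k :: nat assume k: "1 \<le> k" "k \<le> n" "K * ln (real n) \<le> real k"
    show "measure M {x. (T ^^ k) x \<in> annulus x (r k) (1 / real n ^ a)} \<le> (C + C0 + 1) / real n ^ 3"
    proof (cases "n = 1")
      case True
      have "measure M {x. (T ^^ k) x \<in> annulus x (r k) (1 / real n ^ a)} \<le> 1" by (rule prob_le_1)
      also have "1 \<le> (C + C0 + 1) / real n ^ 3" using True KC C0 by simp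
      finally show ?thesis .
    next
      case False
      with k have n: "2 \<le> n" by simp
      define \<delta> where "\<delta> = 1 / real n ^ a"
      have \<delta>: "0 < \<delta>" using n by (simp add: \<delta>_def)
      define b where "b t = ramp \<delta> (r k + \<delta>) t - ramp \<delta> (r k - \<delta>) t" for t
      note bump = annulus_bump[OF \<delta>, where r="r k", folded b_def]
      define G where "G j y z = complex_of_real (b (dist y z))" for j :: nat and y z :: 'a
      have [measurable]: "b \<in> borel_measurable borel" unfolding b_def[abs_def] by measurable
      note [measurable] = measurable_iter
      have bm: "(\<lambda>x. b (dist (f x) (g x))) \<in> borel_measurable M'" if "f \<in> measurable M' M" "g \<in> measurable M' M" for f g and M' :: "'k measure"
        using measurable_dist_M[OF that] by measurable
      have b01: "norm (b t) \<le> 1" for t using bump(3,4)[of t] by simp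
      have "decoupling_error k k G \<le> C / real n ^ 3"
      proof (rule dec[of k k n "2 / \<delta>" G])
        show "2 / \<delta> \<le> real n ^ (a + 1)" using n by (simp add: \<delta>_def mult_right_mono)
        show "lipschitz_kernel (2 / \<delta>) (G j)" for j
          unfolding lipschitz_kernel_def
        proof (intro conjI allI)
          show "norm (G j y z) \<le> 1" for y z using b01 by (simp add: G_def)
          show "norm (G j y z - G j y' z') \<le> 2 / \<delta> * (dist y y' + dist z z')" for y y' z z'
          proof -
            have "norm (G j y z - G j y' z') = \<bar>b (dist y z) - b (dist y' z')\<bar>"
              unfolding G_def of_real_diff[symmetric] norm_of_real ..
            also have "\<dots> \<le> 2 / \<delta> * \<bar>dist y z - dist y' z'\<bar>" by (rule bump(5))
            also have "\<dots> \<le> 2 / \<delta> * (dist y y' + dist z z')" using \<delta> abs_dist_diff_le by (intro mult_left_mono) auto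
            finally show ?thesis .
          qed
          show "(\<lambda>(y, z). G j y z) \<in> borel_measurable (M \<Otimes>\<^sub>M M)"
            unfolding G_def case_prod_beta by (intro measurable_compose[OF bm borel_measurable_of_real]) auto
        qed
      qed (use k \<delta> in auto)
      then have D: "norm ((LINT x|M. G k x ((T ^^ k) x)) - (LINT y|M. LINT x|M. G k y ((T ^^ k) x))) \<le> C / real n ^ 3"
        by (simp add: decoupling_error_def)
      have off: "norm (LINT y|M. LINT x|M. G k y ((T ^^ k) x)) \<le> C0 / real n ^ 3"
      proof (rule norm_integral_le)
        show "(\<lambda>y. LINT x|M. G k y ((T ^^ k) x)) \<in> borel_measurable M"
        proof (rule borel_measurable_lebesgue_integral)
          show "(\<lambda>(y, x). G k y ((T ^^ k) x)) \<in> borel_measurable (M \<Otimes>\<^sub>M M)"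
            unfolding G_def case_prod_beta by (intro measurable_compose[OF bm borel_measurable_of_real]) auto
        qed
        fix y
        have "(\<lambda>z. b (dist y z)) \<in> borel_measurable M" by (intro bm) (auto simp: space_M)
        then have "(LINT x|M. G k y ((T ^^ k) x)) = complex_of_real (LINT z|M. b (dist y z))"
          using integral_iter[of "\<lambda>z. b (dist y z)" k] by (simp add: G_def)
        also have "norm \<dots> = (LINT z|M. b (dist y z))"
          unfolding norm_of_real using bump(3) by (intro abs_of_nonneg Bochner_Integration.integral_nonneg) auto
        also have "\<dots> \<le> (LINT z|M. indicator (annulus y (r k + \<delta>) (3 * \<delta>)) z)"
          by (intro integral_mono integrable_bounded[OF _ b01] bm integrable_indicator_M bump(2) annulus_sets) (auto simp: space_M)
        also have "\<dots> \<le> C0 / real n ^ 3"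
          using small[OF k(1,2), of "r k + \<delta>" y] \<delta> by (simp add: \<delta>_def space_M)
        finally show "norm (LINT x|M. G k y ((T ^^ k) x)) \<le> C0 / real n ^ 3" .
      qed
      have diagm: "(\<lambda>x. b (dist x ((T ^^ k) x))) \<in> borel_measurable M" by (intro bm) auto
      have setm: "{x. (T ^^ k) x \<in> annulus x (r k) \<delta>} \<in> sets M"
      proof -
        have "(\<lambda>x. dist x ((T ^^ k) x)) \<in> borel_measurable M" by (intro measurable_dist_M) auto
        then have "{x \<in> space M. r k - \<delta> \<le> dist x ((T ^^ k) x) \<and> dist x ((T ^^ k) x) < r k} \<in> sets M" by measurable
        then show ?thesis by (simp add: space_M)
      qed
      have "measure M {x. (T ^^ k) x \<in> annulus x (r k) \<delta>} = (LINT x|M. indicator {x. (T ^^ k) x \<in> annulus x (r k) \<delta>} x)"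
        using setm by (simp add: space_M)
      also have "\<dots> \<le> (LINT x|M. b (dist x ((T ^^ k) x)))"
      proof (intro integral_mono integrable_bounded[OF diagm b01])
        show "integrable M (indicator {x. (T ^^ k) x \<in> annulus x (r k) \<delta>} :: 'a \<Rightarrow> real)"
          using setm by (simp add: less_top[symmetric])
        show "indicator {x. (T ^^ k) x \<in> annulus x (r k) \<delta>} x \<le> b (dist x ((T ^^ k) x))" for x
          using bump(1)[of x "(T ^^ k) x"] by (simp add: indicator_def)
      qed
      also have "\<dots> \<le> norm (LINT x|M. G k x ((T ^^ k) x))"
        by (simp add: G_def)
      also have "\<dots> \<le> C / real n ^ 3 + C0 / real n ^ 3"
        using D off norm_triangle_ineq2[of "LINT x|M. G k x ((T ^^ k) x)" "LINT y|M. LINT x|M. G k y ((T ^^ k) x)"] by linarith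
      also have "\<dots> \<le> (C + C0 + 1) / real n ^ 3" by (simp add: add_divide_distrib)
      finally show ?thesis by (simp add: \<delta>_def)
    qed
  qed
qed

abbreviation hit :: "nat \<Rightarrow> 'a \<Rightarrow> 'a \<Rightarrow> real" where
  "hit k y x \<equiv> indicator (ball y (r k)) ((T ^^ k) x)"

abbreviation mass :: "nat \<Rightarrow> 'a \<Rightarrow> real" where
  "mass k y \<equiv> measure M (ball y (r k))"

lemma integrable_iter:
  fixes f :: "'a \<Rightarrow> 'b::{banach, second_countable_topology}"
  shows "integrable M f \<Longrightarrow> integrable M (\<lambda>x. f ((T ^^ k) x))"
  using integrable_distr[OF measurable_iter, of k f] by (simp add: invariant_iter)

lemma hit_measurable [measurable]: "hit k y \<in> borel_measurable M"
  using measurable_compose[OF measurable_iter[of k], of "indicator (ball y (r k)) :: 'a \<Rightarrow> real" borel] by simp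

lemma integral_hit: "(LINT x|M. hit k y x) = mass k y"
proof -
  have "(indicator (ball y (r k)) :: 'a \<Rightarrow> real) \<in> borel_measurable M" by simp
  from integral_iter[OF this, of k] show ?thesis by (simp add: space_M)
qed

lemma integrable_hit: "integrable M (hit k y)"
  by (rule integrable_bounded[of _ 1], rule hit_measurable) (simp add: indicator_def)

lemma integrable_hit_mult: "integrable M (\<lambda>x. hit j y x * hit k y x)"
  by (rule integrable_bounded[of _ 1], intro borel_measurable_times hit_measurable) (simp add: indicator_def)

lemma target_sum_measurable [measurable]: "target_sum M T r y n \<in> borel_measurable M"
  unfolding target_sum_def[abs_def] by measurable

lemma integral_target_sum: "(LINT x|M. target_sum M T r y n x) = 0"
  unfolding target_sum_def using integrable_hit by (simp add: integral_hit prob_space)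

lemma Var_target_sum:
  "Var M (target_sum M T r y n) = (\<Sum>j=1..n. \<Sum>k=1..n. (LINT x|M. hit j y x * hit k y x) - mass j y * mass k y)"
proof -
  have "Var M (target_sum M T r y n) = (LINT x|M. target_sum M T r y n x * target_sum M T r y n x)"
    by (simp add: Var_def Cov_def integral_target_sum)
  also have "\<dots> = (LINT x|M. (\<Sum>j=1..n. \<Sum>k=1..n. (hit j y x - mass j y) * (hit k y x - mass k y)))"
    unfolding target_sum_def sum_product ..
  also have "\<dots> = (\<Sum>j=1..n. \<Sum>k=1..n. (LINT x|M. hit j y x * hit k y x) - mass j y * mass k y)"
  proof -
    have eq: "(\<lambda>x. (hit j y x - mass j y) * (hit k y x - mass k y))
        = (\<lambda>x. hit j y x * hit k y x - mass j y * hit k y x - mass k y * hit j y x + mass j y * mass k y)" for j k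
      by (auto simp: algebra_simps)
    have "has_bochner_integral M (\<lambda>x. (hit j y x - mass j y) * (hit k y x - mass k y))
       ((LINT x|M. hit j y x * hit k y x) - mass j y * mass k y - mass k y * mass j y + mass j y * mass k y)" for j k
      unfolding eq
    proof (intro has_bochner_integral_add has_bochner_integral_diff)
      show "has_bochner_integral M (\<lambda>x. hit j y x * hit k y x) (LINT x|M. hit j y x * hit k y x)"
        by (rule has_bochner_integral_integrable[OF integrable_hit_mult])
      have h: "has_bochner_integral M (hit i y) (mass i y)" for i
        using has_bochner_integral_integrable[OF integrable_hit] by (simp add: integral_hit)
      show "has_bochner_integral M (\<lambda>x. mass j y * hit k y x) (mass j y * mass k y)"
        "has_bochner_integral M (\<lambda>x. mass k y * hit j y x) (mass k y * mass j y)"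
        by (intro has_bochner_integral_mult_right h)+
      show "has_bochner_integral M (\<lambda>x. mass j y * mass k y) (mass j y * mass k y)"
        by (simp add: has_bochner_integral_iff prob_space)
    qed
    then have "has_bochner_integral M (\<lambda>x. \<Sum>j=1..n. \<Sum>k=1..n. (hit j y x - mass j y) * (hit k y x - mass k y))
       (\<Sum>j=1..n. \<Sum>k=1..n. (LINT x|M. hit j y x * hit k y x) - mass j y * mass k y - mass k y * mass j y + mass j y * mass k y)"
      by (intro has_bochner_integral_sum)
    then show ?thesis by (simp add: has_bochner_integral_iff mult.commute)
  qed
  finally show ?thesis .
qed

text \<open>Replace the two indicators by ramps, at the cost of the measures of thin annuli, and decorrelate the ramps.\<close>

lemma far_hits_decorrelate:
  obtains K C :: real where "0 \<le> K" "0 \<le> C"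
    "\<And>n j k y. 1 \<le> j \<Longrightarrow> 1 \<le> k \<Longrightarrow> j \<le> n \<Longrightarrow> k \<le> n \<Longrightarrow> real j + K * ln (real n) \<le> real k \<Longrightarrow>
      \<bar>(LINT x|M. hit j y x * hit k y x) - mass j y * mass k y\<bar> \<le> C / real n ^ 3"
proof -
  obtain a C0 where C0: "0 \<le> C0" and small: "\<And>n k y r'. 1 \<le> k \<Longrightarrow> k \<le> n \<Longrightarrow> r k \<le> r' \<Longrightarrow> measure M (annulus y r' (3 * (1 / real n ^ a))) \<le> C0 / real n ^ 3"
    by (rule annuli_small) (rule that, assumption+)
  obtain B \<tau> e where B: "0 < B" "0 < \<tau>" and dec:
    "\<And>N n' n L \<phi> G. N \<le> n' \<Longrightarrow> n' \<le> n \<Longrightarrow> 1 \<le> n \<Longrightarrow> 0 \<le> L \<Longrightarrow>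
      lipschitz_test L \<phi> \<Longrightarrow> (\<And>k. lipschitz_test L (G k)) \<Longrightarrow>
      norm (Cov M \<phi> (\<lambda>x. \<Prod>k=N..n'. G k ((T ^^ k) x))) \<le> B * (1 + L) * real n ^ e * exp (- \<tau> * real N)"
    using lipschitz_decorrelation by blast
  define E where "E = a + e + 3"
  show thesis
  proof (rule that[of "real E / \<tau>" "4 * C0 + 2 * B"])
    show "0 \<le> real E / \<tau>" "0 \<le> 4 * C0 + 2 * B" using B C0 by auto
    fix n j k :: nat and y :: 'a
    assume jk: "1 \<le> j" "1 \<le> k" "j \<le> n" "k \<le> n" and gap: "real j + real E / \<tau> * ln (real n) \<le> real k"
    have n: "1 \<le> real n" "0 < real n" "1 \<le> n" using jk by auto
    have "0 \<le> real E / \<tau> * ln (real n)" using B n by simp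
    then have jlek: "j \<le> k" using gap by linarith
    define l where "l = k - j"
    have l: "real E / \<tau> * ln (real n) \<le> real l" "l \<le> n" "k = l + j" using gap jlek jk by (auto simp: l_def of_nat_diff)
    define \<delta> where "\<delta> = 1 / real n ^ a"
    have \<delta>: "0 < \<delta>" using n by (simp add: \<delta>_def)
    define f where "f i z = ramp \<delta> (r i) (dist y z)" for i z
    have f01: "0 \<le> f i z" "f i z \<le> 1" "\<bar>f i z\<bar> \<le> 1" for i z using ramp_range[of \<delta> "r i" "dist y z"] by (auto simp: f_def)
    have fL: "\<bar>f i z - f i w\<bar> \<le> 1 / \<delta> * dist z w" for i z w
    proof -
      have "\<bar>f i z - f i w\<bar> \<le> \<bar>dist y z - dist y w\<bar> / \<delta>" unfolding f_def by (rule ramp_lipschitz[OF \<delta>])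
      also have "\<dots> \<le> 1 / \<delta> * dist z w" using \<delta> abs_dist_diff_le[of y z y w] by (simp add: divide_right_mono)
      finally show ?thesis .
    qed
    have fm [measurable]: "f i \<in> borel_measurable M" for i
      by (rule borel_measurable_lipschitz[of _ "1 / \<delta>"]) (use fL in simp)
    note [measurable] = measurable_iter
    let ?b = "\<lambda>i z. indicator (ball y (r i)) z :: real"
    have bf: "\<bar>?b i z - f i z\<bar> \<le> indicator (annulus y (r i) \<delta>) z" for i z
      unfolding f_def by (rule indicator_minus_ramp[OF \<delta>])
    have ann: "measure M (annulus y (r i) \<delta>) \<le> C0 / real n ^ 3" if "1 \<le> i" "i \<le> n" for i
    proof -
      have "measure M (annulus y (r i) \<delta>) \<le> measure M (annulus y (r i) (3 * \<delta>))"
        using \<delta> by (intro finite_measure_mono annulus_mono) auto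
      also have "\<dots> \<le> C0 / real n ^ 3" unfolding \<delta>_def using that by (intro small) auto
      finally show ?thesis .
    qed
    have "(LINT x|M. hit j y x * hit k y x) = (LINT x|M. (\<lambda>x. ?b j x * ?b k ((T ^^ l) x)) ((T ^^ j) x))"
      by (simp add: l(3) funpow_add)
    also have "\<dots> = (LINT x|M. ?b j x * ?b k ((T ^^ l) x))"
      by (intro integral_iter) measurable
    finally have hit_eq: "(LINT x|M. hit j y x * hit k y x) = (LINT x|M. ?b j x * ?b k ((T ^^ l) x))" .
    have d1: "\<bar>(LINT x|M. ?b j x * ?b k ((T ^^ l) x)) - (LINT x|M. f j x * f k ((T ^^ l) x))\<bar> \<le> 2 * C0 / real n ^ 3"
    proof -
      have i1: "integrable M (\<lambda>x. ?b j x * ?b k ((T ^^ l) x))" by (rule integrable_bounded[of _ 1]) (measurable, auto simp: indicator_def)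
      have i2: "integrable M (\<lambda>x. f j x * f k ((T ^^ l) x))"
        by (rule integrable_bounded[of _ 1]) (measurable, use f01 in \<open>simp add: abs_mult mult_le_one\<close>)
      have i3: "integrable M (\<lambda>x. indicator (annulus y (r j) \<delta>) x + indicator (annulus y (r k) \<delta>) ((T ^^ l) x) :: real)"
        by (intro Bochner_Integration.integrable_add integrable_indicator_M integrable_iter annulus_sets)
      have "(LINT x|M. ?b j x * ?b k ((T ^^ l) x)) - (LINT x|M. f j x * f k ((T ^^ l) x)) = (LINT x|M. ?b j x * ?b k ((T ^^ l) x) - f j x * f k ((T ^^ l) x))"
        using i1 i2 by simp
      also have "\<bar>\<dots>\<bar> \<le> (LINT x|M. \<bar>?b j x * ?b k ((T ^^ l) x) - f j x * f k ((T ^^ l) x)\<bar>)" by (rule integral_abs_bound)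
      also have "\<dots> \<le> (LINT x|M. indicator (annulus y (r j) \<delta>) x + indicator (annulus y (r k) \<delta>) ((T ^^ l) x))"
      proof (rule integral_mono)
        fix x
        have "\<bar>?b j x * ?b k ((T ^^ l) x) - f j x * f k ((T ^^ l) x)\<bar> = \<bar>(?b j x - f j x) * ?b k ((T ^^ l) x) + f j x * (?b k ((T ^^ l) x) - f k ((T ^^ l) x))\<bar>"
          by (simp add: algebra_simps)
        also have "\<dots> \<le> \<bar>?b j x - f j x\<bar> * 1 + 1 * \<bar>?b k ((T ^^ l) x) - f k ((T ^^ l) x)\<bar>"
          using f01(3)[of j x]
          by (intro order_trans[OF abs_triangle_ineq] add_mono) (auto simp only: abs_mult intro!: mult_mono, auto simp: indicator_def)
        also have "\<dots> \<le> indicator (annulus y (r j) \<delta>) x + indicator (annulus y (r k) \<delta>) ((T ^^ l) x)"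
          using bf[of j x] bf[of k "(T ^^ l) x"] by simp
        finally show "\<bar>?b j x * ?b k ((T ^^ l) x) - f j x * f k ((T ^^ l) x)\<bar> \<le> indicator (annulus y (r j) \<delta>) x + indicator (annulus y (r k) \<delta>) ((T ^^ l) x)" .
      qed (use i1 i2 i3 in auto)
      also have "\<dots> = measure M (annulus y (r j) \<delta>) + measure M (annulus y (r k) \<delta>)"
      proof -
        have int: "integrable M (indicator (annulus y (r i) \<delta>) :: 'a \<Rightarrow> real)" for i
          by (intro integrable_indicator_M annulus_sets)
        have "(LINT x|M. indicator (annulus y (r k) \<delta>) ((T ^^ l) x)) = (LINT x|M. indicator (annulus y (r k) \<delta>) x :: real)"
          by (rule integral_iter) (rule borel_measurable_integrable[OF int])
        then show ?thesis
          by (subst Bochner_Integration.integral_add) (intro int integrable_iter, intro integrable_iter int, simp add: space_M)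
      qed
      also have "\<dots> \<le> 2 * C0 / real n ^ 3" using ann[OF jk(1,3)] ann[OF jk(2,4)] by simp
      finally show ?thesis .
    qed
    have d2: "\<bar>mass i y - (LINT x|M. f i x)\<bar> \<le> C0 / real n ^ 3" if i: "1 \<le> i" "i \<le> n" for i
    proof -
      have int: "integrable M (f i)" by (rule integrable_bounded[of _ 1]) (use f01 in auto)
      have "mass i y - (LINT x|M. f i x) = (LINT x|M. ?b i x - f i x)"
        using int integrable_indicator_M[OF ball_sets, of y "r i"] by (simp add: space_M)
      also have "\<bar>\<dots>\<bar> \<le> (LINT x|M. \<bar>?b i x - f i x\<bar>)" by (rule integral_abs_bound)
      also have "\<dots> \<le> (LINT x|M. indicator (annulus y (r i) \<delta>) x)"
        using int integrable_indicator_M[OF ball_sets, of y "r i"] by (intro integral_mono bf integrable_indicator_M annulus_sets) auto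
      also have "\<dots> \<le> C0 / real n ^ 3" using ann[OF i] by (simp add: space_M)
      finally show ?thesis .
    qed
    have d3: "\<bar>(LINT x|M. f j x * f k ((T ^^ l) x)) - (LINT x|M. f j x) * (LINT x|M. f k x)\<bar> \<le> 2 * B / real n ^ 3"
    proof -
      have "norm (Cov M (\<lambda>x. complex_of_real (f j x)) (\<lambda>x. \<Prod>i=l..l. complex_of_real (f k ((T ^^ i) x))))
          \<le> B * (1 + 1 / \<delta>) * real n ^ e * exp (- \<tau> * real l)"
        by (rule dec[of l l n "1 / \<delta>" "\<lambda>x. complex_of_real (f j x)" "\<lambda>_ z. complex_of_real (f k z)"])
          (use l(2) n \<delta> f01 fL in \<open>auto simp: lipschitz_test_def of_real_diff[symmetric] simp del: of_real_diff\<close>)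
      also have "Cov M (\<lambda>x. complex_of_real (f j x)) (\<lambda>x. \<Prod>i=l..l. complex_of_real (f k ((T ^^ i) x)))
        = complex_of_real ((LINT x|M. f j x * f k ((T ^^ l) x)) - (LINT x|M. f j x) * (LINT x|M. f k x))"
        using integral_iter[OF fm[of k], of l] by (simp add: Cov_def of_real_mult[symmetric] del: of_real_mult)
      also have "B * (1 + 1 / \<delta>) * real n ^ e * exp (- \<tau> * real l) \<le> B * (2 * real n ^ a) * real n ^ e * (1 / real n ^ E)"
      proof (intro mult_mono exp_log_le l(1) n B)
        show "1 + 1 / \<delta> \<le> 2 * real n ^ a" using one_le_power[OF n(1), of a] by (simp add: \<delta>_def)
      qed (use B \<delta> in auto)
      also have "\<dots> = 2 * B / real n ^ 3" using n by (simp add: E_def power_add field_simps)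
      finally show ?thesis by (simp only: norm_of_real)
    qed
    have d4: "\<bar>(LINT x|M. f j x) * (LINT x|M. f k x) - mass j y * mass k y\<bar> \<le> 2 * C0 / real n ^ 3"
    proof -
      let ?p = "LINT x|M. f j x" and ?q = "LINT x|M. f k x"
      have p: "\<bar>?p\<bar> \<le> 1" using norm_integral_le[of "f j" 1] f01 by simp
      have "\<bar>?p * ?q - mass j y * mass k y\<bar> = \<bar>?p * (?q - mass k y) + (?p - mass j y) * mass k y\<bar>" by (simp add: algebra_simps)
      also have "\<dots> \<le> 1 * \<bar>?q - mass k y\<bar> + \<bar>?p - mass j y\<bar> * 1"
        using p by (intro order_trans[OF abs_triangle_ineq] add_mono) (auto simp only: abs_mult intro!: mult_mono, auto)
      also have "\<dots> \<le> 2 * C0 / real n ^ 3" using d2[OF jk(1,3)] d2[OF jk(2,4)] by (simp add: abs_minus_commute)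
      finally show ?thesis .
    qed
    show "\<bar>(LINT x|M. hit j y x * hit k y x) - mass j y * mass k y\<bar> \<le> (4 * C0 + 2 * B) / real n ^ 3"
      using d1 d3 d4 unfolding hit_eq add_divide_distrib by linarith
  qed
qed

section \<open>Growth of the variance\<close>

text \<open>In the double sum of covariances, the diagonal contributes the sum of the target measures. Covariances at
  time distance less than \<open>N\<close> are bounded below by minus the product of the target measures, hence by minus half
  the sum of their squares, and each index has at most \<open>2 * N\<close> such partners. Covariances at larger time distance
  are of order \<open>n powr (- 3)\<close>.\<close>

lemma Var_target_sum_ge:
  obtains K C :: real where "0 \<le> K" "0 \<le> C"
    "\<And>n N y. 1 \<le> n \<Longrightarrow> 1 \<le> N \<Longrightarrow> K * ln (real n) \<le> real N \<Longrightarrow>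
       (\<Sum>k=1..n. mass k y * (1 - 2 * real N * mass k y)) - C / real n \<le> Var M (target_sum M T r y n)"
proof -
  obtain K C where KC: "0 \<le> K" "0 \<le> C" and far: "\<And>n j k y. 1 \<le> j \<Longrightarrow> 1 \<le> k \<Longrightarrow> j \<le> n \<Longrightarrow> k \<le> n \<Longrightarrow> real j + K * ln (real n) \<le> real k \<Longrightarrow>
      \<bar>(LINT x|M. hit j y x * hit k y x) - mass j y * mass k y\<bar> \<le> C / real n ^ 3"
    using far_hits_decorrelate by blast
  show thesis
  proof (rule that[of K C])
    show "0 \<le> K" "0 \<le> C" using KC by auto
    fix n N :: nat and y :: 'a
    assume n: "1 \<le> n" and N1: "1 \<le> N" and N: "K * ln (real n) \<le> real N"
    define P where "P j k = (LINT x|M. hit j y x * hit k y x) - mass j y * mass k y" for j k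
    \<comment> \<open>A lower bound for the covariance of the hits at times \<open>j\<close> and \<open>k\<close>, covering the diagonal, near and far pairs.\<close>
    define Q where "Q j k = (if j = k then mass k y else 0)
      - (if j < k + N \<and> k < j + N then ((mass j y)\<^sup>2 + (mass k y)\<^sup>2) / 2 else 0) - C / real n ^ 3" for j k
    have s0: "0 \<le> mass k y" for k by simp
    have am: "mass j y * mass k y \<le> ((mass j y)\<^sup>2 + (mass k y)\<^sup>2) / 2" for j k
      using sum_squares_bound[of "mass j y" "mass k y"] by simp
    have C3: "0 \<le> C / real n ^ 3" using KC by simp
    have "Q j k \<le> P j k" if jk: "j \<in> {1..n}" "k \<in> {1..n}" for j k
    proof -
      consider "j = k" | "j \<noteq> k" "j < k + N" "k < j + N" | "j + N \<le> k" "j \<noteq> k" | "k + N \<le> j" "j \<noteq> k" by linarith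
      then show ?thesis
      proof cases
        case 1
        have "(\<lambda>x. hit k y x * hit k y x) = hit k y" by (auto simp: indicator_def)
        then have "P j k = mass k y - mass k y * mass k y" using 1 integral_hit[of y k] by (simp add: P_def)
        then show ?thesis using 1 C3 N1 by (simp add: Q_def power2_eq_square)
      next
        case 2
        have "0 \<le> (LINT x|M. hit j y x * hit k y x)" by (intro Bochner_Integration.integral_nonneg) simp
        then have "- (((mass j y)\<^sup>2 + (mass k y)\<^sup>2) / 2) - C / real n ^ 3 \<le> P j k"
          unfolding P_def using C3 am[of j k] by linarith
        then show ?thesis using 2 by (simp add: Q_def)
      next
        case 3
        then have "real j + real N \<le> real k" by linarith
        then have "\<bar>P j k\<bar> \<le> C / real n ^ 3" unfolding P_def using jk N by (intro far) auto
        then show ?thesis using 3 by (simp add: Q_def)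
      next
        case 4
        then have "real k + real N \<le> real j" by linarith
        then have "\<bar>P k j\<bar> \<le> C / real n ^ 3" unfolding P_def using jk N by (intro far) auto
        moreover have "P k j = P j k" by (simp add: P_def mult.commute)
        ultimately show ?thesis using 4 by (simp add: Q_def)
      qed
    qed
    then have "(\<Sum>j=1..n. \<Sum>k=1..n. Q j k) \<le> (\<Sum>j=1..n. \<Sum>k=1..n. P j k)" by (intro sum_mono) auto
    also have "\<dots> = Var M (target_sum M T r y n)" by (simp add: Var_target_sum P_def)
    finally have V: "(\<Sum>j=1..n. \<Sum>k=1..n. Q j k) \<le> Var M (target_sum M T r y n)" .
    define R where "R j k = (if j < k + N \<and> k < j + N then (mass j y)\<^sup>2 / 2 else 0)" for j k
    have row: "(\<Sum>k=1..n. R j k) \<le> real N * (mass j y)\<^sup>2" for j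
    proof -
      let ?S = "{k\<in>{1..n}. j < k + N \<and> k < j + N}"
      have "?S \<subseteq> {j + 1 - N..<j + N}" using N1 by auto
      then have "card ?S \<le> card {j + 1 - N..<j + N}" by (intro card_mono) auto
      also have "\<dots> \<le> 2 * N" by simp
      finally have c: "real (card ?S) \<le> 2 * real N" by linarith
      have "(\<Sum>k=1..n. R j k) = (\<Sum>k\<in>?S. (mass j y)\<^sup>2 / 2)" unfolding R_def by (intro sum.mono_neutral_cong_right) auto
      also have "\<dots> = real (card ?S) * ((mass j y)\<^sup>2 / 2)" by simp
      also have "\<dots> \<le> 2 * real N * ((mass j y)\<^sup>2 / 2)" using c by (intro mult_right_mono) auto
      finally show ?thesis by simp
    qed
    show "(\<Sum>k=1..n. mass k y * (1 - 2 * real N * mass k y)) - C / real n \<le> Var M (target_sum M T r y n)"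
    proof -
      have "(\<Sum>j=1..n. \<Sum>k=1..n. Q j k) = (\<Sum>j=1..n. \<Sum>k=1..n. (if j = k then mass k y else 0) - (R j k + R k j) - C / real n ^ 3)"
        unfolding Q_def R_def by (intro sum.cong refl) (auto simp: field_simps)
      also have "\<dots> = (\<Sum>j=1..n. \<Sum>k=1..n. (if j = k then mass k y else 0)) - ((\<Sum>j=1..n. \<Sum>k=1..n. R j k) + (\<Sum>j=1..n. \<Sum>k=1..n. R k j)) - (\<Sum>j=1..n. \<Sum>k=1..n. C / real n ^ 3)"
        by (simp add: sum.distrib sum_subtractf)
      also have "(\<Sum>j=1..n. \<Sum>k=1..n. R k j) = (\<Sum>j=1..n. \<Sum>k=1..n. R j k)" by (rule sum.swap)
      also have "(\<Sum>j=1..n. \<Sum>k=1..n. (if j = k then mass k y else 0)) = (\<Sum>k=1..n. mass k y)" by simp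
      also have "(\<Sum>j=1..n. \<Sum>k=1..n. C / real n ^ 3) = C / real n" using n by (simp add: power3_eq_cube)
      finally have eq: "(\<Sum>j=1..n. \<Sum>k=1..n. Q j k) = (\<Sum>k=1..n. mass k y) - 2 * (\<Sum>j=1..n. \<Sum>k=1..n. R j k) - C / real n" by simp
      have "(\<Sum>j=1..n. \<Sum>k=1..n. R j k) \<le> (\<Sum>j=1..n. real N * (mass j y)\<^sup>2)" by (intro sum_mono row N1)
      moreover have "(\<Sum>k=1..n. mass k y * (1 - 2 * real N * mass k y)) = (\<Sum>k=1..n. mass k y) - 2 * (\<Sum>j=1..n. real N * (mass j y)\<^sup>2)"
        by (simp add: sum_subtractf[symmetric] sum_distrib_left algebra_simps power2_eq_square)
      ultimately show ?thesis using V eq by linarith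
    qed
  qed
qed

text \<open>In the lower bound above, \<open>N\<close> is of order \<open>ln n\<close>. For \<open>k\<close> beyond a small power \<open>n powr \<theta>\<close>, target measures are
  \<open>o (1 / ln n)\<close>, so that at least half of each of them survives, and their sum is of order
  \<open>n powr (1 - a)\<close>; the earlier terms cost at most \<open>n powr \<theta> * ln n\<close>.\<close>

lemma Var_target_sum_growth:
  obtains c \<epsilon> :: real where "0 < c" "0 < \<epsilon>"
    "eventually (\<lambda>n. \<forall>y. c * real n powr \<epsilon> \<le> Var M (target_sum M T r y n)) sequentially"
proof -
  obtain K C where KC: "0 \<le> K" "0 \<le> C" and V: "\<And>n N y. 1 \<le> n \<Longrightarrow> 1 \<le> N \<Longrightarrow> K * ln (real n) \<le> real N \<Longrightarrow>
       (\<Sum>k=1..n. mass k y * (1 - 2 * real N * mass k y)) - C / real n \<le> Var M (target_sum M T r y n)"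
    using Var_target_sum_ge by blast
  obtain c a where c: "0 < c" "0 \<le> a" "a < 1" and low: "\<And>k y. 1 \<le> k \<Longrightarrow> c * real k powr (- a) \<le> mass k y"
    using target_lower by blast
  obtain \<kappa> C1 where \<kappa>: "1 < \<kappa>" "0 < C1" and up: "\<And>k y. 2 \<le> k \<Longrightarrow> mass k y \<le> C1 * ln (real k) powr (- \<kappa>)"
    using target_upper by blast
  \<comment> \<open>The growth exponent \<open>1 - a\<close> is \<open>2 * \<theta>\<close>, so \<open>n powr \<theta>\<close> early terms are negligible even with a factor \<open>ln n\<close>.\<close>
  define \<theta> where "\<theta> = (1 - a) / 2"
  have \<theta>: "0 < \<theta>" using c by (simp add: \<theta>_def)
  have l1: "eventually (\<lambda>n. 2 * ((K + 2) * ln (real n)) * (C1 * (\<theta> * ln (real n)) powr (- \<kappa>)) < 1 / 2) sequentially"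
  proof (rule order_tendstoD(2))
    show "(\<lambda>n. 2 * ((K + 2) * ln (real n)) * (C1 * (\<theta> * ln (real n)) powr (- \<kappa>))) \<longlonglongrightarrow> 0"
      using \<theta> \<kappa> KC by real_asymp
  qed simp
  have l2: "eventually (\<lambda>n. 2 < real n powr \<theta>) sequentially"
  proof -
    have "filterlim (\<lambda>n. real n powr \<theta>) at_top sequentially" using \<theta> by real_asymp
    then show ?thesis by (simp add: filterlim_at_top_dense)
  qed
  have l3: "eventually (\<lambda>n. (c / 2 + 2 * ((K + 2) * ln (real n))) * real n powr \<theta> + C < c / 4 * real n powr (2 * \<theta>)) sequentially"
  proof -
    have "(\<lambda>n. (c / 2 + 2 * ((K + 2) * ln (real n))) * real n powr (- \<theta>) + C * real n powr (- 2 * \<theta>)) \<longlonglongrightarrow> 0"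
      using \<theta> by real_asymp
    then have "eventually (\<lambda>n. (c / 2 + 2 * ((K + 2) * ln (real n))) * real n powr (- \<theta>) + C * real n powr (- 2 * \<theta>) < c / 4) sequentially"
      using c by (intro order_tendstoD(2)) auto
    then show ?thesis using eventually_ge_at_top[of 1]
    proof eventually_elim
      case (elim n)
      have n: "0 < real n" using elim by simp
      have "((c / 2 + 2 * ((K + 2) * ln (real n))) * real n powr (- \<theta>) + C * real n powr (- 2 * \<theta>)) * real n powr (2 * \<theta>) < c / 4 * real n powr (2 * \<theta>)"
        using elim n by (intro mult_strict_right_mono) auto
      moreover have "real n powr (- \<theta>) * real n powr (2 * \<theta>) = real n powr \<theta>" "real n powr (- 2 * \<theta>) * real n powr (2 * \<theta>) = 1"
        using n by (simp_all add: powr_add[symmetric])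
      ultimately show ?case by (simp only: distrib_right mult.assoc mult_1_right)
    qed
  qed
  show thesis
  proof (rule that[of "c / 4" "2 * \<theta>"])
    show "0 < c / 4" "0 < 2 * \<theta>" using c \<theta> by auto
    show "eventually (\<lambda>n. \<forall>y. c / 4 * real n powr (2 * \<theta>) \<le> Var M (target_sum M T r y n)) sequentially"
      using l1 l2 l3 eventually_ge_at_top[of 3]
    proof eventually_elim
      case (elim n)
      define N where "N = nat \<lceil>K * ln (real n)\<rceil> + 1"
      have n: "3 \<le> real n" using elim(4) by simp
      have ln1: "1 \<le> ln (real n)" using n exp_le by (subst ln_ge_iff) auto
      have "0 \<le> K * ln (real n)" using KC ln1 by simp
      then have N: "1 \<le> N" "K * ln (real n) \<le> real N" "real N \<le> K * ln (real n) + 2"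
        unfolding N_def by linarith+
      have N2: "real N \<le> (K + 2) * ln (real n)" using N(3) ln1 by (simp add: distrib_right)
      let ?w = "c / 2 * real n powr (- a)" and ?u = "c / 2 + 2 * ((K + 2) * ln (real n))"
      let ?J = "{k \<in> {1..n}. real k < real n powr \<theta>}"
      have u0: "0 \<le> ?u" using c KC ln1 by simp
      show ?case
      proof
        fix y
        have summand: "?w - (if real k < real n powr \<theta> then ?u else 0) \<le> mass k y * (1 - 2 * real N * mass k y)" if k: "k \<in> {1..n}" for k
        proof (cases "real k < real n powr \<theta>")
          case True
          have s: "0 \<le> mass k y" "mass k y \<le> 1" by auto
          have "mass k y * mass k y \<le> 1 * 1" using s by (intro mult_mono) auto
          then have "2 * real N * (mass k y * mass k y) \<le> 2 * real N * 1" by (intro mult_left_mono) auto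
          moreover have "mass k y * (1 - 2 * real N * mass k y) = mass k y - 2 * real N * (mass k y * mass k y)" by (simp add: algebra_simps)
          ultimately have "- (2 * real N) \<le> mass k y * (1 - 2 * real N * mass k y)" using s by linarith
          moreover have "?w \<le> c / 2" using c n powr_mono[of "- a" 0 "real n"] by simp
          ultimately show ?thesis using True N2 by simp
        next
          case False
          have k2: "2 \<le> k" using False elim(2) by linarith
          have "\<theta> * ln (real n) = ln (real n powr \<theta>)" using n by (simp add: ln_powr)
          also have "\<dots> \<le> ln (real k)" using False k2 n by (intro ln_mono) auto
          finally have lnk: "\<theta> * ln (real n) \<le> ln (real k)" .
          have pos: "0 < \<theta> * ln (real n)" using \<theta> ln1 by simp
          have "mass k y \<le> C1 * ln (real k) powr (- \<kappa>)" by (rule up[OF k2])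
          also have "\<dots> \<le> C1 * (\<theta> * ln (real n)) powr (- \<kappa>)"
            using \<kappa> pos lnk by (intro mult_left_mono powr_mono2') auto
          finally have "2 * real N * mass k y \<le> 2 * ((K + 2) * ln (real n)) * (C1 * (\<theta> * ln (real n)) powr (- \<kappa>))"
            using N2 by (intro mult_mono) auto
          then have half: "1 / 2 \<le> 1 - 2 * real N * mass k y" using elim(1) by linarith
          have "real n powr (- a) \<le> real k powr (- a)" using k c by (intro powr_mono2') auto
          then have "c * real n powr (- a) \<le> c * real k powr (- a)" using c by (intro mult_left_mono) auto
          also have "\<dots> \<le> mass k y" using k by (intro low) auto
          finally have "c * real n powr (- a) \<le> mass k y" .
          then have "c * real n powr (- a) * (1 / 2) \<le> mass k y * (1 - 2 * real N * mass k y)"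
            using half c by (intro mult_mono) auto
          then show ?thesis using False by simp
        qed
        have cJ: "real (card ?J) \<le> real n powr \<theta>"
        proof -
          have "?J \<subseteq> {1..nat \<lfloor>real n powr \<theta>\<rfloor>}" by (auto simp: le_nat_floor)
          then have "card ?J \<le> card {1..nat \<lfloor>real n powr \<theta>\<rfloor>}" by (intro card_mono) auto
          also have "\<dots> = nat \<lfloor>real n powr \<theta>\<rfloor>" by simp
          finally have "real (card ?J) \<le> real (nat \<lfloor>real n powr \<theta>\<rfloor>)" by (simp only: of_nat_le_iff)
          also have "\<dots> \<le> real n powr \<theta>" by (simp add: of_nat_nat)
          finally show ?thesis .
        qed
        have "real n * ?w - real (card ?J) * ?u = (\<Sum>k=1..n. ?w - (if real k < real n powr \<theta> then ?u else 0))"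
          by (simp add: sum_subtractf sum.If_cases Int_def conj_commute)
        also have "\<dots> \<le> (\<Sum>k=1..n. mass k y * (1 - 2 * real N * mass k y))" by (intro sum_mono summand)
        finally have S: "real n * ?w - real (card ?J) * ?u \<le> (\<Sum>k=1..n. mass k y * (1 - 2 * real N * mass k y))" .
        have "real (card ?J) * ?u \<le> ?u * real n powr \<theta>" using mult_right_mono[OF cJ u0] by (simp only: mult.commute)
        moreover have "real n * ?w = c / 2 * real n powr (2 * \<theta>)"
        proof -
          have "real n * real n powr (- a) = real n powr 1 * real n powr (- a)" using n by simp
          also have "\<dots> = real n powr (1 + - a)" by (simp only: powr_add)
          also have "1 + - a = 2 * \<theta>" by (simp add: \<theta>_def)
          finally show ?thesis by simp
        qed
        moreover have "C / real n \<le> C" using KC n divide_left_mono[of 1 "real n" C] by simp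
        moreover have "(\<Sum>k=1..n. mass k y * (1 - 2 * real N * mass k y)) - C / real n \<le> Var M (target_sum M T r y n)"
          using elim(4) N by (intro V) auto
        ultimately show "c / 4 * real n powr (2 * \<theta>) \<le> Var M (target_sum M T r y n)"
          using S elim(3) by linarith
      qed
    qed
  qed
qed

end

section \<open>The characteristic function of the recurrence sums\<close>

lemma norm_iexp_diff_le: "norm (iexp a - iexp b) \<le> \<bar>a - b\<bar>"
proof -
  have "iexp a - iexp b = iexp b * (iexp (a - b) - 1)"
    by (simp add: right_diff_distrib exp_add[symmetric])
  then have "norm (iexp a - iexp b) = norm (iexp (a - b) - 1)" by (simp add: norm_mult)
  also have "\<dots> \<le> \<bar>a - b\<bar>" using iexp_approx1[of "a - b" 0] by simp
  finally show ?thesis .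
qed

context shrinking_targets
begin

lemma hit_measurable_pair:
  assumes "f \<in> measurable K M" "g \<in> measurable K M"
  shows "(\<lambda>w. hit k (f w) (g w)) \<in> borel_measurable K"
proof -
  have "(\<lambda>w. dist (f w) ((T ^^ k) (g w))) \<in> borel_measurable K"
    by (intro measurable_dist_M assms measurable_compose[OF assms(2) measurable_iter])
  then have "(\<lambda>w. indicator {..<r k} (dist (f w) ((T ^^ k) (g w))) :: real) \<in> borel_measurable K" by measurable
  then show ?thesis by (simp add: indicator_def)
qed

lemma mass_measurable: "mass k \<in> borel_measurable M"
proof -
  have "(\<lambda>y. LINT x|M. hit k y x) \<in> borel_measurable M"
    by (rule borel_measurable_lebesgue_integral, unfold case_prod_beta, intro hit_measurable_pair) auto
  then show ?thesis by (simp only: integral_hit)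
qed

lemma target_sum_measurable_pair:
  assumes "f \<in> measurable K M" "g \<in> measurable K M"
  shows "(\<lambda>w. target_sum M T r (f w) n (g w)) \<in> borel_measurable K"
  unfolding target_sum_def
  by (intro borel_measurable_sum borel_measurable_diff hit_measurable_pair assms measurable_compose[OF assms(1) mass_measurable])

text \<open>Drop the terms before time \<open>N\<close> and replace the indicators by ramps in the others.\<close>

lemma characteristic_approximation:
  fixes \<omega> :: real and N n :: nat and \<delta> e :: real and y x :: 'a
  defines "f \<equiv> \<lambda>k y z. ramp \<delta> (r k) (dist y z)"
  assumes \<delta>: "0 < \<delta>" and N: "1 \<le> N" "N \<le> n"
    and ann: "\<And>k. k \<in> {N..n} \<Longrightarrow> measure M (annulus y (r k) \<delta>) \<le> e"
  shows "norm (iexp (\<omega> * target_sum M T r y n x) - (\<Prod>k=N..n. iexp (\<omega> * (f k y ((T ^^ k) x) - (LINT z|M. f k y z)))))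
     \<le> \<bar>\<omega>\<bar> * (real N + (\<Sum>k=N..n. indicator (annulus y (r k) \<delta>) ((T ^^ k) x)) + real n * e)"
proof -
  have fL: "\<bar>f i y z - f i y w\<bar> \<le> 1 / \<delta> * dist z w" for i z w
  proof -
    have "\<bar>f i y z - f i y w\<bar> \<le> \<bar>dist y z - dist y w\<bar> / \<delta>" unfolding f_def by (rule ramp_lipschitz[OF \<delta>])
    also have "\<dots> \<le> 1 / \<delta> * dist z w" using \<delta> abs_dist_diff_le[of y z y w] by (simp add: divide_right_mono)
    finally show ?thesis .
  qed
  have fm: "f i y \<in> borel_measurable M" for i
    by (rule borel_measurable_lipschitz[of _ "1 / \<delta>"]) (use fL in simp)
  have fi: "integrable M (f i y)" for i
    by (rule integrable_bounded[of _ 1]) (use ramp_range fm in \<open>auto simp: f_def\<close>)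
  have bf: "\<bar>indicator (ball y (r i)) z - f i y z\<bar> \<le> indicator (annulus y (r i) \<delta>) z" for i z
    unfolding f_def by (rule indicator_minus_ramp[OF \<delta>])
  have e0: "0 \<le> e" using order_trans[OF measure_nonneg ann[of N]] N by simp
  have c: "\<bar>mass k y - (LINT z|M. f k y z)\<bar> \<le> e" if k: "k \<in> {N..n}" for k
  proof -
    have "mass k y - (LINT z|M. f k y z) = (LINT z|M. indicator (ball y (r k)) z - f k y z)"
      using fi integrable_indicator_M[OF ball_sets, of y "r k"] by (simp add: space_M)
    also have "\<bar>\<dots>\<bar> \<le> (LINT z|M. \<bar>indicator (ball y (r k)) z - f k y z\<bar>)" by (rule integral_abs_bound)
    also have "\<dots> \<le> (LINT z|M. indicator (annulus y (r k) \<delta>) z)"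
      using fi integrable_indicator_M[OF ball_sets, of y "r k"] by (intro integral_mono bf integrable_indicator_M annulus_sets) auto
    also have "\<dots> \<le> e" using ann[OF k] by (simp add: space_M)
    finally show ?thesis .
  qed
  let ?S = "\<Sum>k=N..n. f k y ((T ^^ k) x) - (LINT z|M. f k y z)"
  have prod: "(\<Prod>k=N..n. iexp (\<omega> * (f k y ((T ^^ k) x) - (LINT z|M. f k y z)))) = iexp (\<omega> * ?S)"
    by (simp add: exp_sum[symmetric] sum_distrib_left)
  have split: "target_sum M T r y n x = (\<Sum>k=1..<N. hit k y x - mass k y) + (\<Sum>k=N..n. hit k y x - mass k y)"
  proof -
    have "{1..n} = {1..<N} \<union> {N..n}" using N by auto
    then show ?thesis unfolding target_sum_def by (subst sum.union_disjoint[symmetric]) auto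
  qed
  have "\<bar>\<Sum>k=1..<N. hit k y x - mass k y\<bar> \<le> (\<Sum>k=1..<N. 1)"
  proof (rule order_trans[OF sum_abs], rule sum_mono)
    fix k
    have "0 \<le> mass k y" "mass k y \<le> 1" by auto
    then show "\<bar>hit k y x - mass k y\<bar> \<le> 1" unfolding indicator_def by auto
  qed
  then have head: "\<bar>\<Sum>k=1..<N. hit k y x - mass k y\<bar> \<le> real N" by simp
  have "\<bar>(\<Sum>k=N..n. hit k y x - mass k y) - ?S\<bar> \<le> (\<Sum>k=N..n. indicator (annulus y (r k) \<delta>) ((T ^^ k) x) + e)"
    unfolding sum_subtractf[symmetric]
  proof (rule order_trans[OF sum_abs], rule sum_mono)
    fix k assume k: "k \<in> {N..n}"
    show "\<bar>hit k y x - mass k y - (f k y ((T ^^ k) x) - (LINT z|M. f k y z))\<bar> \<le> indicator (annulus y (r k) \<delta>) ((T ^^ k) x) + e"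
      using bf[of k "(T ^^ k) x"] c[OF k] by linarith
  qed
  also have "\<dots> \<le> (\<Sum>k=N..n. indicator (annulus y (r k) \<delta>) ((T ^^ k) x)) + real n * e"
    using N e0 by (auto simp: sum.distrib intro!: mult_right_mono)
  finally have tail: "\<bar>(\<Sum>k=N..n. hit k y x - mass k y) - ?S\<bar> \<le> (\<Sum>k=N..n. indicator (annulus y (r k) \<delta>) ((T ^^ k) x)) + real n * e" .
  have "norm (iexp (\<omega> * target_sum M T r y n x) - iexp (\<omega> * ?S)) \<le> \<bar>\<omega> * target_sum M T r y n x - \<omega> * ?S\<bar>"
    by (rule norm_iexp_diff_le)
  also have "\<dots> = \<bar>\<omega>\<bar> * \<bar>target_sum M T r y n x - ?S\<bar>" by (simp add: abs_mult[symmetric] right_diff_distrib)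
  also have "\<dots> \<le> \<bar>\<omega>\<bar> * (real N + (\<Sum>k=N..n. indicator (annulus y (r k) \<delta>) ((T ^^ k) x)) + real n * e)"
    using head tail unfolding split by (intro mult_left_mono) linarith+
  finally show ?thesis unfolding prod .
qed

text \<open>The normalised sums lose nothing if the terms before a time \<open>N\<close> of order \<open>ln n\<close> are dropped, since \<open>\<sigma>\<close> grows
  faster. The remaining exponential is a product of kernels, which decouple after smoothing.\<close>

lemma characteristic_decoupling:
  fixes \<sigma> :: "nat \<Rightarrow> real" and t :: real
  assumes \<sigma>: "(\<lambda>n. ln (real n) / \<sigma> n) \<longlonglongrightarrow> 0" "eventually (\<lambda>n. 1 \<le> \<sigma> n) sequentially"
  shows "(\<lambda>n. (CLINT x|M. iexp (t / \<sigma> n * target_sum M T r x n x)) -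
              (CLINT y|M. CLINT x|M. iexp (t / \<sigma> n * target_sum M T r y n x))) \<longlonglongrightarrow> 0"
proof -
  obtain a C0 where C0: "0 \<le> C0" and small: "\<And>n k y r'. 1 \<le> k \<Longrightarrow> k \<le> n \<Longrightarrow> r k \<le> r' \<Longrightarrow> measure M (annulus y r' (3 * (1 / real n ^ a))) \<le> C0 / real n ^ 3"
    by (rule annuli_small) (rule that, assumption+)
  obtain K1 C1 where C1: "0 \<le> K1" "0 \<le> C1" and diag: "\<And>n k. 1 \<le> k \<Longrightarrow> k \<le> n \<Longrightarrow> K1 * ln (real n) \<le> real k \<Longrightarrow>
       measure M {x. (T ^^ k) x \<in> annulus x (r k) (1 / real n ^ a)} \<le> C1 / real n ^ 3"
    by (rule diagonal_annuli_small[OF C0 small]) (assumption+, rule that, assumption+)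
  obtain K2 C2 where C2: "0 \<le> K2" "0 \<le> C2" and dec: "\<And>N n' n L (G :: nat \<Rightarrow> 'a \<Rightarrow> 'a \<Rightarrow> complex). N \<le> n' \<Longrightarrow> n' \<le> n \<Longrightarrow> 1 \<le> n \<Longrightarrow> K2 * ln (real n) \<le> real N \<Longrightarrow>
      0 \<le> L \<Longrightarrow> L \<le> real n ^ (a + 1) \<Longrightarrow> (\<And>k. lipschitz_kernel L (G k)) \<Longrightarrow>
      decoupling_error N n' G \<le> C2 / real n ^ 3"
    using decoupling_polynomial[of "a + 1"] by blast
  define K where "K = max K1 K2"
  have K: "0 \<le> K" "K1 \<le> K" "K2 \<le> K" using C1 by (auto simp: K_def)
  define D where "D = 2 * \<bar>t\<bar> * (K + 2 + 2 * (C0 + C1))"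
  have evN: "eventually (\<lambda>n. K * ln (real n) + 2 < real n) sequentially"
  proof -
    have "(\<lambda>n. (K * ln (real n) + 2) / real n) \<longlonglongrightarrow> 0" by real_asymp
    then have "eventually (\<lambda>n. (K * ln (real n) + 2) / real n < 1) sequentially" by (rule order_tendstoD) simp
    then show ?thesis using eventually_gt_at_top[of 0] by eventually_elim (simp add: field_simps)
  qed
  have evt: "eventually (\<lambda>n. 2 * \<bar>t\<bar> \<le> real n) sequentially" by real_asymp
  have lim: "(\<lambda>n. D * (ln (real n) / \<sigma> n) + C2 / real n ^ 3) \<longlonglongrightarrow> 0"
  proof -
    have "(\<lambda>n. C2 / real n ^ 3) \<longlonglongrightarrow> 0" by real_asymp
    from tendsto_add[OF tendsto_mult_right_zero[OF \<sigma>(1), of D] this] show ?thesis by simp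
  qed
  show ?thesis
  proof (rule Lim_null_comparison[OF _ lim])
    show "eventually (\<lambda>n. norm ((CLINT x|M. iexp (t / \<sigma> n * target_sum M T r x n x)) -
              (CLINT y|M. CLINT x|M. iexp (t / \<sigma> n * target_sum M T r y n x))) \<le> D * (ln (real n) / \<sigma> n) + C2 / real n ^ 3) sequentially"
      using \<sigma>(2) evN evt eventually_ge_at_top[of 3]
    proof eventually_elim
      case (elim n)
      have n: "3 \<le> real n" "1 \<le> n" "1 \<le> real n" using elim(4) by auto
      have ln1: "1 \<le> ln (real n)" using n exp_le by (subst ln_ge_iff) auto
      define N where "N = nat \<lceil>K * ln (real n)\<rceil> + 1"
      have Kln: "0 \<le> K * ln (real n)" using K ln1 by simp
      then have N: "1 \<le> N" "K * ln (real n) \<le> real N" "real N \<le> K * ln (real n) + 2"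
        unfolding N_def by linarith+
      have Nn: "N \<le> n" using N(3) elim(2) by linarith
      have N1: "K1 * ln (real n) \<le> real N" "K2 * ln (real n) \<le> real N"
        using mult_right_mono[OF K(2), of "ln (real n)"] mult_right_mono[OF K(3), of "ln (real n)"] N(2) ln1 by linarith+
      have N2: "real N \<le> (K + 2) * ln (real n)" using N(3) ln1 by (simp add: distrib_right)
      define \<delta> where "\<delta> = 1 / real n ^ a"
      have \<delta>: "0 < \<delta>" using n by (simp add: \<delta>_def)
      define \<mu> where "\<mu> = t / \<sigma> n"
      have \<mu>: "\<bar>\<mu>\<bar> \<le> \<bar>t\<bar>" "\<bar>\<mu>\<bar> = \<bar>t\<bar> / \<sigma> n" using elim(1) by (auto simp: \<mu>_def abs_divide divide_le_eq mult_left_le mult_le_cancel_left1)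
      define f where "f k y z = ramp \<delta> (r k) (dist y z)" for k and y z :: 'a
      define b where "b k y = (LINT z|M. f k y z)" for k and y :: 'a
      define G where "G k y z = iexp (\<mu> * (f k y z - b k y))" for k and y z :: 'a
      have fm: "(\<lambda>w. f k (u w) (v w)) \<in> borel_measurable M'" if "u \<in> measurable M' M" "v \<in> measurable M' M" for k u v and M' :: "'k measure"
        unfolding f_def using measurable_dist_M[OF that] by measurable
      have fL: "\<bar>f k y z - f k y' z'\<bar> \<le> 1 / \<delta> * (dist y y' + dist z z')" for k y z y' z'
      proof -
        have "\<bar>f k y z - f k y' z'\<bar> \<le> \<bar>dist y z - dist y' z'\<bar> / \<delta>" unfolding f_def by (rule ramp_lipschitz[OF \<delta>])
        also have "\<dots> \<le> 1 / \<delta> * (dist y y' + dist z z')" using \<delta> abs_dist_diff_le[of y z y' z'] by (simp add: divide_right_mono)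
        finally show ?thesis .
      qed
      have f1: "norm (f k y z) \<le> 1" for k y z using ramp_range[of \<delta> "r k" "dist y z"] by (simp add: f_def)
      have fi: "integrable M (f k y)" for k y
      proof (rule integrable_bounded[of "f k y" 1])
        show "f k y \<in> borel_measurable M" by (rule fm) (auto simp: space_M)
      qed (rule f1)
      have bL: "\<bar>b k y - b k y'\<bar> \<le> 1 / \<delta> * dist y y'" for k y y'
      proof -
        have "b k y - b k y' = (LINT z|M. f k y z - f k y' z)" using fi by (simp add: b_def)
        moreover have "norm (LINT z|M. f k y z - f k y' z) \<le> 1 / \<delta> * dist y y'"
        proof (rule norm_integral_le)
          show "norm (f k y z - f k y' z) \<le> 1 / \<delta> * dist y y'" for z using fL[of k y z y' z] by simp
        qed (use fi in auto)
        ultimately show ?thesis by simp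
      qed
      have bm: "b k \<in> borel_measurable M" for k
        by (rule borel_measurable_lipschitz[of _ "1 / \<delta>"]) (use bL in simp)
      have Gm: "(\<lambda>w. G k (u w) (v w)) \<in> borel_measurable M'" if "u \<in> measurable M' M" "v \<in> measurable M' M" for k u v and M' :: "'k measure"
      proof -
        note [measurable] = fm[OF that] measurable_compose[OF that(1) bm]
        show ?thesis unfolding G_def by measurable
      qed
      have G1: "norm (G k y z) \<le> 1" for k y z by (simp add: G_def)
      have main: "decoupling_error N n G \<le> C2 / real n ^ 3"
      proof (rule dec[of N n n "\<bar>\<mu>\<bar> * (2 / \<delta>)" G, OF Nn order_refl n(2) N1(2)])
        show "0 \<le> \<bar>\<mu>\<bar> * (2 / \<delta>)" using \<delta> by simp
        have "\<bar>\<mu>\<bar> * (2 / \<delta>) = (2 * \<bar>\<mu>\<bar>) * real n ^ a" by (simp add: \<delta>_def)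
        also have "\<dots> \<le> real n * real n ^ a" using \<mu>(1) elim(3) by (intro mult_right_mono) auto
        finally show "\<bar>\<mu>\<bar> * (2 / \<delta>) \<le> real n ^ (a + 1)" by simp
        show "lipschitz_kernel (\<bar>\<mu>\<bar> * (2 / \<delta>)) (G k)" for k
          unfolding lipschitz_kernel_def
        proof (intro conjI allI)
          show "norm (G k y z) \<le> 1" for y z by (rule G1)
          show "(\<lambda>(y, z). G k y z) \<in> borel_measurable (M \<Otimes>\<^sub>M M)"
            unfolding case_prod_beta by (intro Gm) auto
          show "norm (G k y z - G k y' z') \<le> \<bar>\<mu>\<bar> * (2 / \<delta>) * (dist y y' + dist z z')" for y y' z z'
          proof -
            have "norm (G k y z - G k y' z') \<le> \<bar>\<mu> * (f k y z - b k y) - \<mu> * (f k y' z' - b k y')\<bar>"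
              unfolding G_def by (rule norm_iexp_diff_le)
            also have "\<dots> = \<bar>\<mu>\<bar> * \<bar>(f k y z - f k y' z') - (b k y - b k y')\<bar>"
              by (simp add: abs_mult[symmetric] algebra_simps)
            also have "\<dots> \<le> \<bar>\<mu>\<bar> * (1 / \<delta> * (dist y y' + dist z z') + 1 / \<delta> * (dist y y' + dist z z'))"
            proof (rule mult_left_mono)
              have "1 / \<delta> * dist y y' \<le> 1 / \<delta> * (dist y y' + dist z z')" using \<delta> by (intro mult_left_mono) auto
              then show "\<bar>(f k y z - f k y' z') - (b k y - b k y')\<bar> \<le> 1 / \<delta> * (dist y y' + dist z z') + 1 / \<delta> * (dist y y' + dist z z')"
                using fL[of k y z y' z'] bL[of k y y'] by linarith
            qed simp
            finally show ?thesis by (simp add: mult.assoc)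
          qed
        qed
      qed
      define \<Phi> where "\<Phi> y x = iexp (\<mu> * target_sum M T r y n x)" for y x
      define \<Psi> where "\<Psi> y x = (\<Prod>k=N..n. G k y ((T ^^ k) x))" for y x
      define E where "E y x = (\<Sum>k=N..n. indicator (annulus y (r k) \<delta>) ((T ^^ k) x) :: real)" for y x
      note [measurable] = measurable_iter
      have \<Phi>m: "(\<lambda>w. \<Phi> (u w) (v w)) \<in> borel_measurable M'" if "u \<in> measurable M' M" "v \<in> measurable M' M" for u v and M' :: "'k measure"
      proof -
        note [measurable] = target_sum_measurable_pair[OF that]
        show ?thesis unfolding \<Phi>_def by measurable
      qed
      have \<Psi>m: "(\<lambda>w. \<Psi> (u w) (v w)) \<in> borel_measurable M'" if "u \<in> measurable M' M" "v \<in> measurable M' M" for u v and M' :: "'k measure"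
        unfolding \<Psi>_def by (intro borel_measurable_prod Gm that measurable_compose[OF that(2) measurable_iter])
      have \<Phi>1: "norm (\<Phi> y x) \<le> 1" for y x by (simp add: \<Phi>_def)
      have \<Psi>1: "norm (\<Psi> y x) \<le> 1" for y x unfolding \<Psi>_def by (intro norm_prod_le_one G1)
      have ann: "measure M (annulus y (r k) \<delta>) \<le> C0 / real n ^ 3" if "k \<in> {N..n}" for y k
      proof -
        have "measure M (annulus y (r k) \<delta>) \<le> measure M (annulus y (r k) (3 * \<delta>))"
          using \<delta> by (intro finite_measure_mono annulus_mono) auto
        also have "\<dots> \<le> C0 / real n ^ 3" unfolding \<delta>_def using that N(1) by (intro small[of k n "r k"]) auto
        finally show ?thesis .
      qed
      let ?e = "real n * (C0 / real n ^ 3)"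
      have approx: "norm (\<Phi> y x - \<Psi> y x) \<le> \<bar>\<mu>\<bar> * (real N + E y x + ?e)" for y x
        unfolding \<Phi>_def \<Psi>_def E_def G_def b_def f_def
        by (rule characteristic_approximation[OF \<delta> N(1) Nn ann])
      \<comment> \<open>Stated for a map \<open>u\<close>, this covers the diagonal (\<open>u\<close> the identity) and fixed targets (\<open>u\<close> constant).\<close>
      have cmp: "norm ((LINT x|M. \<Phi> (u x) x) - (LINT x|M. \<Psi> (u x) x)) \<le> \<bar>\<mu>\<bar> * (real N + real n * (C / real n ^ 3) + ?e)"
        if u: "u \<in> measurable M M" and hitann: "\<And>k. k \<in> {N..n} \<Longrightarrow> measure M {x. (T ^^ k) x \<in> annulus (u x) (r k) \<delta>} \<le> C / real n ^ 3"
          and C: "0 \<le> C" for u C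
      proof -
        have sm: "{x. (T ^^ k) x \<in> annulus (u x) (r k) \<delta>} \<in> sets M" for k
        proof -
          have "(\<lambda>x. dist (u x) ((T ^^ k) x)) \<in> borel_measurable M" by (intro measurable_dist_M u) auto
          then have "{x \<in> space M. r k - \<delta> \<le> dist (u x) ((T ^^ k) x) \<and> dist (u x) ((T ^^ k) x) < r k} \<in> sets M" by measurable
          then show ?thesis by (simp add: space_M)
        qed
        have Eeq: "E (u x) x = (\<Sum>k=N..n. indicator {x. (T ^^ k) x \<in> annulus (u x) (r k) \<delta>} x)" for x
          by (simp add: E_def indicator_def)
        have Ei: "integrable M (\<lambda>x. E (u x) x)" unfolding Eeq by (intro Bochner_Integration.integrable_sum integrable_indicator_M sm)
        have Eint: "(LINT x|M. E (u x) x) \<le> real n * (C / real n ^ 3)"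
        proof -
          have "(LINT x|M. E (u x) x) = (\<Sum>k=N..n. measure M {x. (T ^^ k) x \<in> annulus (u x) (r k) \<delta>})"
            unfolding Eeq using integrable_indicator_M[OF sm] by (subst Bochner_Integration.integral_sum) (auto simp: space_M)
          also have "\<dots> \<le> (\<Sum>k=N..n. C / real n ^ 3)" by (intro sum_mono hitann)
          also have "\<dots> = real (Suc n - N) * (C / real n ^ 3)" by simp
          also have "\<dots> \<le> real n * (C / real n ^ 3)" using N C by (intro mult_right_mono) auto
          finally show ?thesis .
        qed
        have i\<Phi>: "integrable M (\<lambda>x. \<Phi> (u x) x)" "integrable M (\<lambda>x. \<Psi> (u x) x)"
          by (rule integrable_bounded[OF \<Phi>m \<Phi>1], use u in auto, rule integrable_bounded[OF \<Psi>m \<Psi>1], use u in auto)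
        have "norm ((LINT x|M. \<Phi> (u x) x) - (LINT x|M. \<Psi> (u x) x)) = norm (LINT x|M. \<Phi> (u x) x - \<Psi> (u x) x)"
          using i\<Phi> by simp
        also have "\<dots> \<le> (LINT x|M. norm (\<Phi> (u x) x - \<Psi> (u x) x))" by (rule integral_norm_bound)
        also have "\<dots> \<le> (LINT x|M. \<bar>\<mu>\<bar> * (real N + E (u x) x + ?e))"
          using i\<Phi> Ei by (intro integral_mono approx) auto
        also have "\<dots> = \<bar>\<mu>\<bar> * (real N + (LINT x|M. E (u x) x) + ?e)"
          using Ei by (simp add: prob_space)
        also have "\<dots> \<le> \<bar>\<mu>\<bar> * (real N + real n * (C / real n ^ 3) + ?e)"
          using Eint by (intro mult_left_mono add_mono) auto
        finally show ?thesis .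
      qed
      have A: "norm ((LINT x|M. \<Phi> x x) - (LINT x|M. \<Psi> x x)) \<le> \<bar>\<mu>\<bar> * (real N + real n * (C1 / real n ^ 3) + ?e)"
      proof (rule cmp[of "\<lambda>x. x"])
        fix k assume k: "k \<in> {N..n}"
        then have "1 \<le> k" "k \<le> n" "K1 * ln (real n) \<le> real k" using N(1) N1(1) by auto
        then show "measure M {x. (T ^^ k) x \<in> annulus x (r k) \<delta>} \<le> C1 / real n ^ 3" unfolding \<delta>_def by (rule diag)
      qed (use C1 in auto)
      have B: "norm ((LINT x|M. \<Phi> y x) - (LINT x|M. \<Psi> y x)) \<le> \<bar>\<mu>\<bar> * (real N + real n * (C0 / real n ^ 3) + ?e)" for y
      proof (rule cmp[of "\<lambda>_. y"])
        fix k assume k: "k \<in> {N..n}"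
        have "measure M {x. (T ^^ k) x \<in> annulus y (r k) \<delta>} = measure (distr M M (T ^^ k)) (annulus y (r k) \<delta>)"
          by (subst measure_distr) (auto simp: space_M vimage_def)
        then show "measure M {x. (T ^^ k) x \<in> annulus y (r k) \<delta>} \<le> C0 / real n ^ 3" using ann[OF k] by (simp only: invariant_iter)
      qed (use C0 in \<open>auto simp: space_M\<close>)
      have im: "(\<lambda>y. LINT x|M. \<Phi> y x) \<in> borel_measurable M" "(\<lambda>y. LINT x|M. \<Psi> y x) \<in> borel_measurable M"
        by (rule borel_measurable_lebesgue_integral, unfold case_prod_beta, intro \<Phi>m; simp)
          (rule borel_measurable_lebesgue_integral, unfold case_prod_beta, intro \<Psi>m; simp)
      have ib: "norm (LINT x|M. \<Phi> y x) \<le> 1" "norm (LINT x|M. \<Psi> y x) \<le> 1" for y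
        by (intro norm_integral_le \<Phi>1 \<Phi>m; simp add: space_M) (intro norm_integral_le \<Psi>1 \<Psi>m; simp add: space_M)
      have B': "norm ((LINT y|M. LINT x|M. \<Phi> y x) - (LINT y|M. LINT x|M. \<Psi> y x)) \<le> \<bar>\<mu>\<bar> * (real N + real n * (C0 / real n ^ 3) + ?e)"
      proof -
        have "(LINT y|M. LINT x|M. \<Phi> y x) - (LINT y|M. LINT x|M. \<Psi> y x) = (LINT y|M. (LINT x|M. \<Phi> y x) - (LINT x|M. \<Psi> y x))"
          by (intro Bochner_Integration.integral_diff[symmetric] integrable_bounded[OF im(1) ib(1)] integrable_bounded[OF im(2) ib(2)])
        then show ?thesis using im by (simp only:) (intro norm_integral_le B borel_measurable_diff)
      qed
      have tri: "norm (p - q) \<le> norm (p - p') + norm (p' - q') + norm (q - q')" for p q p' q' :: complex by norm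
      have "norm ((LINT x|M. \<Phi> x x) - (LINT y|M. LINT x|M. \<Phi> y x))
          \<le> \<bar>\<mu>\<bar> * (real N + real n * (C1 / real n ^ 3) + ?e) + C2 / real n ^ 3 + \<bar>\<mu>\<bar> * (real N + real n * (C0 / real n ^ 3) + ?e)"
        using tri[of "LINT x|M. \<Phi> x x" "LINT y|M. LINT x|M. \<Phi> y x" "LINT x|M. \<Psi> x x" "LINT y|M. LINT x|M. \<Psi> y x"]
          A B' main unfolding \<Psi>_def decoupling_error_def by linarith
      also have "\<dots> \<le> D * (ln (real n) / \<sigma> n) + C2 / real n ^ 3"
      proof -
        have sq: "real n * (c / real n ^ 3) \<le> c * ln (real n)" if "0 \<le> c" for c
        proof -
          have "real n * (c / real n ^ 3) = c / real n ^ 2" using n by (simp add: power3_eq_cube power2_eq_square)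
          also have "\<dots> \<le> c / 1" using that one_le_power[OF n(3), of 2] by (intro divide_left_mono) (use n in auto)
          also have "\<dots> \<le> c * ln (real n)" using that ln1 mult_left_mono[OF ln1 that] by simp
          finally show ?thesis .
        qed
        have "(real N + real n * (C1 / real n ^ 3) + ?e) + (real N + real n * (C0 / real n ^ 3) + ?e)
            \<le> 2 * ((K + 2) * ln (real n)) + C1 * ln (real n) + 3 * (C0 * ln (real n))"
        proof -
          have "p + v + u + (p + u + u) \<le> 2 * p' + v' + 3 * u'" if "p \<le> p'" "v \<le> v'" "u \<le> u'" for p p' u u' v v' :: real
            using that by linarith
          from this[OF N2 sq[OF C1(2)] sq[OF C0]] show ?thesis .
        qed
        also have "\<dots> \<le> 2 * (K + 2 + 2 * (C0 + C1)) * ln (real n)"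
          using ln1 C0 C1 by (simp add: distrib_right mult.assoc)
        finally have "\<bar>\<mu>\<bar> * ((real N + real n * (C1 / real n ^ 3) + ?e) + (real N + real n * (C0 / real n ^ 3) + ?e))
            \<le> \<bar>\<mu>\<bar> * (2 * (K + 2 + 2 * (C0 + C1)) * ln (real n))" by (intro mult_left_mono) auto
        also have "\<dots> = D * (ln (real n) / \<sigma> n)" unfolding \<mu>(2) D_def by simp
        finally show ?thesis by (simp only: distrib_left)
      qed
      finally show ?case unfolding \<Phi>_def \<mu>_def .
    qed
  qed
qed

end

lemma borel_measurable_iexp: "g \<in> borel_measurable K \<Longrightarrow> (\<lambda>w. iexp (g w)) \<in> borel_measurable K"
  by measurable

lemma abs_le_half_one_plus_square: "\<bar>z\<bar> \<le> (1 + z\<^sup>2) / 2" for z :: real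
  using sum_squares_bound[of 1 "\<bar>z\<bar>"] by simp

context shrinking_targets
begin

lemma target_sum_bound: "\<bar>target_sum M T r y n x\<bar> \<le> real n"
proof -
  have "\<bar>target_sum M T r y n x\<bar> \<le> (\<Sum>k=1..n. \<bar>hit k y x - mass k y\<bar>)"
    unfolding target_sum_def by (rule sum_abs)
  also have "\<dots> \<le> (\<Sum>k=1..n. 1)"
  proof (rule sum_mono)
    fix k
    have "0 \<le> mass k y" "mass k y \<le> 1" by auto
    then show "\<bar>hit k y x - mass k y\<bar> \<le> 1" unfolding indicator_def by auto
  qed
  finally show ?thesis by simp
qed

lemma Var_eq_integral_square: "Var M (target_sum M T r y n) = (LINT x|M. (target_sum M T r y n x)\<^sup>2)"
  by (simp add: Var_def Cov_def integral_target_sum power2_eq_square)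

lemma integrable_target_sum_square: "integrable M (\<lambda>x. (target_sum M T r y n x)\<^sup>2)"
proof (rule integrable_bounded)
  show "norm ((target_sum M T r y n x)\<^sup>2) \<le> (real n)\<^sup>2" for x
    using target_sum_bound[of y n x] by (simp add: abs_le_square_iff[symmetric])
  show "(\<lambda>x. (target_sum M T r y n x)\<^sup>2) \<in> borel_measurable M" by measurable
qed

lemma target_sd_bounds: "0 \<le> target_sd M T r n y" "target_sd M T r n y \<le> real n"
  "(target_sd M T r n y)\<^sup>2 = (LINT x|M. (target_sum M T r y n x)\<^sup>2)"
proof -
  have 0: "0 \<le> Var M (target_sum M T r y n)" unfolding Var_eq_integral_square by simp
  then show "0 \<le> target_sd M T r n y" by (simp add: target_sd_def)
  show "(target_sd M T r n y)\<^sup>2 = (LINT x|M. (target_sum M T r y n x)\<^sup>2)"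
    using 0 by (simp add: target_sd_def Var_eq_integral_square)
  have "norm (Var M (target_sum M T r y n)) \<le> (real n)\<^sup>2"
    unfolding Var_eq_integral_square
    by (rule norm_integral_le) (measurable, use target_sum_bound[of y n] in \<open>simp add: abs_le_square_iff[symmetric]\<close>)
  then show "target_sd M T r n y \<le> real n"
    unfolding target_sd_def by (intro real_le_lsqrt) auto
qed

lemma target_sd_measurable: "target_sd M T r n \<in> borel_measurable M"
proof -
  have "(\<lambda>y. LINT x|M. (target_sum M T r y n x)\<^sup>2) \<in> borel_measurable M"
  proof (rule borel_measurable_lebesgue_integral)
    have "(\<lambda>w. target_sum M T r (fst w) n (snd w)) \<in> borel_measurable (M \<Otimes>\<^sub>M M)"
      by (rule target_sum_measurable_pair) auto
    then show "(\<lambda>(y, x). (target_sum M T r y n x)\<^sup>2) \<in> borel_measurable (M \<Otimes>\<^sub>M M)"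
      unfolding case_prod_beta by measurable
  qed
  then have "(\<lambda>y. sqrt (LINT x|M. (target_sum M T r y n x)\<^sup>2)) \<in> borel_measurable M" by measurable
  then show ?thesis by (simp add: target_sd_def[abs_def] Var_eq_integral_square)
qed

lemma recurrence_sum_eq: "recurrence_sum M T r n x = target_sum M T r x n x"
  by (simp add: recurrence_sum_def target_sum_def)

lemma target_sd_growth:
  obtains c \<epsilon> :: real where "0 < c" "0 < \<epsilon>"
    "eventually (\<lambda>n. \<forall>y. c * real n powr \<epsilon> \<le> target_sd M T r n y) sequentially"
proof -
  obtain c \<epsilon> where c: "0 < c" "0 < \<epsilon>" and ev: "eventually (\<lambda>n. \<forall>y. c * real n powr \<epsilon> \<le> Var M (target_sum M T r y n)) sequentially"
    using Var_target_sum_growth by blast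
  show thesis
  proof (rule that[of "sqrt c" "\<epsilon> / 2"])
    show "0 < sqrt c" "0 < \<epsilon> / 2" using c by auto
    show "eventually (\<lambda>n. \<forall>y. sqrt c * real n powr (\<epsilon> / 2) \<le> target_sd M T r n y) sequentially"
      using ev
    proof eventually_elim
      case (elim n)
      have "sqrt c * real n powr (\<epsilon> / 2) = sqrt (c * real n powr \<epsilon>)"
        by (simp add: real_sqrt_mult powr_half_sqrt_powr)
      then show ?case using elim by (simp add: target_sd_def)
    qed
  qed
qed

text \<open>The ratio hypothesis transfers the growth of the target deviations to the recurrence deviation. Division by
  zero yields zero, so a deviation that is not positive would keep the integral at least as large as the mean of \<open>W\<close>.\<close>

lemma recurrence_sd_growth:
  assumes W: "integrable M W" "AE y in M. 0 \<le> W y" "0 < (LINT y|M. W y)"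
    and ratio: "(\<lambda>n. LINT y|M. \<bar>target_sd M T r n y / recurrence_sd M T r n - W y\<bar>) \<longlonglongrightarrow> 0"
  shows "(\<lambda>n. ln (real n) / recurrence_sd M T r n) \<longlonglongrightarrow> 0" "eventually (\<lambda>n. 1 \<le> recurrence_sd M T r n) sequentially"
proof -
  define \<sigma> where "\<sigma> = recurrence_sd M T r"
  define \<kappa> where "\<kappa> = (LINT y|M. W y)"
  have \<kappa>: "0 < \<kappa>" using W(3) by (simp add: \<kappa>_def)
  obtain c \<epsilon> where c: "0 < c" "0 < \<epsilon>" and ev: "eventually (\<lambda>n. \<forall>y. c * real n powr \<epsilon> \<le> target_sd M T r n y) sequentially"
    using target_sd_growth by blast
  have si: "integrable M (\<lambda>y. target_sd M T r n y / \<sigma> n)" for n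
  proof (rule integrable_bounded)
    show "(\<lambda>y. target_sd M T r n y / \<sigma> n) \<in> borel_measurable M" using target_sd_measurable[of n] by measurable
    show "norm (target_sd M T r n y / \<sigma> n) \<le> real n / \<bar>\<sigma> n\<bar>" for y
      using target_sd_bounds(1,2)[of n y] by (auto simp: abs_divide intro!: divide_right_mono)
  qed
  define c' where "c' = c / (2 * \<kappa>)"
  have c': "0 < c'" using c \<kappa> by (simp add: c'_def)
  have low: "eventually (\<lambda>n. c' * real n powr \<epsilon> \<le> \<sigma> n) sequentially"
    using ev order_tendstoD(2)[OF ratio \<kappa>] eventually_ge_at_top[of 1]
  proof eventually_elim
    case (elim n)
    have I: "(LINT y|M. \<bar>target_sd M T r n y / \<sigma> n - W y\<bar>) < \<kappa>" using elim(2) by (simp add: \<sigma>_def)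
    have int: "integrable M (\<lambda>y. \<bar>target_sd M T r n y / \<sigma> n - W y\<bar>)" using si W(1) by (intro integrable_abs Bochner_Integration.integrable_diff)
    have pos: "0 < \<sigma> n"
    proof (rule ccontr)
      assume "\<not> 0 < \<sigma> n"
      then have neg: "target_sd M T r n y / \<sigma> n \<le> 0" for y using target_sd_bounds(1)[of n y] by (simp add: divide_nonneg_nonpos)
      have "AE y in M. W y \<le> \<bar>target_sd M T r n y / \<sigma> n - W y\<bar>" using W(2)
      proof eventually_elim
        case (elim y)
        then show ?case using neg[of y] by linarith
      qed
      then have "\<kappa> \<le> (LINT y|M. \<bar>target_sd M T r n y / \<sigma> n - W y\<bar>)"
        unfolding \<kappa>_def by (intro integral_mono_AE W(1) int)
      with I show False by simp
    qed
    have "c * real n powr \<epsilon> / \<sigma> n = (LINT y|M. c * real n powr \<epsilon> / \<sigma> n)" by (simp add: prob_space)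
    also have "\<dots> \<le> (LINT y|M. target_sd M T r n y / \<sigma> n)"
      using elim(1) pos by (intro integral_mono si) (auto intro!: divide_right_mono)
    also have "\<dots> \<le> (LINT y|M. W y + \<bar>target_sd M T r n y / \<sigma> n - W y\<bar>)"
      using si W(1) int by (intro integral_mono) auto
    also have "\<dots> = \<kappa> + (LINT y|M. \<bar>target_sd M T r n y / \<sigma> n - W y\<bar>)"
      using W(1) int by (simp add: \<kappa>_def)
    also have "\<dots> \<le> 2 * \<kappa>" using I by simp
    finally show ?case using pos \<kappa> by (simp add: c'_def field_simps)
  qed
  have "(\<lambda>n. ln (real n) / (c' * real n powr \<epsilon>)) \<longlonglongrightarrow> 0" using c' c by real_asymp
  moreover have "eventually (\<lambda>n. norm (ln (real n) / \<sigma> n) \<le> ln (real n) / (c' * real n powr \<epsilon>)) sequentially"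
    using low eventually_ge_at_top[of 1]
  proof eventually_elim
    case (elim n)
    have p: "0 < c' * real n powr \<epsilon>" using c' elim by simp
    then show ?case using elim by (auto simp: abs_divide intro!: divide_left_mono)
  qed
  ultimately show "(\<lambda>n. ln (real n) / recurrence_sd M T r n) \<longlonglongrightarrow> 0"
    unfolding \<sigma>_def[symmetric] by (rule Lim_null_comparison[rotated])
  have "filterlim (\<lambda>n. c' * real n powr \<epsilon>) at_top sequentially" using c' c by real_asymp
  then have "eventually (\<lambda>n. 1 \<le> c' * real n powr \<epsilon>) sequentially" by (simp add: filterlim_at_top)
  then show "eventually (\<lambda>n. 1 \<le> recurrence_sd M T r n) sequentially"
    using low by eventually_elim (simp add: \<sigma>_def)
qed

text \<open>After decoupling, the recurrence characteristic function is the average over \<open>y\<close> of the characteristic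
  functions of the target sums, evaluated at the random point \<open>t * target_sd / recurrence_sd\<close>. These functions are
  \<open>1\<close>-Lipschitz, because the normalised sums have variance \<open>1\<close>; so convergence in mean of the ratios suffices to
  replace the random point by \<open>t * W y\<close>, where the central limit theorem applies.\<close>

lemma recurrence_characteristic_limit:
  fixes W :: "'a \<Rightarrow> real" and t :: real
  assumes W: "integrable M W" "AE y in M. 0 \<le> W y" "0 < (LINT y|M. W y)"
    and CLT: "AE y in M. weak_conv_m (\<lambda>n. distr M borel (\<lambda>x. target_sum M T r y n x / target_sd M T r n y)) std_normal_distribution"
    and ratio: "(\<lambda>n. LINT y|M. \<bar>target_sd M T r n y / recurrence_sd M T r n - W y\<bar>) \<longlonglongrightarrow> 0"
  shows "(\<lambda>n. CLINT x|M. iexp (t / recurrence_sd M T r n * recurrence_sum M T r n x))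
           \<longlonglongrightarrow> (CLINT y|M. complex_of_real (exp (- ((t * W y)\<^sup>2 / 2))))"
proof -
  define \<sigma> where "\<sigma> = recurrence_sd M T r"
  define s where "s = target_sd M T r"
  note g = recurrence_sd_growth[OF W ratio, folded \<sigma>_def]
  have Wm [measurable]: "W \<in> borel_measurable M" using W(1) by (rule borel_measurable_integrable)
  have sm [measurable]: "s n \<in> borel_measurable M" for n unfolding s_def by (rule target_sd_measurable)
  define f where "f n y = (CLINT x|M. iexp (t / \<sigma> n * target_sum M T r y n x))" for n y
  define \<phi> where "\<phi> n y = (CLINT x|M. iexp (t * W y * (target_sum M T r y n x / s n y)))" for n y
  have Sm [measurable]: "(\<lambda>w. target_sum M T r (fst w) n (snd w)) \<in> borel_measurable (M \<Otimes>\<^sub>M M)" for n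
    by (rule target_sum_measurable_pair) auto
  have fm: "f n \<in> borel_measurable M" for n
    unfolding f_def by (rule borel_measurable_lebesgue_integral) (unfold case_prod_beta, measurable)
  have \<phi>m: "\<phi> n \<in> borel_measurable M" for n
    unfolding \<phi>_def by (rule borel_measurable_lebesgue_integral) (unfold case_prod_beta, measurable)
  have f1: "norm (f n y) \<le> 1" for n y
    unfolding f_def
    by (rule norm_integral_le) (intro borel_measurable_iexp borel_measurable_times borel_measurable_const target_sum_measurable, simp)
  have \<phi>1: "norm (\<phi> n y) \<le> 1" for n y
    unfolding \<phi>_def
    by (rule norm_integral_le)
      (intro borel_measurable_iexp borel_measurable_times borel_measurable_divide borel_measurable_const target_sum_measurable, simp)
  have lim\<phi>: "(\<lambda>n. CLINT y|M. \<phi> n y) \<longlonglongrightarrow> (CLINT y|M. complex_of_real (exp (- ((t * W y)\<^sup>2 / 2))))"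
  proof (rule integral_dominated_convergence[where w="\<lambda>_. 1"])
    show "AE y in M. (\<lambda>n. \<phi> n y) \<longlonglongrightarrow> complex_of_real (exp (- ((t * W y)\<^sup>2 / 2)))"
      using CLT
    proof eventually_elim
      case (elim y)
      have Zm: "(\<lambda>x. target_sum M T r y n x / s n y) \<in> borel_measurable M" for n by measurable
      have "(\<lambda>n. char (distr M borel (\<lambda>x. target_sum M T r y n x / s n y)) (t * W y)) \<longlonglongrightarrow> char std_normal_distribution (t * W y)"
      proof (rule levy_continuity1)
        show "real_distribution (distr M borel (\<lambda>x. target_sum M T r y n x / s n y))" for n
          by (intro real_distribution_distr Zm)
        show "real_distribution std_normal_distribution" by (rule real_dist_normal_dist)
        show "weak_conv_m (\<lambda>n. distr M borel (\<lambda>x. target_sum M T r y n x / s n y)) std_normal_distribution"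
          using elim by (simp add: s_def)
      qed
      moreover have "char (distr M borel (\<lambda>x. target_sum M T r y n x / s n y)) (t * W y) = \<phi> n y" for n
        unfolding char_def \<phi>_def using Zm by (subst integral_distr) auto
      ultimately show ?case by (simp add: char_std_normal_distribution)
    qed
  qed (use \<phi>m \<phi>1 in auto)
  have "(\<lambda>n. (CLINT y|M. f n y) - (CLINT y|M. \<phi> n y)) \<longlonglongrightarrow> 0"
  proof (rule Lim_null_comparison)
    show "(\<lambda>n. \<bar>t\<bar> * (LINT y|M. \<bar>s n y / \<sigma> n - W y\<bar>)) \<longlonglongrightarrow> 0"
      unfolding s_def \<sigma>_def by (rule tendsto_mult_right_zero[OF ratio])
    obtain c \<epsilon> where c: "0 < c" "0 < \<epsilon>" and ev: "eventually (\<lambda>n. \<forall>y. c * real n powr \<epsilon> \<le> s n y) sequentially"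
      unfolding s_def using target_sd_growth by blast
    show "eventually (\<lambda>n. norm ((CLINT y|M. f n y) - (CLINT y|M. \<phi> n y)) \<le> \<bar>t\<bar> * (LINT y|M. \<bar>s n y / \<sigma> n - W y\<bar>)) sequentially"
      using ev eventually_ge_at_top[of 1] g(2)
    proof eventually_elim
      case (elim n)
      have "0 < c * real n powr \<epsilon>" using c elim by simp
      then have s: "0 < s n y" for y using elim(1) by (metis order.strict_trans2)
      have diff: "norm (f n y - \<phi> n y) \<le> \<bar>t\<bar> * \<bar>s n y / \<sigma> n - W y\<bar>" for y
      proof -
        let ?Z = "\<lambda>x. target_sum M T r y n x / s n y"
        have Zm: "?Z \<in> borel_measurable M" by measurable
        have Z2: "integrable M (\<lambda>x. (?Z x)\<^sup>2)" "(LINT x|M. (?Z x)\<^sup>2) = 1"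
          using integrable_target_sum_square[of y n] target_sd_bounds(3)[of n y] s[of y]
          by (auto simp: power_divide s_def[symmetric])
        \<comment> \<open>The first absolute moment is at most \<open>1\<close>, because the second moment is \<open>1\<close>.\<close>
        have bnd: "\<bar>?Z x\<bar> \<le> (1 + (?Z x)\<^sup>2) / 2" for x
          by (rule abs_le_half_one_plus_square)
        have aZ: "integrable M (\<lambda>x. \<bar>?Z x\<bar>)"
          by (rule Bochner_Integration.integrable_bound[of _ "\<lambda>x. (1 + (?Z x)\<^sup>2) / 2"]) (use Z2 Zm bnd in \<open>auto intro!: AE_I2 order_trans[OF bnd]\<close>)
        have "(LINT x|M. \<bar>?Z x\<bar>) \<le> (LINT x|M. (1 + (?Z x)\<^sup>2) / 2)"
          using aZ Z2 bnd by (intro integral_mono) auto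
        also have "\<dots> = 1" using Z2 by (simp add: prob_space)
        finally have EZ: "(LINT x|M. \<bar>?Z x\<bar>) \<le> 1" .
        have i1: "integrable M (\<lambda>x. iexp (t / \<sigma> n * target_sum M T r y n x))"
          "integrable M (\<lambda>x. iexp (t * W y * ?Z x))"
          by (rule integrable_bounded[of _ 1], intro borel_measurable_iexp borel_measurable_times borel_measurable_const target_sum_measurable, simp)
            (rule integrable_bounded[of _ 1], intro borel_measurable_iexp borel_measurable_times borel_measurable_const Zm, simp)
        have "norm (f n y - \<phi> n y) = norm (LINT x|M. iexp (t / \<sigma> n * target_sum M T r y n x) - iexp (t * W y * ?Z x))"
          unfolding f_def \<phi>_def using i1 by simp
        also have "\<dots> \<le> (LINT x|M. norm (iexp (t / \<sigma> n * target_sum M T r y n x) - iexp (t * W y * ?Z x)))"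
          by (rule integral_norm_bound)
        also have "\<dots> \<le> (LINT x|M. \<bar>t\<bar> * \<bar>s n y / \<sigma> n - W y\<bar> * \<bar>?Z x\<bar>)"
        proof (rule integral_mono)
          fix x
          have "norm (iexp (t / \<sigma> n * target_sum M T r y n x) - iexp (t * W y * ?Z x)) \<le> \<bar>t / \<sigma> n * target_sum M T r y n x - t * W y * ?Z x\<bar>"
            by (rule norm_iexp_diff_le)
          also have "t / \<sigma> n * target_sum M T r y n x - t * W y * ?Z x = t * (s n y / \<sigma> n - W y) * ?Z x"
            using s[of y] elim(3) by (simp add: field_simps)
          finally show "norm (iexp (t / \<sigma> n * target_sum M T r y n x) - iexp (t * W y * ?Z x)) \<le> \<bar>t\<bar> * \<bar>s n y / \<sigma> n - W y\<bar> * \<bar>?Z x\<bar>"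
            by (simp only: abs_mult)
        qed (intro integrable_norm Bochner_Integration.integrable_diff i1, intro integrable_mult_right aZ)
        also have "\<dots> = \<bar>t\<bar> * \<bar>s n y / \<sigma> n - W y\<bar> * (LINT x|M. \<bar>?Z x\<bar>)" by simp
        also have "\<dots> \<le> \<bar>t\<bar> * \<bar>s n y / \<sigma> n - W y\<bar>" using EZ by (intro mult_left_le) auto
        finally show ?thesis .
      qed
      have si: "integrable M (\<lambda>y. s n y / \<sigma> n)"
      proof (rule integrable_bounded)
        show "norm (s n y / \<sigma> n) \<le> real n / \<bar>\<sigma> n\<bar>" for y
          unfolding s_def using target_sd_bounds(1,2)[of n y] by (auto simp: abs_divide intro!: divide_right_mono)
      qed measurable
      have fi: "integrable M (f n)" "integrable M (\<phi> n)"
        by (rule integrable_bounded[OF fm f1], rule integrable_bounded[OF \<phi>m \<phi>1])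
      have "norm ((CLINT y|M. f n y) - (CLINT y|M. \<phi> n y)) = norm (CLINT y|M. f n y - \<phi> n y)"
        using fi by simp
      also have "\<dots> \<le> (LINT y|M. norm (f n y - \<phi> n y))" by (rule integral_norm_bound)
      also have "\<dots> \<le> (LINT y|M. \<bar>t\<bar> * \<bar>s n y / \<sigma> n - W y\<bar>)"
        using fi si W(1) diff by (intro integral_mono) auto
      finally show ?case by simp
    qed
  qed
  from tendsto_add[OF tendsto_add[OF characteristic_decoupling[OF g, of t] this[unfolded f_def]] lim\<phi>]
  show ?thesis by (simp add: recurrence_sum_eq \<sigma>_def)
qed

end

section \<open>Gaussian mixtures\<close>

text \<open>The law of \<open>W x * z\<close> for independent \<open>x\<close> and standard normal \<open>z\<close>.\<close>

lemma gaussian_mixture: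
  fixes W :: "'a \<Rightarrow> real"
  assumes M: "prob_space M" and W: "W \<in> borel_measurable M"
  obtains \<nu> :: "real measure" where "real_distribution \<nu>"
    "\<And>t. char \<nu> t = (CLINT x|M. complex_of_real (exp (- ((t * W x)\<^sup>2 / 2))))"
proof -
  interpret M: prob_space M by fact
  interpret N: real_distribution std_normal_distribution by (rule real_dist_normal_dist)
  interpret P: pair_prob_space M std_normal_distribution by standard
  let ?X = "\<lambda>w. W (fst w) * snd w"
  have X: "?X \<in> borel_measurable (M \<Otimes>\<^sub>M std_normal_distribution)"
  proof (rule borel_measurable_times)
    show "(\<lambda>w. W (fst w)) \<in> borel_measurable (M \<Otimes>\<^sub>M std_normal_distribution)"
      by (rule measurable_compose[OF measurable_fst W])
    show "snd \<in> borel_measurable (M \<Otimes>\<^sub>M std_normal_distribution)"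
      using measurable_snd[of M std_normal_distribution] by simp
  qed
  show thesis
  proof (rule that[of "distr (M \<Otimes>\<^sub>M std_normal_distribution) borel ?X"])
    show "real_distribution (distr (M \<Otimes>\<^sub>M std_normal_distribution) borel ?X)"
      by (rule P.real_distribution_distr[OF X])
    fix t
    have m: "(\<lambda>w. iexp (t * ?X w)) \<in> borel_measurable (M \<Otimes>\<^sub>M std_normal_distribution)"
      by (rule borel_measurable_iexp, rule borel_measurable_times, simp, rule X)
    have i: "integrable (M \<Otimes>\<^sub>M std_normal_distribution) (\<lambda>w. iexp (t * ?X w))"
      by (rule P.integrable_const_bound[of _ 1]) (use m in auto)
    have "char (distr (M \<Otimes>\<^sub>M std_normal_distribution) borel ?X) t = (CLINT w|M \<Otimes>\<^sub>M std_normal_distribution. iexp (t * ?X w))"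
      unfolding char_def using X by (subst integral_distr) auto
    also have "\<dots> = (CLINT x|M. CLINT z|std_normal_distribution. iexp (t * ?X (x, z)))"
      by (rule P.integral_fst'[OF i, symmetric])
    also have "\<dots> = (CLINT x|M. char std_normal_distribution (t * W x))"
      by (simp add: char_def mult.assoc)
    also have "\<dots> = (CLINT x|M. complex_of_real (exp (- ((t * W x)\<^sup>2 / 2))))"
      by (simp add: char_std_normal_distribution)
    finally show "char (distr (M \<Otimes>\<^sub>M std_normal_distribution) borel ?X) t = (CLINT x|M. complex_of_real (exp (- ((t * W x)\<^sup>2 / 2))))" .
  qed
qed

lemma norm_char_normal:
  assumes s: "0 < s"
  shows "norm (char (density lborel (\<lambda>x. ennreal (normal_density a s x))) t) = exp (- (s\<^sup>2 * t\<^sup>2 / 2))"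
proof -
  interpret N: real_distribution std_normal_distribution by (rule real_dist_normal_dist)
  have "distributed std_normal_distribution lborel (\<lambda>x. x) (\<lambda>x. ennreal (normal_density 0 1 x))"
    unfolding distributed_def by (auto simp: distr_id2)
  from N.normal_density_affine[OF this, of s a] s
  have "distributed std_normal_distribution lborel (\<lambda>x. a + s * x) (\<lambda>x. ennreal (normal_density a s x))"
    by simp
  then have eq: "density lborel (\<lambda>x. ennreal (normal_density a s x)) = distr std_normal_distribution lborel (\<lambda>x. a + s * x)"
    by (simp add: distributed_def)
  have "char (density lborel (\<lambda>x. ennreal (normal_density a s x))) t = (CLINT x|std_normal_distribution. iexp (t * (a + s * x)))"
    unfolding eq char_def by (subst integral_distr) auto
  also have "\<dots> = (CLINT x|std_normal_distribution. iexp (t * a) * iexp (t * s * x))"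
    by (simp add: exp_add[symmetric] distrib_left ac_simps)
  also have "\<dots> = iexp (t * a) * char std_normal_distribution (t * s)"
    unfolding char_def by (rule integral_mult_right_zero)
  finally show ?thesis
    by (simp add: norm_mult char_std_normal_distribution norm_exp_eq_Re power_mult_distrib mult.commute del: of_real_exp)
qed

text \<open>By the two hypotheses \<open>exp (- V)\<close> has variance zero.\<close>

lemma constant_of_exponential_laplace_transform:
  fixes V :: "'a \<Rightarrow> real"
  assumes M: "prob_space M" and V: "V \<in> borel_measurable M" "AE x in M. 0 \<le> V x"
    and 1: "(LINT x|M. exp (- V x)) = exp (- b)" and 2: "(LINT x|M. exp (- (2 * V x))) = exp (- (2 * b))"
  shows "AE x in M. V x = b"
proof -
  interpret prob_space M by fact
  have i1: "integrable M (\<lambda>x. exp (- V x))"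
    by (rule integrable_const_bound[of _ 1]) (use V in auto)
  have i2: "integrable M (\<lambda>x. exp (- (2 * V x)))"
    by (rule integrable_const_bound[of _ 1]) (use V in auto)
  have sq: "(exp (- V x) - exp (- b))\<^sup>2 = exp (- (2 * V x)) - 2 * exp (- b) * exp (- V x) + exp (- (2 * b))" for x
    by (simp add: power2_diff exp_double[symmetric])
  have i3: "integrable M (\<lambda>x. (exp (- V x) - exp (- b))\<^sup>2)" unfolding sq using i1 i2 by auto
  have "(LINT x|M. (exp (- V x) - exp (- b))\<^sup>2) = exp (- (2 * b)) - 2 * exp (- b) * exp (- b) + exp (- (2 * b))"
    unfolding sq using i1 i2 1 2 by (simp add: prob_space)
  also have "\<dots> = 0" by (simp add: exp_add[symmetric])
  finally have "AE x in M. (exp (- V x) - exp (- b))\<^sup>2 = 0"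
    using i3 by (subst (asm) integral_nonneg_eq_0_iff_AE) auto
  then show ?thesis by eventually_elim simp
qed

section \<open>Recurrence on a Riemannian manifold\<close>

text \<open>Measures of sets with respect to \<open>\<mu>\<close> are at least \<open>c\<close> times those with respect to \<open>m\<close>, and at most a constant
  times their power \<open>1 - 1 / q\<close>, the reciprocal of the conjugate exponent.\<close>

lemma ahlfors_regular_density:
  fixes m :: "'a::metric_space measure"
  assumes comp: "compact (UNIV :: 'a set)" and m: "prob_space m" "sets m = sets borel"
    and between: "\<And>(u::'a) v a e. 0 \<le> a \<Longrightarrow> a \<le> dist u v \<Longrightarrow> 0 < e \<Longrightarrow> \<exists>z. dist u z = a \<and> dist z v < dist u v - a + e"
    and reg: "ahlfors_regular d m"
    and h: "h \<in> borel_measurable m" "AE x in m. c \<le> h x" "0 < c"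
    and q: "1 < q" "integrable m (\<lambda>x. \<bar>h x\<bar> powr q)"
    and \<mu>: "\<mu> = density m (\<lambda>x. ennreal (h x))" "prob_space \<mu>"
  shows "\<exists>c>0. \<forall>x r. 0 < r \<longrightarrow> r \<le> 1 \<longrightarrow> c * r ^ d \<le> measure \<mu> (ball x r)"
    and "\<exists>C>0. \<forall>x r. 0 < r \<longrightarrow> measure \<mu> (ball x r) \<le> C * r powr (real d * (1 - 1 / q))"
    and "annulus_regular \<mu>"
proof -
  interpret m: prob_space m by fact
  interpret \<mu>: prob_space \<mu> by fact
  have h0: "AE x in m. 0 \<le> h x" using h(2) by eventually_elim (use h(3) in auto)
  define H where "H = 1 + (LINT x|m. \<bar>h x\<bar> powr q)"
  have H: "0 < H" unfolding H_def by (intro add_pos_nonneg) auto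
  have e: "0 < 1 - 1 / q" using q by simp
  have upper: "measure \<mu> E \<le> H * measure m E powr (1 - 1 / q)" if "E \<in> sets borel" for E
    unfolding \<mu>(1) H_def using that m \<mu> by (intro density_measure_le_powr h h0 q) auto
  have lower: "c * measure m E \<le> measure \<mu> E" if E: "E \<in> sets borel" for E
  proof -
    have "ennreal c * emeasure m E = (\<integral>\<^sup>+x. ennreal c * indicator E x \<partial>m)"
      using E m by (simp add: nn_integral_cmult_indicator)
    also have "\<dots> \<le> (\<integral>\<^sup>+x. ennreal (h x) * indicator E x \<partial>m)"
      by (rule nn_integral_mono_AE, use h(2) in eventually_elim) (auto intro!: mult_right_mono ennreal_leI)
    also have "\<dots> = emeasure \<mu> E" unfolding \<mu>(1) using E m h by (subst emeasure_density) auto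
    finally show ?thesis using h(3) by (simp add: m.emeasure_eq_measure \<mu>.emeasure_eq_measure ennreal_mult[symmetric])
  qed
  obtain c1 C1 where c1: "0 < c1" "0 < C1" and r: "\<And>x r. 0 < r \<Longrightarrow> r \<le> 1 \<Longrightarrow> c1 * r ^ d \<le> measure m (ball x r) \<and> measure m (ball x r) \<le> C1 * r ^ d"
    using reg unfolding ahlfors_regular_def by blast
  show "\<exists>c>0. \<forall>x r. 0 < r \<longrightarrow> r \<le> 1 \<longrightarrow> c * r ^ d \<le> measure \<mu> (ball x r)"
  proof (intro exI conjI allI impI)
    show "0 < c * c1" using h(3) c1 by simp
    fix x :: 'a and r' :: real assume "0 < r'" "r' \<le> 1"
    then have "c * (c1 * r' ^ d) \<le> c * measure m (ball x r')" using r h(3) by (intro mult_left_mono) auto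
    also have "\<dots> \<le> measure \<mu> (ball x r')" by (rule lower) simp
    finally show "c * c1 * r' ^ d \<le> measure \<mu> (ball x r')" by (simp add: mult.assoc)
  qed
  show "\<exists>C>0. \<forall>x r. 0 < r \<longrightarrow> measure \<mu> (ball x r) \<le> C * r powr (real d * (1 - 1 / q))"
  proof (intro exI conjI allI impI)
    show "0 < H * C1 powr (1 - 1 / q) + 1" using H by (intro add_nonneg_pos) auto
    fix x :: 'a and r' :: real assume r': "0 < r'"
    show "measure \<mu> (ball x r') \<le> (H * C1 powr (1 - 1 / q) + 1) * r' powr (real d * (1 - 1 / q))"
    proof (cases "r' \<le> 1")
      case True
      have "measure \<mu> (ball x r') \<le> H * measure m (ball x r') powr (1 - 1 / q)" by (rule upper) simp
      also have "\<dots> \<le> H * (C1 * r' ^ d) powr (1 - 1 / q)"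
        using r[OF r' True, of x] H e by (intro mult_left_mono powr_mono2) auto
      also have "\<dots> = H * C1 powr (1 - 1 / q) * r' powr (real d * (1 - 1 / q))"
        using r' by (simp add: powr_mult powr_powr powr_realpow[symmetric])
      also have "\<dots> \<le> (H * C1 powr (1 - 1 / q) + 1) * r' powr (real d * (1 - 1 / q))"
        by (intro mult_right_mono) auto
      finally show ?thesis .
    next
      case False
      have "1 \<le> r' powr (real d * (1 - 1 / q))" using False e by (intro ge_one_powr_ge_zero mult_nonneg_nonneg) auto
      also have "\<dots> \<le> (H * C1 powr (1 - 1 / q) + 1) * r' powr (real d * (1 - 1 / q))"
        using H mult_right_mono[of 1 "H * C1 powr (1 - 1 / q) + 1" "r' powr (real d * (1 - 1 / q))"] by simp
      finally show ?thesis using \<mu>.prob_le_1[of "ball x r'"] by linarith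
    qed
  qed
  from annulus_regular_of_ahlfors[OF comp m between reg]
  obtain \<beta> C where \<beta>: "0 < \<beta>" "0 < C" and ann: "\<And>y r s \<rho>. 0 < s \<Longrightarrow> 0 < \<rho> \<Longrightarrow> \<rho> \<le> r \<Longrightarrow> \<rho> \<le> 1 \<Longrightarrow>
     measure m (annulus y r s) \<le> C * (s / \<rho>) powr \<beta>"
    unfolding annulus_regular_def by blast
  show "annulus_regular \<mu>"
    unfolding annulus_regular_def
  proof (intro exI conjI allI impI)
    show "0 < \<beta> * (1 - 1 / q)" "0 < H * C powr (1 - 1 / q)" using \<beta> e H by auto
    fix y :: 'a and r' s \<rho> :: real
    assume s: "0 < s" "0 < \<rho>" "\<rho> \<le> r'" "\<rho> \<le> 1"
    have "measure \<mu> (annulus y r' s) \<le> H * measure m (annulus y r' s) powr (1 - 1 / q)" by (rule upper) (rule annulus_borel)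
    also have "\<dots> \<le> H * (C * (s / \<rho>) powr \<beta>) powr (1 - 1 / q)"
      using ann[OF s, of y] H e by (intro mult_left_mono powr_mono2) auto
    also have "\<dots> = H * C powr (1 - 1 / q) * (s / \<rho>) powr (\<beta> * (1 - 1 / q))"
      by (simp only: powr_mult powr_powr mult.assoc)
    finally show "measure \<mu> (annulus y r' s) \<le> H * C powr (1 - 1 / q) * (s / \<rho>) powr (\<beta> * (1 - 1 / q))" .
  qed
qed

theorem theorem3p1:
  fixes A :: "('a::metric_space, 'n::finite) chart set"
    and g :: "('a, 'n) tensor"
    and vol m \<mu> :: "'a measure"
    and T :: "'a \<Rightarrow> 'a"
    and r :: "nat \<Rightarrow> real"
    and h :: "'a \<Rightarrow> real"
    and c p q \<gamma> \<upsilon> :: real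
  assumes compact: "compact (UNIV :: 'a set)"
    and manifold: "riemannian_manifold A g"
    and volume: "riemannian_volume A g vol"
    and m: "m = uniform_measure vol UNIV"
    and system: "measure_preserving_system \<mu> T"
    and decorrelation: "multiple_decorrelation \<mu> T"
    and r_pos: "\<And>n. 1 \<le> n \<Longrightarrow> 0 < r n"
    and h_measurable: "h \<in> borel_measurable m"
    and density: "\<mu> = density m (\<lambda>x. ennreal (h x))"
    and q: "2 \<le> q"
    and h_Lq: "integrable m (\<lambda>x. \<bar>h x\<bar> powr q)"
    and c: "0 < c"
    and h_lower: "AE x in m. c \<le> h x"
    and p: "1 / p + 1 / q = 1"
    and \<gamma>: "0 < \<gamma>" "\<gamma> < 1 / real CARD('n)"
    and \<upsilon>: "p / real CARD('n) < \<upsilon>"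
    and S: "condition_S \<gamma> \<upsilon> r"
    and target_CLT: "AE y in \<mu>. weak_conv_m
          (\<lambda>n. distr \<mu> borel (\<lambda>x. target_sum \<mu> T r y n x / target_sd \<mu> T r n y))
          std_normal_distribution"
    and sd_ratio: "(\<lambda>n. LINT y|\<mu>. \<bar>target_sd \<mu> T r n y / recurrence_sd \<mu> T r n
                                    - sqrt (h y) / sqrt (LINT x|\<mu>. h x)\<bar>) \<longlonglongrightarrow> 0"
  shows "(\<forall>t::real.
           (\<lambda>n. CLINT x|\<mu>. exp (\<i> * complex_of_real
                   (t / recurrence_sd \<mu> T r n * recurrence_sum \<mu> T r n x)))
           \<longlonglongrightarrow> (CLINT x|\<mu>. complex_of_real (exp (- (h x / (2 * (LINT z|\<mu>. h z))) * t\<^sup>2)))) \<and>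
         (\<exists>\<nu>. real_distribution \<nu> \<and>
           weak_conv_m (\<lambda>n. distr \<mu> borel (\<lambda>x. recurrence_sum \<mu> T r n x / recurrence_sd \<mu> T r n)) \<nu> \<and>
           (\<forall>t. char \<nu> t = (CLINT x|\<mu>. complex_of_real (exp (- (h x / (2 * (LINT z|\<mu>. h z))) * t\<^sup>2)))) \<and>
           (gaussian \<nu> \<longrightarrow> (AE x in \<mu>. h x = 1)))"
proof -
  interpret \<mu>: prob_space \<mu> using system by (simp add: measure_preserving_system_def)
  interpret riemannian A g
    using manifold by unfold_locales (auto simp: riemannian_manifold_def)
  have sv: "sets vol = sets borel" using volume by (simp add: riemannian_volume_def)
  have sm: "sets m = sets borel" unfolding m by (simp add: sv)
  have s\<mu>: "sets \<mu> = sets borel" unfolding density by (simp add: sm)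
  have spv: "space vol = UNIV" using sv by (metis sets_eq_imp_space_eq space_borel)
  have sp\<mu>: "space \<mu> = UNIV" using s\<mu> by (metis sets_eq_imp_space_eq space_borel)
  note hm [measurable] = h_measurable
  \<comment> \<open>If the volume were zero or infinite, the normalised measure \<open>m\<close> would vanish, and so would \<open>\<mu>\<close>.\<close>
  have volfin: "emeasure vol UNIV \<noteq> 0" "emeasure vol UNIV \<noteq> \<infinity>"
  proof -
    have "emeasure m UNIV \<noteq> 0"
    proof
      assume "emeasure m UNIV = 0"
      then have "UNIV \<in> null_sets m" using sm by (simp add: null_sets_def)
      then have "emeasure \<mu> UNIV = 0"
        unfolding density using absolutely_continuousI_density[of "\<lambda>x. ennreal (h x)" m] by (auto simp: absolutely_continuous_def)
      then show False using \<mu>.emeasure_space_1 sp\<mu> by simp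
    qed
    moreover have "emeasure m UNIV = emeasure vol UNIV / emeasure vol UNIV"
      unfolding m using sv by (subst emeasure_uniform_measure) auto
    ultimately show "emeasure vol UNIV \<noteq> 0" "emeasure vol UNIV \<noteq> \<infinity>"
      by (auto simp: divide_ennreal_def)
  qed
  have pm: "prob_space m" unfolding m by (rule prob_space_uniform_measure[OF volfin])
  interpret m: prob_space m by fact
  have reg: "ahlfors_regular CARD('n) m"
    using volfin by (intro ahlfors_regular_volume[OF volume compact m]) (auto simp: less_top zero_less_iff_neq_zero)
  have between: "\<exists>z. dist u z = a \<and> dist z v < dist u v - a + e" if "0 \<le> a" "a \<le> dist u v" "0 < e" for u v :: 'a and a e
    using intermediate_point[OF that] by blast
  have q1: "1 < q" using q by simp
  note dens = ahlfors_regular_density[OF compact pm sm between reg h_measurable h_lower c q1 h_Lq density \<mu>.prob_space_axioms]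
  define D where "D = real CARD('n)"
  have D: "0 < D" by (simp add: D_def)
  have pq: "1 - 1 / q = 1 / p" using p by simp
  have p0: "0 < p"
  proof -
    have "0 < 1 - 1 / q" using q1 by simp
    then show ?thesis unfolding pq by simp
  qed
  obtain Cr where Cr: "0 < Cr" and rlow: "\<And>n. 1 \<le> n \<Longrightarrow> inverse Cr * real n powr (- \<gamma>) \<le> r n"
    and rup: "\<And>n. 2 \<le> n \<Longrightarrow> r n \<le> Cr * ln (real n) powr (- \<upsilon>)"
    using S unfolding condition_S_def by blast
  interpret shrinking_targets \<mu> T "CARD('n)" r
  proof unfold_locales
    show "compact (UNIV :: 'a set)" by (rule compact)
    show "sets \<mu> = sets borel" by (rule s\<mu>)
    show "T \<in> measurable \<mu> \<mu>" "distr \<mu> \<mu> T = \<mu>" using system by (auto simp: measure_preserving_system_def)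
    show "multiple_decorrelation \<mu> T" by (rule decorrelation)
    show "\<exists>c>0. \<forall>x r. 0 < r \<longrightarrow> r \<le> 1 \<longrightarrow> c * r ^ CARD('n) \<le> \<mu>.prob (ball x r)" by (rule dens(1))
    show "annulus_regular \<mu>" by (rule dens(3))
    show "\<exists>c>0. \<exists>\<gamma>\<ge>0. \<forall>k\<ge>1. c * real k powr (- \<gamma>) \<le> r k"
      using Cr \<gamma> rlow by (intro exI[of _ "inverse Cr"] exI[of _ \<gamma>] conjI) auto
    show "\<exists>x y :: 'a. x \<noteq> y"
    proof (rule ccontr)
      assume "\<not> ?thesis"
      then have all: "B = {} \<or> B = UNIV" for B :: "'a set" by (metis UNIV_eq_I empty_iff equals0I)
      have na: "\<And>E. E \<in> sets \<mu> \<Longrightarrow> 0 < emeasure \<mu> E \<Longrightarrow> \<exists>B\<in>sets \<mu>. B \<subseteq> E \<and> 0 < emeasure \<mu> B \<and> emeasure \<mu> B < emeasure \<mu> E"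
        using system unfolding measure_preserving_system_def non_atomic_def by blast
      have "UNIV \<in> sets \<mu>" using s\<mu> by simp
      moreover have "0 < emeasure \<mu> UNIV" using \<mu>.emeasure_space_1 sp\<mu> by simp
      ultimately obtain B where "0 < emeasure \<mu> B" "emeasure \<mu> B < emeasure \<mu> UNIV" using na by blast
      then show False using all[of B] by auto
    qed
    show "\<exists>c>0. \<exists>a<1. 0 \<le> a \<and> (\<forall>k\<ge>1. \<forall>y. c * real k powr (- a) \<le> \<mu>.prob (ball y (r k)))"
    proof -
      obtain c1 where c1: "0 < c1" and low: "\<And>x r. 0 < r \<Longrightarrow> r \<le> 1 \<Longrightarrow> c1 * r ^ CARD('n) \<le> \<mu>.prob (ball x r)"
        using dens(1) by blast
      \<comment> \<open>The cap at \<open>1\<close> keeps the comparison radius in the range of the lower bound for balls.\<close>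
      define c2 where "c2 = min (inverse Cr) 1"
      have c2: "0 < c2" "c2 \<le> 1" "c2 \<le> inverse Cr" using Cr by (auto simp: c2_def)
      show ?thesis
      proof (intro exI conjI allI impI)
        show "0 < c1 * c2 ^ CARD('n)" using c1 c2 by simp
        show "\<gamma> * D < 1" using \<gamma> D by (simp add: D_def field_simps)
        show "0 \<le> \<gamma> * D" using \<gamma> D by simp
        fix k :: nat and y :: 'a assume k: "1 \<le> k"
        let ?\<rho> = "c2 * real k powr (- \<gamma>)"
        have k1: "real k powr (- \<gamma>) \<le> 1" using k \<gamma> powr_mono[of "- \<gamma>" 0 "real k"] by simp
        have "0 < ?\<rho>" using c2 k by simp
        moreover have "?\<rho> \<le> 1" using c2 k1 mult_mono[of c2 1 "real k powr (- \<gamma>)" 1] by simp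
        ultimately have "c1 * ?\<rho> ^ CARD('n) \<le> \<mu>.prob (ball y ?\<rho>)" by (rule low)
        also have "\<dots> \<le> \<mu>.prob (ball y (r k))"
        proof (rule \<mu>.finite_measure_mono)
          have "?\<rho> \<le> inverse Cr * real k powr (- \<gamma>)" using c2 by (intro mult_right_mono) auto
          also have "\<dots> \<le> r k" by (rule rlow[OF k])
          finally show "ball y ?\<rho> \<subseteq> ball y (r k)" by (rule subset_ball)
        qed (simp add: s\<mu>)
        also have "?\<rho> ^ CARD('n) = c2 ^ CARD('n) * real k powr (- (\<gamma> * D))"
          using k by (simp add: power_mult_distrib powr_realpow[symmetric] powr_powr D_def)
        finally show "c1 * c2 ^ CARD('n) * real k powr (- (\<gamma> * D)) \<le> \<mu>.prob (ball y (r k))" by (simp add: mult.assoc)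
      qed
    qed
    show "\<exists>\<kappa>>1. \<exists>C>0. \<forall>k\<ge>2. \<forall>y. \<mu>.prob (ball y (r k)) \<le> C * ln (real k) powr (- \<kappa>)"
    proof -
      obtain C1 where C1: "0 < C1" and up: "\<And>x r. 0 < r \<Longrightarrow> \<mu>.prob (ball x r) \<le> C1 * r powr (D * (1 / p))"
        using dens(2) unfolding pq D_def by blast
      show ?thesis
      proof (intro exI conjI allI impI)
        show "1 < \<upsilon> * (D * (1 / p))" using \<upsilon> p0 D by (simp add: D_def field_simps)
        show "0 < C1 * Cr powr (D * (1 / p))" using C1 Cr by simp
        fix k :: nat and y :: 'a assume k: "2 \<le> k"
        have "\<mu>.prob (ball y (r k)) \<le> C1 * r k powr (D * (1 / p))" using r_pos[of k] k by (intro up) auto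
        also have "\<dots> \<le> C1 * (Cr * ln (real k) powr (- \<upsilon>)) powr (D * (1 / p))"
          using rup[OF k] r_pos[of k] k C1 D p0 by (intro mult_left_mono powr_mono2) auto
        also have "\<dots> = C1 * Cr powr (D * (1 / p)) * ln (real k) powr (- (\<upsilon> * (D * (1 / p))))"
          by (simp add: powr_mult powr_powr)
        finally show "\<mu>.prob (ball y (r k)) \<le> C1 * Cr powr (D * (1 / p)) * ln (real k) powr (- (\<upsilon> * (D * (1 / p))))" .
      qed
    qed
  qed
  define I where "I = (LINT x|\<mu>. h x)"
  define W where "W y = sqrt (h y) / sqrt I" for y
  have h\<mu> [measurable]: "h \<in> borel_measurable \<mu>" unfolding density by simp
  have hlow: "AE x in \<mu>. c \<le> h x" unfolding density using h_lower by (subst AE_density) (auto elim: eventually_mono)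
  have hpos: "AE x in m. 0 \<le> h x" using h_lower by eventually_elim (use c in auto)
  have hint: "integrable \<mu> h"
  proof -
    have "integrable m (\<lambda>x. h x * h x)"
    proof (rule Bochner_Integration.integrable_bound)
      show "integrable m (\<lambda>x. 1 + \<bar>h x\<bar> powr q)" using h_Lq by simp
      show "AE x in m. norm (h x * h x) \<le> norm (1 + \<bar>h x\<bar> powr q)"
      proof (rule AE_I2)
        fix x
        have "\<bar>h x\<bar> * \<bar>h x\<bar> \<le> 1 + \<bar>h x\<bar> powr q"
        proof (cases "1 \<le> \<bar>h x\<bar>")
          case True
          have "\<bar>h x\<bar> * \<bar>h x\<bar> = \<bar>h x\<bar> powr 2" using True by (simp add: power2_eq_square)
          also have "\<dots> \<le> \<bar>h x\<bar> powr q" using True q by (intro powr_mono) auto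
          finally show ?thesis by simp
        next
          case False
          then have "\<bar>h x\<bar> * \<bar>h x\<bar> \<le> 1" by (intro mult_le_one) auto
          moreover have "0 \<le> \<bar>h x\<bar> powr q" by simp
          ultimately show ?thesis by linarith
        qed
        then show "norm (h x * h x) \<le> norm (1 + \<bar>h x\<bar> powr q)" by (simp add: abs_mult)
      qed
    qed measurable
    then show ?thesis unfolding density using hpos by (subst integrable_density) auto
  qed
  have I: "0 < I"
  proof -
    have "c = (LINT x|\<mu>. c)" by (simp add: \<mu>.prob_space)
    also have "\<dots> \<le> I" unfolding I_def by (intro integral_mono_AE hint hlow) simp
    finally show ?thesis using c by simp
  qed
  have Wm [measurable]: "W \<in> borel_measurable \<mu>" unfolding W_def by measurable
  have W0: "AE y in \<mu>. 0 \<le> W y" using hlow by eventually_elim (use c I in \<open>auto simp: W_def\<close>)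
  have Wint: "integrable \<mu> W"
  proof (rule Bochner_Integration.integrable_bound)
    show "integrable \<mu> (\<lambda>y. (1 + h y) / sqrt I)" using hint by simp
    show "AE y in \<mu>. norm (W y) \<le> norm ((1 + h y) / sqrt I)"
      using hlow
    proof eventually_elim
      case (elim y)
      have "sqrt (h y) \<le> 1 + h y" using elim c sqrt_le_D by (intro real_le_lsqrt) (auto simp: power2_eq_square algebra_simps)
      then show ?case using elim c I by (auto simp: W_def abs_divide intro!: divide_right_mono)
    qed
  qed measurable
  have Wpos: "0 < (LINT y|\<mu>. W y)"
  proof -
    have "0 < sqrt c / sqrt I" using c I by simp
    also have "sqrt c / sqrt I = (LINT y|\<mu>. sqrt c / sqrt I)" by (simp add: \<mu>.prob_space)
    also have "\<dots> \<le> (LINT y|\<mu>. W y)"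
      by (rule integral_mono_AE[OF _ Wint], simp, use hlow in eventually_elim) (use I in \<open>auto simp: W_def intro!: divide_right_mono\<close>)
    finally show ?thesis .
  qed
  have W2: "AE y in \<mu>. exp (- ((t * W y)\<^sup>2 / 2)) = exp (- (h y / (2 * I)) * t\<^sup>2)" for t
    using hlow by eventually_elim (use c I in \<open>simp add: W_def power_mult_distrib power_divide ac_simps\<close>)
  have L: "(CLINT y|\<mu>. complex_of_real (exp (- ((t * W y)\<^sup>2 / 2)))) = (CLINT x|\<mu>. complex_of_real (exp (- (h x / (2 * I)) * t\<^sup>2)))" for t
  proof (rule integral_cong_AE)
    show "AE y in \<mu>. complex_of_real (exp (- ((t * W y)\<^sup>2 / 2))) = complex_of_real (exp (- (h y / (2 * I)) * t\<^sup>2))"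
      using W2[of t] by eventually_elim simp
  qed measurable
  have ratio: "(\<lambda>n. LINT y|\<mu>. \<bar>target_sd \<mu> T r n y / recurrence_sd \<mu> T r n - W y\<bar>) \<longlonglongrightarrow> 0"
    using sd_ratio unfolding W_def I_def .
  have lim: "(\<lambda>n. CLINT x|\<mu>. iexp (t / recurrence_sd \<mu> T r n * recurrence_sum \<mu> T r n x))
      \<longlonglongrightarrow> (CLINT x|\<mu>. complex_of_real (exp (- (h x / (2 * I)) * t\<^sup>2)))" for t
    using recurrence_characteristic_limit[OF Wint W0 Wpos target_CLT ratio, of t] unfolding L .
  obtain \<nu> where \<nu>: "real_distribution \<nu>" "\<And>t. char \<nu> t = (CLINT x|\<mu>. complex_of_real (exp (- (h x / (2 * I)) * t\<^sup>2)))"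
    using gaussian_mixture[OF \<mu>.prob_space_axioms Wm] unfolding L by blast
  have Rm: "(\<lambda>x. recurrence_sum \<mu> T r n x / recurrence_sd \<mu> T r n) \<in> borel_measurable \<mu>" for n
    unfolding recurrence_sum_eq by (intro borel_measurable_divide target_sum_measurable_pair) auto
  have weak: "weak_conv_m (\<lambda>n. distr \<mu> borel (\<lambda>x. recurrence_sum \<mu> T r n x / recurrence_sd \<mu> T r n)) \<nu>"
  proof (rule levy_continuity[OF _ \<nu>(1)])
    show "real_distribution (distr \<mu> borel (\<lambda>x. recurrence_sum \<mu> T r n x / recurrence_sd \<mu> T r n))" for n
      by (rule \<mu>.real_distribution_distr[OF Rm])
    fix t
    have "char (distr \<mu> borel (\<lambda>x. recurrence_sum \<mu> T r n x / recurrence_sd \<mu> T r n)) t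
        = (CLINT x|\<mu>. iexp (t / recurrence_sd \<mu> T r n * recurrence_sum \<mu> T r n x))" for n
      unfolding char_def using Rm[of n] by (subst integral_distr) auto
    then show "(\<lambda>n. char (distr \<mu> borel (\<lambda>x. recurrence_sum \<mu> T r n x / recurrence_sd \<mu> T r n)) t) \<longlonglongrightarrow> char \<nu> t"
      using lim[of t] by (simp add: \<nu>(2))
  qed
  have const: "AE x in \<mu>. h x = 1" if gauss: "gaussian \<nu>"
  proof -
    obtain a s where s: "0 < s" "\<nu> = density lborel (\<lambda>x. ennreal (normal_density a s x))"
      using gauss unfolding gaussian_def by blast
    define V where "V x = h x / (2 * I)" for x
    have Vm [measurable]: "V \<in> borel_measurable \<mu>" unfolding V_def by measurable
    have V0: "AE x in \<mu>. 0 \<le> V x" using hlow by eventually_elim (use c I in \<open>simp add: V_def\<close>)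
    \<comment> \<open>Taking moduli removes the mean of the normal law.\<close>
    have lap: "(LINT x|\<mu>. exp (- V x * t\<^sup>2)) = exp (- (s\<^sup>2 * t\<^sup>2 / 2))" for t
    proof -
      have "norm (char \<nu> t) = norm (complex_of_real (LINT x|\<mu>. exp (- V x * t\<^sup>2)))"
        unfolding \<nu>(2) V_def integral_complex_of_real ..
      also have "\<dots> = (LINT x|\<mu>. exp (- V x * t\<^sup>2))"
        unfolding norm_of_real by (intro abs_of_nonneg Bochner_Integration.integral_nonneg) simp
      finally show ?thesis using norm_char_normal[OF s(1), of a t] by (simp add: s(2))
    qed
    have "AE x in \<mu>. V x = s\<^sup>2 / 2"
    proof (rule constant_of_exponential_laplace_transform[OF \<mu>.prob_space_axioms Vm V0])
      show "(LINT x|\<mu>. exp (- V x)) = exp (- (s\<^sup>2 / 2))" using lap[of 1] by simp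
      show "(LINT x|\<mu>. exp (- (2 * V x))) = exp (- (2 * (s\<^sup>2 / 2)))" using lap[of "sqrt 2"] by (simp add: mult.commute)
    qed
    then have "AE x in \<mu>. h x = s\<^sup>2 * I" by eventually_elim (use I in \<open>simp add: V_def field_simps\<close>)
    note h\<mu>_const = this
    have hm: "AE x in m. h x = s\<^sup>2 * I"
    proof -
      from h\<mu>_const have "AE x in m. 0 < ennreal (h x) \<longrightarrow> h x = s\<^sup>2 * I"
        unfolding density by (subst (asm) AE_density) auto
      with h_lower show ?thesis by eventually_elim (use c in simp)
    qed
    have "1 = emeasure \<mu> UNIV" using \<mu>.emeasure_space_1 by (simp add: sp\<mu>)
    also have "\<dots> = (\<integral>\<^sup>+x. ennreal (h x) * indicator UNIV x \<partial>m)"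
      unfolding density using sm by (intro emeasure_density) auto
    also have "\<dots> = (\<integral>\<^sup>+x. ennreal (h x) \<partial>m)" by simp
    also have "\<dots> = (\<integral>\<^sup>+x. ennreal (s\<^sup>2 * I) \<partial>m)" by (rule nn_integral_cong_AE, use hm in eventually_elim) simp
    also have "\<dots> = ennreal (s\<^sup>2 * I)" by (simp add: m.emeasure_space_1)
    finally have "s\<^sup>2 * I = 1" by simp
    with h\<mu>_const show ?thesis by simp
  qed
  show ?thesis
    using lim \<nu> weak const unfolding I_def by blast
qed

end
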